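(* Let $i_1,i_2\in\{0,1,\dots,m\}$, let $\psi_1,\psi_2:[t,T]\to\mathbb{R}$ be twice continuously differentiable nonrandom functions, and let $\{\phi_j(x)\}_{j=0}^{\infty}$ be the complete orthonormal system of Legendre polynomials in $L_2([t,T])$. Then for the iterated Stratonovich stochastic integral $$J^{*}[\psi^{(2)}]_{T,t}={\int\limits_t^{*}}^{T}\psi_2(t_2){\int\limits_t^{*}}^{t_2}\psi_1(t_1)\,d\mathbf{w}_{t_1}^{(i_1)}d\mathbf{w}_{t_2}^{(i_2)}$$ one has $$\lim_{p_1\to\infty}\limsup_{p_2\to\infty}\mathsf{M}\left\{\left(J^{*}[\psi^{(2)}]_{T,t}-\sum_{j_1=0}^{p_1}\sum_{j_2=0}^{p_2}C_{j_2j_1}\zeta_{j_1}^{(i_1)}\zeta_{j_2}^{(i_2)}\right)^{2}\right\}=0 .$$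
   Context: Setting: $(\Omega,\mathrm{F},\mathsf{P})$ is a complete probability space, $\{\mathrm{F}_s,\ s\in[0,T]\}$ a nondecreasing right-continuous family of $\sigma$-algebras of $\mathrm{F}$, $\mathbf{f}_s$ a standard $m$-dimensional Wiener process with respect to this family with independent components $\mathbf{f}_s^{(i)}$, $i=1,\dots,m$; $0\le t<T$; $\mathbf{w}_s^{(i)}=\mathbf{f}_s^{(i)}$ for $i=1,\dots,m$ and $\mathbf{w}_s^{(0)}=s$. $\mathsf{M}$ denotes expectation. Iterated Stratonovich integral: with $\eta_s=\int_t^s\psi_1(\tau)d\mathbf{w}_\tau^{(i_1)}$, for $i_2\neq0$ the integral $J^{*}[\psi^{(2)}]_{T,t}$ is the mean-square limit of $\sum_j\psi_2(\tau_j)\frac12(\eta_{\tau_j}+\eta_{\tau_{j+1}})(\mathbf{w}_{\tau_{j+1}}^{(i_2)}-\mathbf{w}_{\tau_j}^{(i_2)})$ over partitions of $[t,T]$ with mesh tending to $0$; for $i_2=0$ it is $\int_t^T\psi_2(s)\eta_s\,ds$. Legendre system: $\phi_j(x)=\sqrt{\frac{2j+1}{T-t}}\,P_j\!\left(\left(x-\frac{T+t}{2}\right)\frac{2}{T-t}\right)$, $j=0,1,2,\dots$, where $P_j$ is the $j$-th Legendre polynomial. $\zeta_j^{(i)}=\int_t^T\phi_j(s)\,d\mathbf{w}_s^{(i)}$ and $C_{j_2j_1}=\int_t^T\psi_2(t_2)\phi_{j_2}(t_2)\int_t^{t_2}\psi_1(t_1)\phi_{j_1}(t_1)\,dt_1dt_2$.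 *)

theory Defs
  imports "HOL-Probability.Probability" "HOL-Computational_Algebra.Polynomial"
begin

text \<open>
  The filtration and the process are only constrained on the time interval \<open>[0, T]\<close>, and only the
  components \<open>f 1, \<dots>, f m\<close> of \<open>f\<close> are constrained.
\<close>

locale wiener_setting = prob_space M + complete_measure M
  for M :: "'a measure" +
  fixes F :: "real \<Rightarrow> 'a measure"
    and T :: real
    and m :: nat
    and f :: "nat \<Rightarrow> real \<Rightarrow> 'a \<Rightarrow> real"
  assumes filtration_subalgebra: "\<And>s. s \<in> {0..T} \<Longrightarrow> subalgebra M (F s)"
    and filtration_mono: "\<And>s u. 0 \<le> s \<Longrightarrow> s \<le> u \<Longrightarrow> u \<le> T \<Longrightarrow> sets (F s) \<subseteq> sets (F u)"
    and filtration_right_continuous: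
      "\<And>s. s \<in> {0..<T} \<Longrightarrow> sets (F s) = (\<Inter>u\<in>{s<..T}. sets (F u))"
    and wiener_adapted:
      "\<And>i s. i \<in> {1..m} \<Longrightarrow> s \<in> {0..T} \<Longrightarrow> f i s \<in> borel_measurable (F s)"
    and wiener_start: "\<And>i. i \<in> {1..m} \<Longrightarrow> AE \<omega> in M. f i 0 \<omega> = 0"
    and wiener_continuous:
      "\<And>i. i \<in> {1..m} \<Longrightarrow> AE \<omega> in M. continuous_on {0..T} (\<lambda>s. f i s \<omega>)"
    and wiener_increment_normal:
      "\<And>i s u. i \<in> {1..m} \<Longrightarrow> 0 \<le> s \<Longrightarrow> s < u \<Longrightarrow> u \<le> T \<Longrightarrow>
        distributed M lborel (\<lambda>\<omega>. f i u \<omega> - f i s \<omega>) (normal_density 0 (sqrt (u - s)))"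
    and wiener_increment_indep:
      "\<And>s u. 0 \<le> s \<Longrightarrow> s < u \<Longrightarrow> u \<le> T \<Longrightarrow>
        indep_set (sets (F s))
          (sets (vimage_algebra (space M) (\<lambda>\<omega>. \<lambda>i\<in>{1..m}. f i u \<omega> - f i s \<omega>)
            (Pi\<^sub>M {1..m} (\<lambda>_. borel))))"
    and wiener_components_indep:
      "indep_vars (\<lambda>_. Pi\<^sub>M {0..T} (\<lambda>_. borel)) (\<lambda>i \<omega>. \<lambda>s\<in>{0..T}. f i s \<omega>) {1..m}"

definition partition_of :: "real \<Rightarrow> real \<Rightarrow> nat \<Rightarrow> (nat \<Rightarrow> real) \<Rightarrow> bool" where
  "partition_of a b N \<tau> \<longleftrightarrow> \<tau> 0 = a \<and> \<tau> N = b \<and> (\<forall>j<N. \<tau> j < \<tau> (Suc j))"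

text \<open>The filter of partitions of \<open>[a, b]\<close> along which the mesh tends to \<open>0\<close>.\<close>

definition mesh_to_0 :: "real \<Rightarrow> real \<Rightarrow> (nat \<times> (nat \<Rightarrow> real)) filter" where
  "mesh_to_0 a b = (INF \<delta>\<in>{0<..}.
     principal {(N, \<tau>). partition_of a b N \<tau> \<and> (\<forall>j<N. \<tau> (Suc j) - \<tau> j < \<delta>)})"

text \<open>
  Mean squares are taken as \<open>ennreal\<close>-valued integrals, so that a random variable without a second
  moment has mean square \<open>\<infinity>\<close> (the Bochner integral would give \<open>0\<close>).
\<close>

definition mean_square :: "'a measure \<Rightarrow> ('a \<Rightarrow> real) \<Rightarrow> ennreal" where
  "mean_square M X = (\<integral>\<^sup>+\<omega>. ennreal ((X \<omega>)\<^sup>2) \<partial>M)"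

definition ms_tendsto ::
  "'a measure \<Rightarrow> ('b \<Rightarrow> 'a \<Rightarrow> real) \<Rightarrow> ('a \<Rightarrow> real) \<Rightarrow> 'b filter \<Rightarrow> bool" where
  "ms_tendsto M X Y G \<longleftrightarrow>
     Y \<in> borel_measurable M \<and> ((\<lambda>k. mean_square M (\<lambda>\<omega>. X k \<omega> - Y \<omega>)) \<longlongrightarrow> 0) G"

definition step_fun :: "nat \<Rightarrow> (nat \<Rightarrow> real) \<Rightarrow> (nat \<Rightarrow> real) \<Rightarrow> real \<Rightarrow> real" where
  "step_fun N \<tau> c s = (\<Sum>j<N. c j * indicator {\<tau> j..<\<tau> (Suc j)} s)"

definition step_integral ::
  "(real \<Rightarrow> 'a \<Rightarrow> real) \<Rightarrow> nat \<Rightarrow> (nat \<Rightarrow> real) \<Rightarrow> (nat \<Rightarrow> real) \<Rightarrow> 'a \<Rightarrow> real" where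
  "step_integral w N \<tau> c \<omega> = (\<Sum>j<N. c j * (w (\<tau> (Suc j)) \<omega> - w (\<tau> j) \<omega>))"

text \<open>
  \<open>X\<close> is a version of the Ito integral over \<open>[a, b]\<close> of the nonrandom function \<open>g\<close> with respect to
  the Wiener process \<open>w\<close>: the mean-square limit of the integrals of step functions that approximate
  \<open>g\<close> in \<open>L\<^sub>2([a, b])\<close>.
\<close>

definition is_ito_integral ::
  "'a measure \<Rightarrow> (real \<Rightarrow> 'a \<Rightarrow> real) \<Rightarrow> real \<Rightarrow> real \<Rightarrow> (real \<Rightarrow> real) \<Rightarrow> ('a \<Rightarrow> real) \<Rightarrow> bool" where
  "is_ito_integral M w a b g X \<longleftrightarrow>
     (\<exists>N \<tau> c. (\<forall>n::nat. partition_of a b (N n) (\<tau> n)) \<and>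
        (\<lambda>n. \<integral>\<^sup>+s\<in>{a..b}. ennreal ((g s - step_fun (N n) (\<tau> n) (c n) s)\<^sup>2) \<partial>lborel)
          \<longlonglongrightarrow> 0 \<and>
        ms_tendsto M (\<lambda>n. step_integral w (N n) (\<tau> n) (c n)) X sequentially)"

text \<open>The process \<open>w\<^sup>(\<^sup>i\<^sup>)\<close>, with \<open>w\<^sup>(\<^sup>0\<^sup>)\<close> being time.\<close>

definition wproc :: "(nat \<Rightarrow> real \<Rightarrow> 'a \<Rightarrow> real) \<Rightarrow> nat \<Rightarrow> real \<Rightarrow> 'a \<Rightarrow> real" where
  "wproc f i s \<omega> = (if i = 0 then s else f i s \<omega>)"

text \<open>
  The process \<open>s \<mapsto> \<integral>\<^sub>t\<^sup>s g dw\<^sup>(\<^sup>i\<^sup>)\<close> for \<open>s \<in> [t, T]\<close>. An Ito integral is only determined up to a null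
  set for each \<open>s\<close>; as usual, a modification with almost surely continuous paths is taken, so that
  the process can be integrated pathwise in time.
\<close>

definition stoch_int ::
  "'a measure \<Rightarrow> (nat \<Rightarrow> real \<Rightarrow> 'a \<Rightarrow> real) \<Rightarrow> nat \<Rightarrow> real \<Rightarrow> real \<Rightarrow> (real \<Rightarrow> real)
    \<Rightarrow> real \<Rightarrow> 'a \<Rightarrow> real" where
  "stoch_int M f i t T g =
     (if i = 0 then (\<lambda>s \<omega>. LBINT r:{t..s}. g r)
      else (SOME \<eta>. (\<forall>s\<in>{t..T}. is_ito_integral M (wproc f i) t s g (\<eta> s)) \<and>
                    (AE \<omega> in M. continuous_on {t..T} (\<lambda>s. \<eta> s \<omega>))))"

definition stratonovich_sum ::
  "(real \<Rightarrow> real) \<Rightarrow> (real \<Rightarrow> 'a \<Rightarrow> real) \<Rightarrow> (real \<Rightarrow> 'a \<Rightarrow> real)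
    \<Rightarrow> nat \<times> (nat \<Rightarrow> real) \<Rightarrow> 'a \<Rightarrow> real" where
  "stratonovich_sum \<psi> \<eta> w = (\<lambda>(N, \<tau>) \<omega>.
     \<Sum>j<N. \<psi> (\<tau> j) * ((\<eta> (\<tau> j) \<omega> + \<eta> (\<tau> (Suc j)) \<omega>) / 2) * (w (\<tau> (Suc j)) \<omega> - w (\<tau> j) \<omega>))"

definition stratonovich2 ::
  "'a measure \<Rightarrow> (nat \<Rightarrow> real \<Rightarrow> 'a \<Rightarrow> real) \<Rightarrow> real \<Rightarrow> real \<Rightarrow> (real \<Rightarrow> real) \<Rightarrow> (real \<Rightarrow> real)
    \<Rightarrow> nat \<Rightarrow> nat \<Rightarrow> 'a \<Rightarrow> real" where
  "stratonovich2 M f t T \<psi>1 \<psi>2 i1 i2 =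
     (let \<eta> = stoch_int M f i1 t T \<psi>1 in
      if i2 = 0 then (\<lambda>\<omega>. LBINT s:{t..T}. \<psi>2 s * \<eta> s \<omega>)
      else (SOME J. ms_tendsto M (stratonovich_sum \<psi>2 \<eta> (wproc f i2)) J (mesh_to_0 t T)))"

text \<open>The Legendre polynomials, by Rodrigues' formula.\<close>

definition legendre_poly :: "nat \<Rightarrow> real poly" where
  "legendre_poly j = smult (1 / (2 ^ j * fact j)) ((pderiv ^^ j) ([:-1, 0, 1:] ^ j))"

definition legendre_phi :: "real \<Rightarrow> real \<Rightarrow> nat \<Rightarrow> real \<Rightarrow> real" where
  "legendre_phi t T j x =
     sqrt ((2 * real j + 1) / (T - t)) * poly (legendre_poly j) ((x - (T + t) / 2) * (2 / (T - t)))"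

definition zeta ::
  "'a measure \<Rightarrow> (nat \<Rightarrow> real \<Rightarrow> 'a \<Rightarrow> real) \<Rightarrow> real \<Rightarrow> real \<Rightarrow> nat \<Rightarrow> nat \<Rightarrow> 'a \<Rightarrow> real" where
  "zeta M f t T i j = stoch_int M f i t T (legendre_phi t T j) T"

definition fourier_coeff ::
  "real \<Rightarrow> real \<Rightarrow> (real \<Rightarrow> real) \<Rightarrow> (real \<Rightarrow> real) \<Rightarrow> nat \<Rightarrow> nat \<Rightarrow> real" where
  "fourier_coeff t T \<psi>1 \<psi>2 j2 j1 =
     (LBINT t2:{t..T}. \<psi>2 t2 * legendre_phi t T j2 t2 *
        (LBINT t1:{t..t2}. \<psi>1 t1 * legendre_phi t T j1 t1))"

text \<open>Derivatives at the end points are one-sided.\<close>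

definition C2_on :: "real \<Rightarrow> real \<Rightarrow> (real \<Rightarrow> real) \<Rightarrow> bool" where
  "C2_on a b g \<longleftrightarrow> (\<exists>g' g''.
     (\<forall>x\<in>{a..b}. (g has_real_derivative g' x) (at x within {a..b})) \<and>
     (\<forall>x\<in>{a..b}. (g' has_real_derivative g'' x) (at x within {a..b})) \<and>
     continuous_on {a..b} g'')"

end

theory Submission
  imports Defs
begin

text \<open>
  The Stratonovich sums and the partial sums of the Fourier-Legendre expansion are both bilinear
  expressions \<open>X = \<Sum> W\<^sub>1(a) W\<^sub>2(b)\<close> in Wiener integrals (ordinary integrals for the time
  component) of nonrandom functions. By Isserlis' formula the mean square of \<open>X\<close> is at most a
  constant times \<open>u\<^sup>2 + \<parallel>k\<parallel>\<^sup>2\<close>, where \<open>k(x, y) = \<Sum> a(x) b(y)\<close> is the kernel of \<open>X\<close> and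
  \<open>u = \<Sum> \<integral> a b\<close> its trace; this holds for step functions and passes to \<open>L\<^sub>2\<close>-limits by Fatou's
  lemma. For the Stratonovich sums the kernel tends to \<open>K(x, y) = \<psi>\<^sub>1(x) \<psi>\<^sub>2(y) 1(x < y)\<close> and the
  trace to \<open>\<integral> \<psi>\<^sub>1 \<psi>\<^sub>2 / 2\<close>, so the theorem reduces to the same two limits for the partial Fourier
  sums. The kernel limit is Parseval's identity in each variable. The trace is \<open>\<Sum> C\<^sub>j\<^sub>j\<close>, which
  integration by parts again reduces to Parseval's identity. Of the Legendre system only
  orthonormality and completeness matter.
\<close>

section \<open>Legendre polynomials\<close>

text \<open>The kernel alone does not control the mean square: if \<open>i1 = i2\<close> is a Wiener
  index, the diagonal contributes although it is a null set of the square. This is where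
  Stratonovich and Ito sums differ, so the trace is carried as a separate number. The average of the
  two end-point values of \<eta> gives each diagonal cell the weight one half, which is the origin
  of half the integral of \<psi>1 * \<psi>2. A product of two mean-square limits need not be a
  mean-square limit of the products. Wiener integrals are therefore represented by almost sure
  limits, which are compatible with products, while the quantitative bound is carried along by lower
  semicontinuity. The integrals in the statement are values of a choice operator. Existence of a
  continuous version of the inner integral, and of the limit over all partitions, has to be proved
  before their defining properties may be used. The order of the limits matters: once
  \<open>p1 \<le> p2\<close> the trace of the double sum no longer depends on \<open>p2\<close>, so
  only the kernel error moves in the inner limit.\<close>

lemma integral_poly_pderiv:
  "integral {-1..1} (poly (pderiv p)) = poly p 1 - poly p (-1 :: real)"
proof -
  have "(poly (pderiv p) has_integral (poly p 1 - poly p (-1))) {-1..1::real}"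
    by (rule fundamental_theorem_of_calculus)
       (auto intro!: has_field_derivative_at_within poly_DERIV
         simp flip: has_real_derivative_iff_has_vector_derivative)
  then show ?thesis by (rule integral_unique)
qed

lemma poly_integrable_on: "poly p integrable_on {a..b::real}"
  by (intro integrable_continuous_real continuous_intros)

lemma integral_poly_add:
  "integral {a..b} (poly (p + q)) = integral {a..b} (poly p) + integral {a..b::real} (poly q)"
  using integral_add[OF poly_integrable_on[of p a b] poly_integrable_on[of q a b]]
  by (simp add: poly_add[abs_def])

lemma integral_poly_smult: "integral {a..b} (poly (smult c p)) = c * integral {a..b::real} (poly p)"
  by (simp add: poly_smult[abs_def])

lemma integral_poly_by_parts:
  assumes "poly (p * q) 1 = (0::real)" and "poly (p * q) (-1) = 0"
  shows "integral {-1..1} (poly (pderiv p * q)) = - integral {-1..1} (poly (p * pderiv q))"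
  using integral_poly_pderiv[of "p * q"] assms
  by (simp only: pderiv_mult integral_poly_add mult.commute[of q])

text \<open>Each differentiation costs at most one factor \<open>r\<close>, by the product rule
  applied to \<open>r ^ Suc k * q\<close>.\<close>

lemma power_dvd_higher_pderiv:
  assumes "i \<le> j"
  shows "(r :: real poly) ^ (j - i) dvd (pderiv ^^ i) (r ^ j)"
  using assms
proof (induction i)
  case (Suc i)
  then have "r ^ Suc (j - Suc i) dvd (pderiv ^^ i) (r ^ j)"
    by (simp add: Suc_diff_Suc del: power_Suc)
  then obtain q where q: "(pderiv ^^ i) (r ^ j) = r ^ Suc (j - Suc i) * q" by (auto simp: dvd_def)
  have "pderiv (r ^ Suc k * q) = r ^ k * (r * pderiv q + smult (of_nat (Suc k)) (pderiv r) * q)" for k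
    by (simp only: pderiv_mult pderiv_power_Suc) (simp add: algebra_simps)
  then show ?case by (simp add: q del: power_Suc)
qed simp

abbreviation rodrigues_base :: "real poly" where
  "rodrigues_base \<equiv> [:-1, 0, 1:]"

text \<open>This removes the boundary terms when the derivatives in Rodrigues' formula are moved to
  the other factor.\<close>

lemma poly_higher_pderiv_rodrigues_eq_0:
  assumes "i < n" and "x = 1 \<or> x = -1"
  shows "poly ((pderiv ^^ i) (rodrigues_base ^ n)) x = 0"
proof -
  obtain q where "(pderiv ^^ i) (rodrigues_base ^ n) = rodrigues_base ^ (n - i) * q"
    using power_dvd_higher_pderiv[of i n rodrigues_base] assms by (auto simp: dvd_def)
  then show ?thesis using assms by auto
qed

lemma integral_rodrigues_by_parts:
  assumes "i \<le> n"
  shows "integral {-1..1} (poly ((pderiv ^^ i) (rodrigues_base ^ n) * q)) =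
    (-1) ^ i * integral {-1..1} (poly (rodrigues_base ^ n * (pderiv ^^ i) q))"
  using assms
proof (induction i arbitrary: q)
  case (Suc i)
  have "integral {-1..1} (poly ((pderiv ^^ Suc i) (rodrigues_base ^ n) * q)) =
    - integral {-1..1} (poly ((pderiv ^^ i) (rodrigues_base ^ n) * pderiv q))"
    using Suc.prems
    by (simp, intro integral_poly_by_parts) (auto simp: poly_higher_pderiv_rodrigues_eq_0)
  also have "\<dots> = (-1) ^ Suc i * integral {-1..1} (poly (rodrigues_base ^ n * (pderiv ^^ Suc i) q))"
    using Suc.IH[of "pderiv q"] Suc.prems by (simp only: funpow_Suc_right o_apply power_Suc)
  finally show ?case .
qed simp

lemma higher_pderiv_eq_0:
  assumes "degree (q :: real poly) < j"
  shows "(pderiv ^^ j) q = 0"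
  using assms by (intro poly_eqI) (simp add: coeff_higher_pderiv coeff_eq_0)

lemma degree_rodrigues_power: "degree (rodrigues_base ^ j) = 2 * j"
  by (subst degree_power_eq) auto

lemma lead_coeff_rodrigues_power: "coeff (rodrigues_base ^ j) (2 * j) = 1"
  using lead_coeff_power[of rodrigues_base j] by (simp add: degree_rodrigues_power)

text \<open>The positive leading coefficient forces the exact degree and later permits the division
  in \<open>legendre_poly_span\<close>.\<close>

lemma degree_legendre_poly: "degree (legendre_poly j) = j"
  and coeff_legendre_poly_pos: "coeff (legendre_poly j) j > 0"
proof -
  show *: "coeff (legendre_poly j) j > 0"
    using lead_coeff_rodrigues_power[of j]
    by (auto simp: legendre_poly_def coeff_higher_pderiv mult_2 intro!: divide_pos_pos mult_pos_pos pochhammer_pos)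
  have "degree (legendre_poly j) \<le> j"
    by (intro degree_le)
       (auto simp: legendre_poly_def coeff_higher_pderiv degree_rodrigues_power intro!: coeff_eq_0)
  then show "degree (legendre_poly j) = j"
    using * le_degree[of "legendre_poly j" j] by auto
qed

text \<open>All \<open>j\<close> derivatives of Rodrigues' formula pass to \<open>q\<close>, and the
  \<open>j\<close>-th derivative of \<open>q\<close> is zero.\<close>

lemma integral_legendre_poly_orthogonal:
  assumes "degree q < j"
  shows "integral {-1..1} (poly (legendre_poly j * q)) = 0"
proof -
  have "poly 0 = (\<lambda>x::real. 0)" by auto
  then show ?thesis
    using integral_rodrigues_by_parts[of j j q] higher_pderiv_eq_0[OF assms]
    by (simp add: legendre_poly_def integral_poly_smult)
qed

text \<open>Integrate by parts with the factor \<open>1\<close> as derivative of \<open>x\<close>,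
  and write the resulting \<open>x^2\<close> as \<open>(x^2 - 1) + 1\<close>.\<close>

lemma integral_rodrigues_power_Suc:
  "(2 * real j + 3) * integral {-1..1} (poly (rodrigues_base ^ Suc j)) =
    - 2 * (real j + 1) * integral {-1..1} (poly (rodrigues_base ^ j))"
proof -
  let ?I = "\<lambda>p. integral {-1..1} (poly p)"
  have "?I (pderiv [:0, 1:] * rodrigues_base ^ Suc j) = - ?I ([:0, 1:] * pderiv (rodrigues_base ^ Suc j))"
    by (rule integral_poly_by_parts) auto
  moreover have "pderiv [:0, 1:] * rodrigues_base ^ Suc j = rodrigues_base ^ Suc j"
    by (simp add: pderiv_pCons)
  moreover have "[:0, 1:] * pderiv (rodrigues_base ^ Suc j) =
      smult (2 * (real j + 1)) (rodrigues_base ^ Suc j + rodrigues_base ^ j)"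
    by (rule poly_ext) (simp add: pderiv_power_Suc pderiv_pCons algebra_simps del: power_Suc,
        simp add: algebra_simps)
  ultimately show ?thesis
    by (simp add: integral_poly_smult integral_poly_add algebra_simps del: power_Suc)
qed

lemma integral_legendre_poly_square:
  "integral {-1..1} (poly (legendre_poly j * legendre_poly j)) = 2 / (2 * real j + 1)"
proof -
  let ?I = "\<lambda>p. integral {-1..1} (poly p)"
  \<comment> \<open>The left side is the squared norm after \<open>j\<close> integrations by parts:
    one factor has lost all its derivatives, the other has become the constant
    \<open>(2j)! / (2^j j!)\<close>. The recurrence above gives the induction.\<close>
  have *: "(-1) ^ j * fact (2 * j) / (2 ^ j * fact j)\<^sup>2 * ?I (rodrigues_base ^ j) = 2 / (2 * real j + 1)"
  proof (induction j)
    case 0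
    then show ?case by simp
  next
    case (Suc j)
    let ?c = "(-1) ^ j * fact (2 * j) / (2 ^ j * fact j)\<^sup>2 :: real"
    have I: "?I (rodrigues_base ^ Suc j) = - 2 * (real j + 1) / (2 * real j + 3) * ?I (rodrigues_base ^ j)"
      using integral_rodrigues_power_Suc[of j] by (simp add: field_simps del: power_Suc)
    have "(-1) ^ Suc j * fact (2 * Suc j) / (2 ^ Suc j * fact (Suc j))\<^sup>2 * (- 2 * (real j + 1) / (2 * real j + 3))
        = (2 * real j + 1) / (2 * real j + 3) * ?c"
      by (simp add: divide_simps power2_eq_square) (simp add: algebra_simps)
    then have "(-1) ^ Suc j * fact (2 * Suc j) / (2 ^ Suc j * fact (Suc j))\<^sup>2 * ?I (rodrigues_base ^ Suc j)
        = (2 * real j + 1) / (2 * real j + 3) * (?c * ?I (rodrigues_base ^ j))"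
      unfolding I by (metis (no_types, lifting) mult.assoc)
    also have "\<dots> = 2 / (2 * real (Suc j) + 1)"
      unfolding Suc by (simp add: divide_simps add_eq_0_iff) (simp add: algebra_simps)
    finally show ?case .
  qed
  have "(pderiv ^^ j) (legendre_poly j) = smult (1 / (2 ^ j * fact j)) ((pderiv ^^ (2 * j)) (rodrigues_base ^ j))"
    by (simp add: legendre_poly_def higher_pderiv_smult mult_2 funpow_add)
  moreover have "(pderiv ^^ (2 * j)) (rodrigues_base ^ j) = [:fact (2 * j):]"
  proof (intro poly_eqI)
    fix n
    show "coeff ((pderiv ^^ (2 * j)) (rodrigues_base ^ j)) n = coeff [:fact (2 * j):] n"
      using lead_coeff_rodrigues_power[of j]
      by (cases n) (auto simp: coeff_higher_pderiv pochhammer_fact degree_rodrigues_power coeff_eq_0)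
  qed
  ultimately have D: "(pderiv ^^ j) (legendre_poly j) = [:fact (2 * j) / (2 ^ j * fact j):]"
    by simp
  have "?I (legendre_poly j * legendre_poly j) =
      1 / (2 ^ j * fact j) * ?I ((pderiv ^^ j) (rodrigues_base ^ j) * legendre_poly j)"
    by (subst (1) legendre_poly_def) (simp add: integral_poly_smult)
  also have "\<dots> = 1 / (2 ^ j * fact j) * ((-1) ^ j * (fact (2 * j) / (2 ^ j * fact j) * ?I (rodrigues_base ^ j)))"
    by (simp add: integral_rodrigues_by_parts D integral_poly_smult)
  also have "\<dots> = (-1) ^ j * fact (2 * j) / (2 ^ j * fact j)\<^sup>2 * ?I (rodrigues_base ^ j)"
    by (simp add: power2_eq_square)
  finally show ?thesis using * by simp
qed

text \<open>A suitable multiple of the Legendre polynomial of degree \<open>Suc n\<close> cancels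
  the top coefficient, and the induction hypothesis takes the rest.\<close>

lemma legendre_poly_span:
  "degree p \<le> n \<Longrightarrow> \<exists>c. p = (\<Sum>j\<le>n. smult (c j) (legendre_poly j))"
proof (induction n arbitrary: p)
  case 0
  have "legendre_poly 0 = 1" by (simp add: legendre_poly_def)
  moreover obtain a where "p = [:a:]" using 0 by (metis degree_eq_zeroE le_zero_eq)
  ultimately have "p = (\<Sum>j\<le>0. smult a (legendre_poly j))" by simp
  then show ?case by (rule exI[of _ "\<lambda>_. a"])
next
  case (Suc n)
  let ?P = "legendre_poly (Suc n)"
  define a where "a = coeff p (Suc n) / coeff ?P (Suc n)"
  have "degree (p - smult a ?P) \<le> n"
  proof (intro degree_le allI impI)
    fix i assume "n < i"
    show "coeff (p - smult a ?P) i = 0"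
    proof (cases "i = Suc n")
      case True
      then show ?thesis using coeff_legendre_poly_pos[of "Suc n"] by (simp add: a_def)
    next
      case False
      then show ?thesis using \<open>n < i\<close> Suc.prems by (simp add: coeff_eq_0 degree_legendre_poly)
    qed
  qed
  from Suc.IH[OF this] obtain c where c: "p - smult a ?P = (\<Sum>j\<le>n. smult (c j) (legendre_poly j))"
    by blast
  have "p = (\<Sum>j\<le>Suc n. smult ((c(Suc n := a)) j) (legendre_poly j))"
    using c by (simp add: diff_eq_eq)
  then show ?case by (rule exI[of _ "c(Suc n := a)"])
qed

section \<open>Bounded measurable functions\<close>

text \<open>A class closed under sums, products and tensor products, all of whose members are
  integrable for a finite measure. Integrability conditions thus reduce to the structural rules
  \<open>bm_intros\<close>.\<close>

definition bounded_measurable :: "'a measure \<Rightarrow> ('a \<Rightarrow> real) \<Rightarrow> bool" where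
  "bounded_measurable M g \<longleftrightarrow> g \<in> borel_measurable M \<and> (\<exists>c. \<forall>x\<in>space M. \<bar>g x\<bar> \<le> c)"

lemma bounded_measurableI:
  "g \<in> borel_measurable M \<Longrightarrow> (\<And>x. x \<in> space M \<Longrightarrow> \<bar>g x\<bar> \<le> c) \<Longrightarrow> bounded_measurable M g"
  by (auto simp: bounded_measurable_def)

named_theorems bm_intros

lemma bm_measurable [measurable_dest]: "bounded_measurable M g \<Longrightarrow> g \<in> borel_measurable M"
  by (simp add: bounded_measurable_def)

lemma bm_const [bm_intros]: "bounded_measurable M (\<lambda>x. c)"
  by (auto simp: bounded_measurable_def)

lemma bm_add [bm_intros]:
  assumes "bounded_measurable M g" "bounded_measurable M h"
  shows "bounded_measurable M (\<lambda>x. g x + h x)"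
proof -
  from assms obtain c d where "\<forall>x\<in>space M. \<bar>g x\<bar> \<le> c" "\<forall>x\<in>space M. \<bar>h x\<bar> \<le> d"
    by (auto simp: bounded_measurable_def)
  then show ?thesis
    using assms by (intro bounded_measurableI[of _ _ "c + d"]) (auto simp: bounded_measurable_def intro!: abs_triangle_ineq[THEN order_trans] add_mono)
qed

lemma bm_mult [bm_intros]:
  assumes "bounded_measurable M g" "bounded_measurable M h"
  shows "bounded_measurable M (\<lambda>x. g x * h x)"
proof -
  from assms obtain c d where "\<forall>x\<in>space M. \<bar>g x\<bar> \<le> c" "\<forall>x\<in>space M. \<bar>h x\<bar> \<le> d"
    by (auto simp: bounded_measurable_def)
  then show ?thesis
    using assms by (intro bounded_measurableI[of _ _ "\<bar>c\<bar> * \<bar>d\<bar>"])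
      (auto simp: bounded_measurable_def abs_mult intro!: mult_mono intro: order_trans[OF _ abs_ge_self])
qed

lemma bm_cmult: "bounded_measurable M g \<Longrightarrow> bounded_measurable M (\<lambda>x. c * g x)"
  by (intro bm_intros)

lemma bm_diff [bm_intros]:
  assumes "bounded_measurable M g" "bounded_measurable M h"
  shows "bounded_measurable M (\<lambda>x. g x - h x)"
  using bm_add[OF assms(1) bm_cmult[OF assms(2), of "-1"]] by simp

lemma bm_power [bm_intros]: "bounded_measurable M g \<Longrightarrow> bounded_measurable M (\<lambda>x. g x ^ n)"
  by (induction n) (auto intro: bm_intros)

lemma bm_sum [bm_intros]:
  "(\<And>i. i \<in> I \<Longrightarrow> bounded_measurable M (g i)) \<Longrightarrow> bounded_measurable M (\<lambda>x. \<Sum>i\<in>I. g i x)"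
  by (induction I rule: infinite_finite_induct) (auto intro: bm_intros)

lemma bm_fst [bm_intros]: "bounded_measurable M g \<Longrightarrow> bounded_measurable (M \<Otimes>\<^sub>M N) (\<lambda>z. g (fst z))"
  unfolding bounded_measurable_def by (auto simp: space_pair_measure)

lemma bm_snd [bm_intros]: "bounded_measurable N g \<Longrightarrow> bounded_measurable (M \<Otimes>\<^sub>M N) (\<lambda>z. g (snd z))"
  unfolding bounded_measurable_def by (auto simp: space_pair_measure)

lemma (in finite_measure) bm_integrable: "bounded_measurable M g \<Longrightarrow> integrable M g"
  unfolding bounded_measurable_def by (auto intro!: integrable_const_bound AE_I2)

text \<open>Keeps the class stable when a variable is integrated out, so that inner integrals in
  Fubini arguments can be estimated by monotonicity.\<close>

lemma (in finite_measure) bm_lebesgue_integral: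
  assumes "bounded_measurable (N \<Otimes>\<^sub>M M) k"
  shows "bounded_measurable N (\<lambda>x. \<integral>y. k (x, y) \<partial>M)"
proof -
  from assms obtain c where c: "\<forall>z\<in>space (N \<Otimes>\<^sub>M M). \<bar>k z\<bar> \<le> c" and [measurable]: "k \<in> borel_measurable (N \<Otimes>\<^sub>M M)"
    by (auto simp: bounded_measurable_def)
  show ?thesis
  proof (rule bounded_measurableI[of _ _ "\<bar>c\<bar> * measure M (space M)"])
    fix x assume x: "x \<in> space N"
    have "bounded_measurable M (\<lambda>y. k (x, y))"
      by (rule bounded_measurableI[of _ _ c])
         (use x c in \<open>auto simp: space_pair_measure intro!: measurable_compose[OF measurable_Pair1' \<open>k \<in> _\<close>]\<close>)
    then have *: "integrable M (\<lambda>y. k (x, y))" by (rule bm_integrable)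
    have "\<bar>\<integral>y. k (x, y) \<partial>M\<bar> \<le> (\<integral>y. \<bar>k (x, y)\<bar> \<partial>M)" by (rule integral_abs_bound)
    also have "\<dots> \<le> (\<integral>y. \<bar>c\<bar> \<partial>M)"
      using x c * by (intro integral_mono) (auto simp: space_pair_measure, metis abs_ge_self mem_Sigma_iff order_trans)
    finally show "\<bar>\<integral>y. k (x, y) \<partial>M\<bar> \<le> \<bar>c\<bar> * measure M (space M)" by (simp add: mult.commute)
  qed measurable
qed

text \<open>Stands in for the triangle inequality of L2 without square roots; it is the source of
  most factors 2 below.\<close>

lemma (in finite_measure) integral_square_add_le:
  assumes [bm_intros]: "bounded_measurable M g" "bounded_measurable M h"
  shows "(\<integral>x. (g x + h x)\<^sup>2 \<partial>M) \<le> 2 * (\<integral>x. (g x)\<^sup>2 \<partial>M) + 2 * (\<integral>x. (h x)\<^sup>2 \<partial>M)"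
proof -
  have "(\<integral>x. (g x + h x)\<^sup>2 \<partial>M) \<le> (\<integral>x. 2 * (g x)\<^sup>2 + 2 * (h x)\<^sup>2 \<partial>M)"
  proof (intro integral_mono bm_integrable bm_intros)
    fix x
    show "(g x + h x)\<^sup>2 \<le> 2 * (g x)\<^sup>2 + 2 * (h x)\<^sup>2"
      using sum_squares_bound[of "g x" "h x"] by (simp add: power2_sum)
  qed
  also have "\<dots> = 2 * (\<integral>x. (g x)\<^sup>2 \<partial>M) + 2 * (\<integral>x. (h x)\<^sup>2 \<partial>M)"
    by (subst Bochner_Integration.integral_add) (auto intro!: bm_integrable bm_intros)
  finally show ?thesis .
qed

text \<open>The Cauchy-Schwarz inequality, from the nonnegativity in \<open>r\<close> of the
  quadratic polynomial \<open>r\<^sup>2 * a - 2 * r * b + c\<close>.\<close>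

lemma (in finite_measure) integral_product_square_le:
  assumes [bm_intros]: "bounded_measurable M g" "bounded_measurable M h"
  shows "(\<integral>x. g x * h x \<partial>M)\<^sup>2 \<le> (\<integral>x. (g x)\<^sup>2 \<partial>M) * (\<integral>x. (h x)\<^sup>2 \<partial>M)"
proof -
  define a b c where "a = (\<integral>x. (g x)\<^sup>2 \<partial>M)" and "b = (\<integral>x. g x * h x \<partial>M)" and "c = (\<integral>x. (h x)\<^sup>2 \<partial>M)"
  have q: "0 \<le> r\<^sup>2 * a - 2 * r * b + c" for r
  proof -
    have "0 \<le> (\<integral>x. (r * g x - h x)\<^sup>2 \<partial>M)" by simp
    also have "\<dots> = (\<integral>x. r\<^sup>2 * (g x)\<^sup>2 - 2 * r * (g x * h x) + (h x)\<^sup>2 \<partial>M)"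
      by (simp add: power2_diff power_mult_distrib algebra_simps)
    also have "\<dots> = r\<^sup>2 * a - 2 * r * b + c"
      unfolding a_def b_def c_def
      by (subst Bochner_Integration.integral_add Bochner_Integration.integral_diff integral_mult_right_zero,
          (auto intro!: bm_integrable bm_intros)[2])+ simp
    finally show ?thesis .
  qed
  have "0 \<le> a" "0 \<le> c" by (simp_all add: a_def c_def)
  show ?thesis unfolding a_def[symmetric] b_def[symmetric] c_def[symmetric]
  proof (cases "a = 0")
    case True
    have "b = 0"
    proof (rule ccontr)
      assume "b \<noteq> 0"
      \<comment> \<open>For \<open>a = 0\<close> the polynomial is linear, and at this point its
        value is -1.\<close>
      with q[of "(c + 1) / (2 * b)"] True show False by simp
    qed
    then show "b\<^sup>2 \<le> a * c" using True by simp
  next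
    case False
    then show "b\<^sup>2 \<le> a * c"
      \<comment> \<open>The minimum point of the polynomial.\<close>
      using q[of "b / a"] \<open>0 \<le> a\<close> by (simp add: field_simps power2_eq_square)
  qed
qed

text \<open>Pythagoras with arbitrary coefficients \<open>d\<close>. Taking the Fourier coefficients
  gives Bessel's inequality; nonnegativity of the last sum says that no other choice approximates
  better.\<close>

lemma (in finite_measure) integral_square_diff_orthonormal:
  assumes [simp]: "finite I" and h: "bounded_measurable M h"
    and e: "\<And>i. i \<in> I \<Longrightarrow> bounded_measurable M (e i)"
    and orth: "\<And>i j. i \<in> I \<Longrightarrow> j \<in> I \<Longrightarrow> (\<integral>x. e i x * e j x \<partial>M) = (if i = j then 1 else 0)"
  shows "(\<integral>x. (h x - (\<Sum>i\<in>I. d i * e i x))\<^sup>2 \<partial>M) =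
    (\<integral>x. (h x)\<^sup>2 \<partial>M) - (\<Sum>i\<in>I. (\<integral>x. h x * e i x \<partial>M)\<^sup>2) + (\<Sum>i\<in>I. (d i - (\<integral>x. h x * e i x \<partial>M))\<^sup>2)"
proof -
  let ?S = "\<lambda>x. \<Sum>i\<in>I. d i * e i x"
  note [bm_intros] = h e
  have hS: "(\<integral>x. h x * ?S x \<partial>M) = (\<Sum>i\<in>I. d i * (\<integral>x. h x * e i x \<partial>M))"
    by (simp add: sum_distrib_left mult.left_commute[of "h _"])
       (subst Bochner_Integration.integral_sum; auto intro!: bm_integrable bm_intros)
  have "(\<integral>x. ?S x * ?S x \<partial>M) = (\<integral>x. (\<Sum>i\<in>I. \<Sum>j\<in>I. d i * d j * (e i x * e j x)) \<partial>M)"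
    by (simp add: sum_product algebra_simps)
  also have "\<dots> = (\<Sum>i\<in>I. \<Sum>j\<in>I. d i * d j * (if i = j then 1 else 0))"
    by (subst Bochner_Integration.integral_sum, auto intro!: bm_integrable bm_intros sum.cong)
       (subst Bochner_Integration.integral_sum, auto intro!: bm_integrable bm_intros sum.cong simp: orth)
  also have "\<dots> = (\<Sum>i\<in>I. (d i)\<^sup>2)"
    by (auto intro!: sum.cong simp: power2_eq_square if_distrib sum.delta cong: if_cong)
  finally have SS: "(\<integral>x. ?S x * ?S x \<partial>M) = (\<Sum>i\<in>I. (d i)\<^sup>2)" .
  have "(\<integral>x. (h x - ?S x)\<^sup>2 \<partial>M) = (\<integral>x. (h x)\<^sup>2 - 2 * (h x * ?S x) + ?S x * ?S x \<partial>M)"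
    by (intro Bochner_Integration.integral_cong refl) (simp add: power2_eq_square[of "?S _"] power2_diff)
  also have "\<dots> = (\<integral>x. (h x)\<^sup>2 \<partial>M) - 2 * (\<integral>x. h x * ?S x \<partial>M) + (\<integral>x. ?S x * ?S x \<partial>M)"
    by (subst Bochner_Integration.integral_add, (intro bm_integrable bm_intros; assumption)+,
        subst Bochner_Integration.integral_diff, (intro bm_integrable bm_intros; assumption)+) simp
  also have "\<dots> = (\<integral>x. (h x)\<^sup>2 \<partial>M) - (\<Sum>i\<in>I. (\<integral>x. h x * e i x \<partial>M)\<^sup>2) + (\<Sum>i\<in>I. (d i - (\<integral>x. h x * e i x \<partial>M))\<^sup>2)"
    unfolding hS SS by (simp add: power2_diff sum.distrib sum_subtractf sum_distrib_left algebra_simps)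
  finally show ?thesis .
qed

lemma bm_pair_integral_mult:
  assumes "finite_measure M" "finite_measure N" and [bm_intros]: "bounded_measurable M g" "bounded_measurable N h"
  shows "(\<integral>z. g (fst z) * h (snd z) \<partial>(M \<Otimes>\<^sub>M N)) = (\<integral>x. g x \<partial>M) * (\<integral>y. h y \<partial>N)"
proof -
  interpret M: finite_measure M by fact
  interpret N: finite_measure N by fact
  interpret P: pair_sigma_finite M N ..
  interpret MN: finite_measure "M \<Otimes>\<^sub>M N" by (intro finite_measure_pair_measure assms)
  have "integrable (M \<Otimes>\<^sub>M N) (\<lambda>z. g (fst z) * h (snd z))"
    by (intro MN.bm_integrable bm_intros)
  from P.integral_fst'[OF this] show ?thesis by simp
qed

section \<open>Fourier-Legendre series on an interval\<close>

locale interval =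
  fixes t T :: real
  assumes t_less_T: "t < T"
begin

abbreviation \<mu> :: "real measure" where
  "\<mu> \<equiv> restrict_space lborel {t..T}"

abbreviation \<mu>2 :: "(real \<times> real) measure" where
  "\<mu>2 \<equiv> \<mu> \<Otimes>\<^sub>M \<mu>"

lemma space_mu: "space \<mu> = {t..T}"
  by (simp add: space_restrict_space)

sublocale mu: finite_measure \<mu>
  by (rule finite_measureI)
     (simp add: emeasure_restrict_space space_restrict_space emeasure_lborel_Icc_eq)

sublocale mu2: finite_measure \<mu>2
  by (intro finite_measure_pair_measure mu.finite_measure_axioms)

sublocale mu_pair: pair_sigma_finite \<mu> \<mu> ..

lemma measure_mu: "measure \<mu> {t..T} = T - t"
  using t_less_T by (simp add: measure_restrict_space)

lemma measurable_mu_ident [measurable]: "(\<lambda>x. x) \<in> borel_measurable \<mu>"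
  by (rule measurable_restrict_space1) simp

lemma bm_continuous: "continuous_on {t..T} g \<Longrightarrow> bounded_measurable \<mu> g"
proof -
  assume g: "continuous_on {t..T} g"
  then have "bounded (g ` {t..T})"
    by (intro compact_imp_bounded compact_continuous_image) auto
  then obtain c where "\<forall>x\<in>{t..T}. \<bar>g x\<bar> \<le> c" by (auto simp: bounded_iff)
  moreover have "g \<in> borel_measurable \<mu>"
    using borel_measurable_continuous_on_restrict[OF g]
    by (simp cong: measurable_cong_sets add: sets_restrict_space)
  ultimately show ?thesis by (intro bounded_measurableI[of _ _ c]) (auto simp: space_mu)
qed

lemma bm_indicator [bm_intros]: "A \<in> sets borel \<Longrightarrow> bounded_measurable \<mu> (\<lambda>x. indicator A x)"
  by (rule bounded_measurableI[of _ _ 1])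
     (auto intro!: measurable_restrict_space1 split: split_indicator)

lemma integral_mu: "(\<integral>x. (g x :: real) \<partial>\<mu>) = (LBINT x:{t..T}. g x)"
  unfolding set_lebesgue_integral_def by (rule integral_restrict_space) simp

lemma set_integral_continuous:
  fixes g :: "real \<Rightarrow> real"
  assumes "continuous_on {t..T} g" "s \<in> {t..T}"
  shows "(LBINT x:{t..s}. g x) = integral {t..s} g"
  by (rule set_borel_integral_eq_integral(2), rule borel_integrable_atLeastAtMost')
     (use assms in \<open>auto intro: continuous_on_subset\<close>)

lemma integral_mu_continuous:
  fixes g :: "real \<Rightarrow> real"
  shows
  "continuous_on {t..T} g \<Longrightarrow> (\<integral>x. g x \<partial>\<mu>) = integral {t..T} g"
  using set_integral_continuous[of g T] t_less_T by (simp add: integral_mu)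

text \<open>Step functions live on half-open intervals and primitives on closed ones; the two differ
  by the null set \<open>{b}\<close>.\<close>

lemma integral_mu_indicator:
  fixes g :: "real \<Rightarrow> real"
  assumes "continuous_on {t..T} g" "a \<in> {t..T}" "b \<in> {t..T}"
  shows "(\<integral>x. indicator {a..<b} x * g x \<partial>\<mu>) = integral {a..b} g"
proof -
  have "(\<integral>x. indicator {a..<b} x * g x \<partial>\<mu>) = (LBINT x:{a..b}. g x)"
    unfolding integral_mu set_lebesgue_integral_def
  proof (rule integral_cong_AE)
    have "g \<in> borel_measurable \<mu>" using bm_continuous[OF assms(1)] by measurable
    \<comment> \<open>Nothing is known about \<open>g\<close> outside \<open>[t, T]\<close>, so
      measurability on the whole line is obtained for its cut-off only.\<close>
    then have [measurable]: "(\<lambda>x. indicator {t..T} x *\<^sub>R g x) \<in> borel_measurable lborel"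
      by (simp add: borel_measurable_restrict_space_iff)
    have "(\<lambda>x. indicator {a..<b} x * (indicator {t..T} x *\<^sub>R g x)) \<in> borel_measurable lborel" by measurable
    then show "(\<lambda>x. indicator {t..T} x *\<^sub>R (indicator {a..<b} x * g x)) \<in> borel_measurable lborel"
      by (simp add: mult_ac)
    have "(\<lambda>x. indicator {a..b} x * (indicator {t..T} x *\<^sub>R g x)) \<in> borel_measurable lborel" by measurable
    moreover have "(\<lambda>x. indicator {a..b} x * (indicator {t..T} x *\<^sub>R g x)) = (\<lambda>x. indicator {a..b} x *\<^sub>R g x)"
      using assms by (auto split: split_indicator)
    ultimately show "(\<lambda>x. indicator {a..b} x *\<^sub>R g x) \<in> borel_measurable lborel" by simp
    show "AE x in lborel. indicator {t..T} x *\<^sub>R (indicator {a..<b} x * g x) = indicator {a..b} x *\<^sub>R g x"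
      using AE_lborel_singleton[of b] by eventually_elim (use assms in \<open>auto split: split_indicator\<close>)
  qed
  also have "\<dots> = integral {a..b} g"
    by (rule set_borel_integral_eq_integral(2), rule borel_integrable_atLeastAtMost')
       (use assms in \<open>auto intro: continuous_on_subset\<close>)
  finally show ?thesis .
qed

abbreviation \<phi> :: "nat \<Rightarrow> real \<Rightarrow> real" where
  "\<phi> \<equiv> legendre_phi t T"

lemma continuous_on_phi [continuous_intros]: "continuous_on A (\<phi> j)"
  unfolding legendre_phi_def by (intro continuous_intros)

lemma bm_phi [bm_intros]: "bounded_measurable \<mu> (\<phi> j)"
  by (intro bm_continuous continuous_intros)

lemma integral_poly_affine:
  "integral {t..T} (\<lambda>x. poly p ((x - (T + t) / 2) * (2 / (T - t)))) =
    (T - t) / 2 * integral {-1..1} (poly p)"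
proof -
  have "(poly p has_integral integral {-1..1} (poly p)) (cbox (-1) 1)"
    using poly_integrable_on[of p "-1" 1] by (simp add: has_integral_integral)
  from has_integral_affinity'[OF this, of "2 / (T - t)" "- (T + t) / (T - t)"] t_less_T
  have "((\<lambda>x. poly p ((2 / (T - t)) * x - (T + t) / (T - t))) has_integral
      integral {-1..1} (poly p) / (2 / (T - t))) {(-1 - - (T + t) / (T - t)) / (2 / (T - t))..(1 - - (T + t) / (T - t)) / (2 / (T - t))}"
    by (simp add: field_simps)
  also have "(-1 - - (T + t) / (T - t)) / (2 / (T - t)) = t"
    using t_less_T by (simp add: field_simps)
  also have "(1 - - (T + t) / (T - t)) / (2 / (T - t)) = T"
    using t_less_T by (simp add: field_simps)
  also have "(\<lambda>x. poly p ((2 / (T - t)) * x - (T + t) / (T - t))) =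
      (\<lambda>x. poly p ((x - (T + t) / 2) * (2 / (T - t))))"
    by (simp add: algebra_simps add_divide_distrib)
  finally show ?thesis by (simp add: integral_unique)
qed

lemma phi_orthonormal: "(\<integral>x. \<phi> i x * \<phi> j x \<partial>\<mu>) = (if i = j then 1 else 0)"
proof -
  have eq: "(\<lambda>x. \<phi> i x * \<phi> j x) = (\<lambda>x. (sqrt ((2 * real i + 1) / (T - t)) * sqrt ((2 * real j + 1) / (T - t))) *
      poly (legendre_poly i * legendre_poly j) ((x - (T + t) / 2) * (2 / (T - t))))"
    by (simp add: legendre_phi_def mult_ac)
  have "(\<integral>x. \<phi> i x * \<phi> j x \<partial>\<mu>) = integral {t..T} (\<lambda>x. \<phi> i x * \<phi> j x)"
    by (intro integral_mu_continuous continuous_intros)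
  also have "\<dots> = sqrt ((2 * real i + 1) / (T - t)) * sqrt ((2 * real j + 1) / (T - t)) *
      ((T - t) / 2 * integral {-1..1} (poly (legendre_poly i * legendre_poly j)))"
    by (simp only: eq integral_mult_right integral_poly_affine)
  also have "\<dots> = (if i = j then 1 else 0)"
  proof (cases "i = j")
    case True
    have "sqrt ((2 * real j + 1) / (T - t)) * sqrt ((2 * real j + 1) / (T - t)) = (2 * real j + 1) / (T - t)"
      using t_less_T by simp
    then show ?thesis
      using True t_less_T by (simp only: integral_legendre_poly_square) (simp add: divide_simps, simp add: algebra_simps)
  next
    case False
    then have "integral {-1..1} (poly (legendre_poly i * legendre_poly j)) = 0"
      using integral_legendre_poly_orthogonal[of "legendre_poly i" j]
        integral_legendre_poly_orthogonal[of "legendre_poly j" i]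
      by (cases "i < j") (auto simp: degree_legendre_poly mult.commute)
    then show ?thesis using False by simp
  qed
  finally show ?thesis .
qed

text \<open>Weierstrass' theorem on \<open>[-1, 1]\<close>, transported by the affine map, with the
  polynomial rewritten in the Legendre basis.\<close>

lemma phi_uniformly_dense:
  assumes g: "continuous_on {t..T} g" and "\<epsilon> > 0"
  obtains n d where "\<And>x. x \<in> {t..T} \<Longrightarrow> \<bar>g x - (\<Sum>j\<le>n. d j * \<phi> j x)\<bar> < \<epsilon>"
proof -
  let ?u = "\<lambda>x. (x - (T + t) / 2) * (2 / (T - t))"
  let ?v = "\<lambda>z. z * ((T - t) / 2) + (T + t) / 2"
  have v: "?v z \<in> {t..T}" if "z \<in> {-1..1}" for z
  proof -
    have "-1 * ((T - t) / 2) \<le> z * ((T - t) / 2)" "z * ((T - t) / 2) \<le> 1 * ((T - t) / 2)"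
      using that t_less_T by (intro mult_right_mono; simp)+
    then show ?thesis by (simp add: field_simps)
  qed
  have u: "?u x \<in> {-1..1}" if "x \<in> {t..T}" for x
    using that t_less_T by (simp add: field_simps)
  have vu: "?v (?u x) = x" for x
    using t_less_T by (simp add: divide_simps) (simp add: algebra_simps)
  have "continuous_on {-1..1} (\<lambda>z. g (?v z))"
    by (rule continuous_on_compose2[OF g]) (use v in \<open>auto intro!: continuous_intros\<close>)
  from Stone_Weierstrass_real_polynomial_function[OF _ this \<open>\<epsilon> > 0\<close>]
  obtain q where q: "real_polynomial_function q" "\<And>z. z \<in> {-1..1} \<Longrightarrow> \<bar>g (?v z) - q z\<bar> < \<epsilon>"
    by auto
  then obtain a N where qa: "q = (\<lambda>x. \<Sum>i\<le>N. a i * x ^ i)"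
    using real_polynomial_function_iff_sum[of q] by blast
  define p where "p = (\<Sum>i\<le>N. monom (a i) i)"
  have qp: "q = poly p" by (auto simp: qa p_def poly_sum poly_monom)
  obtain c where c: "p = (\<Sum>j\<le>degree p. smult (c j) (legendre_poly j))"
    using legendre_poly_span[OF order_refl, of p] by auto
  \<comment> \<open>Undoes the normalising square root in \<open>legendre_phi\<close>.\<close>
  define d where "d j = c j / sqrt ((2 * real j + 1) / (T - t))" for j
  have pos: "(2 * real j + 1) / (T - t) > 0" for j
    using t_less_T by (intro divide_pos_pos) auto
  have "d j * \<phi> j x = c j * poly (legendre_poly j) (?u x)" for j x
    using pos[of j] t_less_T unfolding d_def legendre_phi_def by simp
  then have "(\<Sum>j\<le>degree p. d j * \<phi> j x) = poly p (?u x)" for x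
    by (subst c) (simp add: poly_sum)
  then show ?thesis
    using q(2)[OF u] vu by (intro that[of d "degree p"]) (simp only: qp)
qed

lemma phi_bessel_eq:
  assumes "bounded_measurable \<mu> h"
  shows "(\<integral>x. (h x - (\<Sum>j\<le>n. d j * \<phi> j x))\<^sup>2 \<partial>\<mu>) =
    (\<integral>x. (h x)\<^sup>2 \<partial>\<mu>) - (\<Sum>j\<le>n. (\<integral>x. h x * \<phi> j x \<partial>\<mu>)\<^sup>2) + (\<Sum>j\<le>n. (d j - (\<integral>x. h x * \<phi> j x \<partial>\<mu>))\<^sup>2)"
  by (intro mu.integral_square_diff_orthonormal bm_intros phi_orthonormal assms) auto

lemma phi_bessel:
  assumes "bounded_measurable \<mu> h"
  shows "(\<Sum>j\<le>n. (\<integral>x. h x * \<phi> j x \<partial>\<mu>)\<^sup>2) \<le> (\<integral>x. (h x)\<^sup>2 \<partial>\<mu>)"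
proof -
  have "0 \<le> (\<integral>x. (h x - (\<Sum>j\<le>n. (\<integral>x. h x * \<phi> j x \<partial>\<mu>) * \<phi> j x))\<^sup>2 \<partial>\<mu>)" by simp
  then show ?thesis unfolding phi_bessel_eq[OF assms] by simp
qed

text \<open>Bessel's inequality bounds the partial sums from above. Optimality of the Fourier
  coefficients bounds the missing mass by the error of any one approximation, found by passing
  through a continuous function as granted by \<open>approx\<close>.\<close>

lemma phi_parseval:
  assumes h: "bounded_measurable \<mu> h"
    and approx: "\<And>\<epsilon>. \<epsilon> > 0 \<Longrightarrow> \<exists>g. continuous_on {t..T} g \<and> (\<integral>x. (h x - g x)\<^sup>2 \<partial>\<mu>) < \<epsilon>"
  shows "(\<lambda>n. \<Sum>j\<le>n. (\<integral>x. h x * \<phi> j x \<partial>\<mu>)\<^sup>2) \<longlonglongrightarrow> (\<integral>x. (h x)\<^sup>2 \<partial>\<mu>)"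
proof (rule LIMSEQ_I)
  fix r :: real assume "r > 0"
  let ?s = "\<lambda>n. \<Sum>j\<le>n. (\<integral>x. h x * \<phi> j x \<partial>\<mu>)\<^sup>2"
  obtain g where g: "continuous_on {t..T} g" and hg: "(\<integral>x. (h x - g x)\<^sup>2 \<partial>\<mu>) < r / 4"
    using approx[of "r / 4"] \<open>r > 0\<close> by auto
  \<comment> \<open>Chosen so that the squared uniform error integrates to \<open>r / 8\<close>; the
    total is then below \<open>2 * (r / 4) + 2 * (r / 8)\<close>, which is less than
    \<open>r\<close>.\<close>
  define e where "e = sqrt (r / (8 * (T - t)))"
  have "e > 0" using \<open>r > 0\<close> t_less_T by (simp add: e_def)
  from phi_uniformly_dense[OF g this] obtain n d
    where d: "\<And>x. x \<in> {t..T} \<Longrightarrow> \<bar>g x - (\<Sum>j\<le>n. d j * \<phi> j x)\<bar> < e" by metis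
  note [bm_intros] = h bm_continuous[OF g]
  have "(\<integral>x. (g x - (\<Sum>j\<le>n. d j * \<phi> j x))\<^sup>2 \<partial>\<mu>) \<le> (\<integral>x. e\<^sup>2 \<partial>\<mu>)"
  proof (intro integral_mono mu.bm_integrable bm_intros)
    fix x assume "x \<in> space \<mu>"
    then show "(g x - (\<Sum>j\<le>n. d j * \<phi> j x))\<^sup>2 \<le> e\<^sup>2"
      using d[of x] by (intro abs_le_square_iff[THEN iffD1]) (auto simp: space_mu)
  qed
  also have "\<dots> = r / 8"
    using \<open>r > 0\<close> t_less_T by (simp add: space_mu measure_mu e_def divide_simps) (simp add: algebra_simps)?
  finally have gd: "(\<integral>x. (g x - (\<Sum>j\<le>n. d j * \<phi> j x))\<^sup>2 \<partial>\<mu>) \<le> r / 8" .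
  have "(\<integral>x. (h x)\<^sup>2 \<partial>\<mu>) - ?s n \<le> (\<integral>x. (h x - (\<Sum>j\<le>n. d j * \<phi> j x))\<^sup>2 \<partial>\<mu>)"
    unfolding phi_bessel_eq[OF h] by (simp add: sum_nonneg)
  also have "\<dots> = (\<integral>x. ((h x - g x) + (g x - (\<Sum>j\<le>n. d j * \<phi> j x)))\<^sup>2 \<partial>\<mu>)" by simp
  also have "\<dots> \<le> 2 * (\<integral>x. (h x - g x)\<^sup>2 \<partial>\<mu>) + 2 * (\<integral>x. (g x - (\<Sum>j\<le>n. d j * \<phi> j x))\<^sup>2 \<partial>\<mu>)"
    by (intro mu.integral_square_add_le bm_intros)
  also have "\<dots> < r" using hg gd \<open>r > 0\<close> by linarith
  finally have *: "(\<integral>x. (h x)\<^sup>2 \<partial>\<mu>) - ?s n < r" .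
  show "\<exists>no. \<forall>k\<ge>no. norm (?s k - (\<integral>x. (h x)\<^sup>2 \<partial>\<mu>)) < r"
  proof (intro exI allI impI)
    fix k assume "n \<le> k"
    then have "?s n \<le> ?s k" by (intro sum_mono2) auto
    with * phi_bessel[OF h, of k] show "norm (?s k - (\<integral>x. (h x)\<^sup>2 \<partial>\<mu>)) < r" by simp
  qed
qed

lemma phi_parseval_continuous:
  assumes "continuous_on {t..T} h"
  shows "(\<lambda>n. \<Sum>j\<le>n. (\<integral>x. h x * \<phi> j x \<partial>\<mu>)\<^sup>2) \<longlonglongrightarrow> (\<integral>x. (h x)\<^sup>2 \<partial>\<mu>)"
  by (rule phi_parseval[OF bm_continuous[OF assms]]) (use assms in \<open>auto intro!: exI[of _ h]\<close>)

text \<open>Parseval and Bessel for \<open>h\<close> cut off at \<open>s\<close>. Read as functions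
  of \<open>s\<close>, the two claims are pointwise convergence and a dominating bound for sums of
  squared primitives, as dominated convergence requires.\<close>

lemma phi_parseval_truncated:
  assumes h: "continuous_on {t..T} h" and s: "s \<in> {t..T}"
  shows "(\<lambda>n. \<Sum>j\<le>n. (integral {t..s} (\<lambda>x. h x * \<phi> j x))\<^sup>2) \<longlonglongrightarrow> integral {t..s} (\<lambda>x. (h x)\<^sup>2)"
    and "(\<Sum>j\<le>n. (integral {t..s} (\<lambda>x. h x * \<phi> j x))\<^sup>2) \<le> integral {t..s} (\<lambda>x. (h x)\<^sup>2)"
proof -
  let ?h = "\<lambda>x. indicator {t..<s} x * h x"
  have bm [bm_intros]: "bounded_measurable \<mu> h" "bounded_measurable \<mu> ?h"
    using bm_continuous[OF h] by (auto intro!: bm_intros)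
  obtain c where c: "\<And>x. x \<in> {t..T} \<Longrightarrow> \<bar>h x\<bar> \<le> c" "c > 0"
  proof -
    obtain c where "\<forall>x\<in>{t..T}. \<bar>h x\<bar> \<le> c"
      using bm(1) by (auto simp: bounded_measurable_def space_mu)
    then show ?thesis by (intro that[of "\<bar>c\<bar> + 1"]) force+
  qed
  have e1: "(\<integral>x. ?h x * \<phi> j x \<partial>\<mu>) = integral {t..s} (\<lambda>x. h x * \<phi> j x)" for j
    using integral_mu_indicator[of "\<lambda>x. h x * \<phi> j x" t s] s t_less_T
    by (simp add: mult_ac continuous_intros h)
  have e2: "(\<integral>x. (?h x)\<^sup>2 \<partial>\<mu>) = integral {t..s} (\<lambda>x. (h x)\<^sup>2)"
  proof -
    have "(\<lambda>x. (?h x)\<^sup>2) = (\<lambda>x. indicator {t..<s} x * (h x)\<^sup>2)"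
      by (auto split: split_indicator)
    then show ?thesis
      using integral_mu_indicator[of "\<lambda>x. (h x)\<^sup>2" t s] s t_less_T by (simp add: continuous_intros h)
  qed
  show "(\<Sum>j\<le>n. (integral {t..s} (\<lambda>x. h x * \<phi> j x))\<^sup>2) \<le> integral {t..s} (\<lambda>x. (h x)\<^sup>2)"
    using phi_bessel[OF bm(2), of n] unfolding e1 e2 .
  have "(\<lambda>n. \<Sum>j\<le>n. (\<integral>x. ?h x * \<phi> j x \<partial>\<mu>)\<^sup>2) \<longlonglongrightarrow> (\<integral>x. (?h x)\<^sup>2 \<partial>\<mu>)"
  proof (rule phi_parseval[OF bm(2)])
    fix \<epsilon> :: real assume "\<epsilon> > 0"
    \<comment> \<open>The width of a linear ramp that replaces the jump at \<open>s\<close>. The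
      squared error is at most \<open>c\<^sup>2\<close> on an interval of this length, so it
      integrates to at most \<epsilon> / 2.\<close>
    define \<delta> where "\<delta> = \<epsilon> / (2 * c\<^sup>2)"
    have "\<delta> > 0" using c \<open>\<epsilon> > 0\<close> by (simp add: \<delta>_def)
    define r where "r x = max 0 (min 1 ((s - x) / \<delta>))" for x
    have r: "r x = 1" if "x \<le> s - \<delta>" for x
      using that \<open>\<delta> > 0\<close> by (simp add: r_def field_simps)
    have r0: "r x = 0" if "s \<le> x" for x
      using divide_nonpos_pos[of "s - x" \<delta>] that \<open>\<delta> > 0\<close> by (simp add: r_def max_def min_def)
    have r01: "0 \<le> r x" "r x \<le> 1" for x
      by (auto simp: r_def)
    have cont_r: "continuous_on {t..T} r"
      unfolding r_def using \<open>\<delta> > 0\<close> by (intro continuous_intros) auto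
    then have cont: "continuous_on {t..T} (\<lambda>x. h x * r x)"
      by (intro continuous_intros h)
    have "(\<integral>x. (?h x - h x * r x)\<^sup>2 \<partial>\<mu>) \<le> (\<integral>x. c\<^sup>2 * indicator {s - \<delta>..<s} x \<partial>\<mu>)"
    proof (intro integral_mono mu.bm_integrable bm_intros bm_continuous[OF cont_r])
      fix x assume "x \<in> space \<mu>"
      then have x: "x \<in> {t..T}" by (simp add: space_mu)
      show "(?h x - h x * r x)\<^sup>2 \<le> c\<^sup>2 * indicator {s - \<delta>..<s} x"
      proof (cases "x \<in> {s - \<delta>..<s}")
        case True
        have "\<bar>h x * (1 - r x)\<bar> \<le> c * 1"
          unfolding abs_mult using c x r01[of x] by (intro mult_mono) auto
        then have "(h x * (1 - r x))\<^sup>2 \<le> c\<^sup>2"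
          using c by (intro abs_le_square_iff[THEN iffD1]) auto
        then show ?thesis using True x by (simp add: algebra_simps)
      next
        case False
        then consider "x < s - \<delta>" | "s \<le> x" by fastforce
        then show ?thesis
          using x r[of x] r0[of x] \<open>\<delta> > 0\<close> by cases (auto split: split_indicator)
      qed
    qed auto
    also have "\<dots> = c\<^sup>2 * measure \<mu> ({s - \<delta>..<s} \<inter> {t..T})"
      by (simp add: space_mu)
    also have "\<dots> \<le> c\<^sup>2 * \<delta>"
    proof (intro mult_left_mono)
      have "measure \<mu> ({s - \<delta>..<s} \<inter> {t..T}) = measure lborel ({s - \<delta>..<s} \<inter> {t..T})"
        by (subst measure_restrict_space) auto
      also have "\<dots> \<le> measure lborel {s - \<delta>..<s}"
        using \<open>\<delta> > 0\<close> by (intro measure_mono_fmeasurable) (auto simp: fmeasurable_def)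
      also have "\<dots> = \<delta>" using \<open>\<delta> > 0\<close> by simp
      finally show "measure \<mu> ({s - \<delta>..<s} \<inter> {t..T}) \<le> \<delta>" .
    qed simp
    also have "\<dots> < \<epsilon>" using c \<open>\<epsilon> > 0\<close> by (simp add: \<delta>_def)
    finally show "\<exists>g. continuous_on {t..T} g \<and> (\<integral>x. (?h x - g x)\<^sup>2 \<partial>\<mu>) < \<epsilon>"
      using cont by blast
  qed
  then show "(\<lambda>n. \<Sum>j\<le>n. (integral {t..s} (\<lambda>x. h x * \<phi> j x))\<^sup>2) \<longlonglongrightarrow> integral {t..s} (\<lambda>x. (h x)\<^sup>2)"
    unfolding e1 e2 .
qed

end

section \<open>Continuously differentiable functions\<close>

definition C1_on :: "real \<Rightarrow> real \<Rightarrow> (real \<Rightarrow> real) \<Rightarrow> bool" where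
  "C1_on a b g \<longleftrightarrow> (\<exists>g'. (\<forall>x\<in>{a..b}. (g has_real_derivative g' x) (at x within {a..b})) \<and>
     continuous_on {a..b} g')"

lemma C2_on_imp_C1_on: "C2_on a b g \<Longrightarrow> C1_on a b g"
  unfolding C2_on_def C1_on_def by (metis DERIV_continuous_on)

lemma C1_on_imp_continuous_on: "C1_on a b g \<Longrightarrow> continuous_on {a..b} g"
  unfolding C1_on_def by (metis DERIV_continuous_on)

lemma C1_on_const: "C1_on a b (\<lambda>x. c)"
  unfolding C1_on_def by (rule exI[of _ "\<lambda>x. 0"]) auto

lemma C1_on_add: "C1_on a b g \<Longrightarrow> C1_on a b h \<Longrightarrow> C1_on a b (\<lambda>x. g x + h x)"
  unfolding C1_on_def
  apply (elim exE)
  subgoal for g' h'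
    by (rule exI[of _ "\<lambda>x. g' x + h' x"]) (auto intro!: derivative_eq_intros continuous_intros)
  done

lemma C1_on_divide:
  assumes g: "C1_on a b g" and h: "C1_on a b h" and nz: "\<And>x. x \<in> {a..b} \<Longrightarrow> h x \<noteq> 0"
  shows "C1_on a b (\<lambda>x. g x / h x)"
proof -
  from g h obtain g' h' where
    *: "\<And>x. x \<in> {a..b} \<Longrightarrow> (g has_real_derivative g' x) (at x within {a..b})" "continuous_on {a..b} g'"
    "\<And>x. x \<in> {a..b} \<Longrightarrow> (h has_real_derivative h' x) (at x within {a..b})" "continuous_on {a..b} h'"
    unfolding C1_on_def by metis
  note c = C1_on_imp_continuous_on[OF g] C1_on_imp_continuous_on[OF h]
  show ?thesis
    unfolding C1_on_def
  proof (intro exI[of _ "\<lambda>x. (g' x * h x - g x * h' x) / (h x * h x)"] conjI ballI)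
    fix x assume "x \<in> {a..b}"
    then show "((\<lambda>x. g x / h x) has_real_derivative (g' x * h x - g x * h' x) / (h x * h x)) (at x within {a..b})"
      using * nz by (intro DERIV_divide) auto
  next
    show "continuous_on {a..b} (\<lambda>x. (g' x * h x - g x * h' x) / (h x * h x))"
      using * nz c by (intro continuous_intros) auto
  qed
qed

lemma C1_on_bounded:
  assumes "C1_on a b g"
  obtains c where "c > 0" "\<And>x. x \<in> {a..b} \<Longrightarrow> \<bar>g x\<bar> \<le> c"
proof -
  have "bounded (g ` {a..b})"
    using C1_on_imp_continuous_on[OF assms] by (intro compact_imp_bounded compact_continuous_image) auto
  then obtain c where "\<forall>x\<in>{a..b}. \<bar>g x\<bar> \<le> c" by (auto simp: bounded_iff)
  then show ?thesis by (intro that[of "\<bar>c\<bar> + 1"]) force+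
qed

text \<open>Converts the mesh of a partition into a rate for step approximations.\<close>

lemma C1_on_lipschitz:
  assumes "C1_on a b g"
  obtains L where "L > 0" "\<And>x y. x \<in> {a..b} \<Longrightarrow> y \<in> {a..b} \<Longrightarrow> \<bar>g x - g y\<bar> \<le> L * \<bar>x - y\<bar>"
proof -
  from assms obtain g' where
    *: "\<And>x. x \<in> {a..b} \<Longrightarrow> (g has_real_derivative g' x) (at x within {a..b})" "continuous_on {a..b} g'"
    unfolding C1_on_def by metis
  have "bounded (g' ` {a..b})"
    using * by (intro compact_imp_bounded compact_continuous_image) auto
  then obtain c where c: "\<forall>x\<in>{a..b}. \<bar>g' x\<bar> \<le> c" by (auto simp: bounded_iff)
  have "norm (g x - g y) \<le> (\<bar>c\<bar> + 1) * norm (x - y)" if "x \<in> {a..b}" "y \<in> {a..b}" for x y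
    by (rule field_differentiable_bound[of "{a..b}" g g']) (use * c that in force)+
  then show ?thesis by (intro that[of "\<bar>c\<bar> + 1"]) auto
qed

section \<open>Integration by parts and the limit of the trace\<close>

context interval
begin

lemma integral_has_derivative_mu:
  assumes "continuous_on {t..T} g" "s \<in> {t..T}"
  shows "((\<lambda>s. integral {t..s} g) has_real_derivative g s) (at s within {t..T})"
  using assms by (rule integral_has_real_derivative)

lemma continuous_on_integral_mu:
  "continuous_on {t..T} (g :: real \<Rightarrow> real) \<Longrightarrow> continuous_on {t..T} (\<lambda>s. integral {t..s} g)"
  by (intro indefinite_integral_continuous_1 integrable_continuous_real)

lemma integral_by_parts_mu:
  assumes \<rho>: "\<And>x. x \<in> {t..T} \<Longrightarrow> (\<rho> has_real_derivative \<rho>' x) (at x within {t..T})"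
    and A: "\<And>x. x \<in> {t..T} \<Longrightarrow> (A has_real_derivative A' x) (at x within {t..T})"
    and "continuous_on {t..T} \<rho>'" "continuous_on {t..T} A'" "A t = 0"
  shows "(\<integral>x. \<rho> x * A' x \<partial>\<mu>) = \<rho> T * A T - (\<integral>x. \<rho>' x * A x \<partial>\<mu>)"
proof -
  have c: "continuous_on {t..T} \<rho>" "continuous_on {t..T} A"
    using \<rho> A by (blast intro: DERIV_continuous_on)+
  have "((\<lambda>x. \<rho> x * A' x + \<rho>' x * A x) has_integral (\<rho> T * A T - \<rho> t * A t)) {t..T}"
    by (rule fundamental_theorem_of_calculus)
       (use t_less_T in \<open>auto intro!: derivative_eq_intros \<rho> A
         simp: mult.commute simp flip: has_real_derivative_iff_has_vector_derivative\<close>)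
  moreover have "integral {t..T} (\<lambda>x. \<rho> x * A' x + \<rho>' x * A x) =
      integral {t..T} (\<lambda>x. \<rho> x * A' x) + integral {t..T} (\<lambda>x. \<rho>' x * A x)"
    by (intro integral_add integrable_continuous_real continuous_intros assms c)
  ultimately show ?thesis
    using \<open>A t = 0\<close> by (simp add: integral_mu_continuous continuous_intros assms c integral_unique)
qed

text \<open>Exhibits the coefficient, for fixed \<open>j1\<close>, as a Fourier coefficient in the
  outer variable, so that Parseval's identity applies to the sum over \<open>j2\<close>.\<close>

lemma fourier_coeff_eq:
  assumes "continuous_on {t..T} \<psi>1" "continuous_on {t..T} \<psi>2"
  shows "fourier_coeff t T \<psi>1 \<psi>2 j2 j1 =
    (\<integral>y. \<psi>2 y * integral {t..y} (\<lambda>x. \<psi>1 x * \<phi> j1 x) * \<phi> j2 y \<partial>\<mu>)"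
  unfolding fourier_coeff_def integral_mu[symmetric]
  by (intro Bochner_Integration.integral_cong refl)
     (simp add: space_mu set_integral_continuous continuous_intros assms)

lemma trace_tendsto_proportional:
  assumes \<psi>: "continuous_on {t..T} \<psi>" and \<rho>: "C1_on t T \<rho>"
    and \<psi>2: "\<And>x. x \<in> {t..T} \<Longrightarrow> \<psi>2 x = \<rho> x * \<psi> x"
  shows "(\<lambda>n. \<Sum>j\<le>n. fourier_coeff t T \<psi> \<psi>2 j j) \<longlonglongrightarrow> 1 / 2 * (\<integral>x. \<psi> x * \<psi>2 x \<partial>\<mu>)"
proof -
  from \<rho> obtain \<rho>' where
    \<rho>': "\<And>x. x \<in> {t..T} \<Longrightarrow> (\<rho> has_real_derivative \<rho>' x) (at x within {t..T})" "continuous_on {t..T} \<rho>'"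
    unfolding C1_on_def by metis
  note c\<rho> = C1_on_imp_continuous_on[OF \<rho>]
  have c2: "continuous_on {t..T} \<psi>2"
    using continuous_on_mult[OF c\<rho> \<psi>] by (rule continuous_on_eq) (simp add: \<psi>2)
  define G where "G j s = integral {t..s} (\<lambda>x. \<psi> x * \<phi> j x)" for j s
  define H where "H s = integral {t..s} (\<lambda>x. (\<psi> x)\<^sup>2)" for s
  have G0: "G j t = 0" and H0: "H t = 0" for j by (simp_all add: G_def H_def)
  have dG: "(G j has_real_derivative \<psi> s * \<phi> j s) (at s within {t..T})" if "s \<in> {t..T}" for j s
    unfolding G_def using that by (intro integral_has_derivative_mu continuous_intros \<psi>)
  have cG: "continuous_on {t..T} (G j)" for j
    unfolding G_def by (intro continuous_on_integral_mu continuous_intros \<psi>)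
  have dH: "(H has_real_derivative (\<psi> s)\<^sup>2) (at s within {t..T})" if "s \<in> {t..T}" for s
    unfolding H_def using that by (intro integral_has_derivative_mu continuous_intros \<psi>)
  have cH: "continuous_on {t..T} H"
    unfolding H_def by (intro continuous_on_integral_mu continuous_intros \<psi>)
  have C: "fourier_coeff t T \<psi> \<psi>2 j j = 1 / 2 * (\<rho> T * (G j T)\<^sup>2 - (\<integral>x. \<rho>' x * (G j x)\<^sup>2 \<partial>\<mu>))" for j
  proof -
    \<comment> \<open>The factor next to \<rho> is the derivative of the square of
      \<open>G j\<close>.\<close>
    have "(\<integral>x. \<rho> x * (2 * G j x * (\<psi> x * \<phi> j x)) \<partial>\<mu>) = \<rho> T * (G j T)\<^sup>2 - (\<integral>x. \<rho>' x * (G j x)\<^sup>2 \<partial>\<mu>)"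
      using \<rho>' by (intro integral_by_parts_mu continuous_intros cG \<psi>)
        (auto intro!: derivative_eq_intros dG simp: G0)
    moreover have "(\<integral>x. \<rho> x * (2 * G j x * (\<psi> x * \<phi> j x)) \<partial>\<mu>) = 2 * fourier_coeff t T \<psi> \<psi>2 j j"
      unfolding fourier_coeff_eq[OF \<psi> c2] G_def[symmetric] integral_mult_right_zero[symmetric]
      by (intro Bochner_Integration.integral_cong refl) (simp add: space_mu \<psi>2)
    ultimately show ?thesis by simp
  qed
  have lim: "(\<lambda>n. \<Sum>j\<le>n. (G j s)\<^sup>2) \<longlonglongrightarrow> H s" "(\<Sum>j\<le>n. (G j s)\<^sup>2) \<le> H s" if "s \<in> {t..T}" for s n
    unfolding G_def H_def using phi_parseval_truncated[OF \<psi> that] by auto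
  note [bm_intros] = bm_continuous[OF \<rho>'(2)] bm_continuous[OF cG] bm_continuous[OF cH]
  \<comment> \<open>Parseval at each point gives the pointwise limit, and Bessel at each point makes
    \<open>\<bar>\<rho>' x * H x\<bar>\<close> a dominating function.\<close>
  have I: "(\<lambda>n. \<integral>x. \<rho>' x * (\<Sum>j\<le>n. (G j x)\<^sup>2) \<partial>\<mu>) \<longlonglongrightarrow> (\<integral>x. \<rho>' x * H x \<partial>\<mu>)"
  proof (rule integral_dominated_convergence[where w = "\<lambda>x. \<bar>\<rho>' x * H x\<bar>"])
    show "integrable \<mu> (\<lambda>x. \<bar>\<rho>' x * H x\<bar>)"
      by (intro integrable_abs mu.bm_integrable bm_intros)
    show "AE x in \<mu>. (\<lambda>n. \<rho>' x * (\<Sum>j\<le>n. (G j x)\<^sup>2)) \<longlonglongrightarrow> \<rho>' x * H x"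
      using lim by (intro AE_I2 tendsto_intros) (auto simp: space_mu)
    show "AE x in \<mu>. norm (\<rho>' x * (\<Sum>j\<le>n. (G j x)\<^sup>2)) \<le> \<bar>\<rho>' x * H x\<bar>" for n
    proof (rule AE_I2)
      fix x assume "x \<in> space \<mu>"
      then have "(\<Sum>j\<le>n. (G j x)\<^sup>2) \<le> H x" using lim by (simp add: space_mu)
      then show "norm (\<rho>' x * (\<Sum>j\<le>n. (G j x)\<^sup>2)) \<le> \<bar>\<rho>' x * H x\<bar>"
        by (simp add: abs_mult sum_nonneg mult_left_mono)
    qed
  qed (auto intro!: bm_measurable bm_intros)
  have "(\<Sum>j\<le>n. fourier_coeff t T \<psi> \<psi>2 j j) =
      1 / 2 * (\<rho> T * (\<Sum>j\<le>n. (G j T)\<^sup>2) - (\<integral>x. \<rho>' x * (\<Sum>j\<le>n. (G j x)\<^sup>2) \<partial>\<mu>))" for n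
  proof -
    have "(\<integral>x. \<rho>' x * (\<Sum>j\<le>n. (G j x)\<^sup>2) \<partial>\<mu>) = (\<Sum>j\<le>n. \<integral>x. \<rho>' x * (G j x)\<^sup>2 \<partial>\<mu>)"
      unfolding sum_distrib_left
      by (rule Bochner_Integration.integral_sum) (intro mu.bm_integrable bm_intros)
    then show ?thesis
      unfolding C by (simp only: sum_subtractf sum_distrib_left right_diff_distrib)
  qed
  moreover have "(\<lambda>n. 1 / 2 * (\<rho> T * (\<Sum>j\<le>n. (G j T)\<^sup>2) - (\<integral>x. \<rho>' x * (\<Sum>j\<le>n. (G j x)\<^sup>2) \<partial>\<mu>)))
      \<longlonglongrightarrow> 1 / 2 * (\<rho> T * H T - (\<integral>x. \<rho>' x * H x \<partial>\<mu>))"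
    using t_less_T by (intro tendsto_intros lim I) auto
  \<comment> \<open>The same integration by parts read backwards, now with \<open>H\<close>, whose
    derivative is the square of \<psi>.\<close>
  moreover have "\<rho> T * H T - (\<integral>x. \<rho>' x * H x \<partial>\<mu>) = (\<integral>x. \<rho> x * (\<psi> x)\<^sup>2 \<partial>\<mu>)"
    using \<rho>' by (intro integral_by_parts_mu[symmetric] continuous_intros \<psi>) (auto intro!: dH simp: H0)
  moreover have "\<dots> = (\<integral>x. \<psi> x * \<psi>2 x \<partial>\<mu>)"
    by (intro Bochner_Integration.integral_cong refl) (simp add: space_mu \<psi>2 power2_eq_square)
  ultimately show ?thesis by (simp only:)
qed

lemma fourier_coeff_add:
  assumes "continuous_on {t..T} \<psi>" "continuous_on {t..T} \<xi>" "continuous_on {t..T} \<psi>2"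
  shows "fourier_coeff t T (\<lambda>x. \<psi> x + \<xi> x) \<psi>2 i j = fourier_coeff t T \<psi> \<psi>2 i j + fourier_coeff t T \<xi> \<psi>2 i j"
proof -
  have "integral {t..y} (\<lambda>x. (\<psi> x + \<xi> x) * \<phi> j x) =
      integral {t..y} (\<lambda>x. \<psi> x * \<phi> j x) + integral {t..y} (\<lambda>x. \<xi> x * \<phi> j x)" if "y \<in> {t..T}" for y
    unfolding distrib_right using that
    by (intro integral_add integrable_continuous_real continuous_intros)
       (auto intro: continuous_on_subset[OF assms(1)] continuous_on_subset[OF assms(2)])
  then have "(\<integral>y. \<psi>2 y * integral {t..y} (\<lambda>x. (\<psi> x + \<xi> x) * \<phi> j x) * \<phi> i y \<partial>\<mu>) =
      (\<integral>y. \<psi>2 y * integral {t..y} (\<lambda>x. \<psi> x * \<phi> j x) * \<phi> i y + \<psi>2 y * integral {t..y} (\<lambda>x. \<xi> x * \<phi> j x) * \<phi> i y \<partial>\<mu>)"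
    by (intro Bochner_Integration.integral_cong refl) (simp add: space_mu algebra_simps)
  then show ?thesis
    using assms
    by (simp add: fourier_coeff_eq continuous_intros,
        intro Bochner_Integration.integral_add mu.bm_integrable bm_continuous continuous_intros continuous_on_integral_mu)
qed

text \<open>
  If \<open>\<psi>2 = \<rho> \<psi>1\<close>, the diagonal coefficients are integrals of \<open>\<rho> (G\<^sub>j\<^sup>2)' / 2\<close> for a primitive \<open>G\<^sub>j\<close>,
  so that integration by parts reduces the trace to Parseval's identity. The general case follows
  by splitting \<open>\<psi>1 = (\<psi>1 + c) - c\<close> with a constant \<open>c\<close> that makes both summands nonzero.
\<close>

lemma trace_tendsto:
  assumes \<psi>1: "C1_on t T \<psi>1" and \<psi>2: "C1_on t T \<psi>2"
  shows "(\<lambda>n. \<Sum>j\<le>n. fourier_coeff t T \<psi>1 \<psi>2 j j) \<longlonglongrightarrow> 1 / 2 * (\<integral>x. \<psi>1 x * \<psi>2 x \<partial>\<mu>)"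
proof -
  obtain c where c: "c > 0" "\<And>x. x \<in> {t..T} \<Longrightarrow> \<bar>\<psi>1 x\<bar> \<le> c" using C1_on_bounded[OF \<psi>1] by metis
  \<comment> \<open>Since \<psi>1 is at least \<open>- c\<close>, this function is at least
    \<open>c\<close>, and the quotient of \<psi>2 by it is again continuously
    differentiable.\<close>
  define \<xi> where "\<xi> x = \<psi>1 x + 2 * c" for x
  have \<xi>: "C1_on t T \<xi>" unfolding \<xi>_def by (intro C1_on_add \<psi>1 C1_on_const)
  have nz: "\<xi> x \<noteq> 0" if "x \<in> {t..T}" for x
    using c(1) c(2)[OF that] by (auto simp: \<xi>_def)
  have cont: "continuous_on {t..T} \<psi>1" "continuous_on {t..T} \<psi>2" "continuous_on {t..T} \<xi>"
    using \<psi>1 \<psi>2 \<xi> by (auto intro: C1_on_imp_continuous_on)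
  note [bm_intros] = cont[THEN bm_continuous]
  have "fourier_coeff t T \<xi> \<psi>2 j j = fourier_coeff t T \<psi>1 \<psi>2 j j + fourier_coeff t T (\<lambda>x. 2 * c) \<psi>2 j j" for j
    unfolding \<xi>_def by (intro fourier_coeff_add cont continuous_intros)
  then have eq: "(\<Sum>j\<le>n. fourier_coeff t T \<psi>1 \<psi>2 j j) =
      (\<Sum>j\<le>n. fourier_coeff t T \<xi> \<psi>2 j j) - (\<Sum>j\<le>n. fourier_coeff t T (\<lambda>x. 2 * c) \<psi>2 j j)" for n
    by (simp add: sum.distrib)
  have "(\<lambda>n. \<Sum>j\<le>n. fourier_coeff t T \<psi>1 \<psi>2 j j) \<longlonglongrightarrow>
      1 / 2 * (\<integral>x. \<xi> x * \<psi>2 x \<partial>\<mu>) - 1 / 2 * (\<integral>x. 2 * c * \<psi>2 x \<partial>\<mu>)"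
    unfolding eq
  proof (rule tendsto_diff)
    show "(\<lambda>n. \<Sum>j\<le>n. fourier_coeff t T \<xi> \<psi>2 j j) \<longlonglongrightarrow> 1 / 2 * (\<integral>x. \<xi> x * \<psi>2 x \<partial>\<mu>)"
      using nz by (intro trace_tendsto_proportional[OF cont(3) C1_on_divide[OF \<psi>2 \<xi>]]) auto
    show "(\<lambda>n. \<Sum>j\<le>n. fourier_coeff t T (\<lambda>x. 2 * c) \<psi>2 j j) \<longlonglongrightarrow> 1 / 2 * (\<integral>x. 2 * c * \<psi>2 x \<partial>\<mu>)"
      using c(1)
      by (intro trace_tendsto_proportional[OF _ C1_on_divide[OF \<psi>2 C1_on_const[of _ _ "2 * c"]]]) auto
  qed
  moreover have "(\<integral>x. \<xi> x * \<psi>2 x \<partial>\<mu>) = (\<integral>x. \<psi>1 x * \<psi>2 x \<partial>\<mu>) + (\<integral>x. 2 * c * \<psi>2 x \<partial>\<mu>)"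
    unfolding \<xi>_def distrib_right
    by (intro Bochner_Integration.integral_add mu.bm_integrable bm_intros)
  ultimately show ?thesis by (simp add: add_divide_distrib)
qed

section \<open>The kernel of the iterated integral and its Fourier sums\<close>

definition volterra_kernel :: "(real \<Rightarrow> real) \<Rightarrow> (real \<Rightarrow> real) \<Rightarrow> real \<times> real \<Rightarrow> real" where
  "volterra_kernel \<psi>1 \<psi>2 z = \<psi>1 (fst z) * \<psi>2 (snd z) * (if fst z < snd z then 1 else 0)"

lemma bm_volterra_kernel [bm_intros]:
  assumes "bounded_measurable \<mu> \<psi>1" "bounded_measurable \<mu> \<psi>2"
  shows "bounded_measurable \<mu>2 (volterra_kernel \<psi>1 \<psi>2)"
  unfolding volterra_kernel_def[abs_def]
  by (intro bm_mult bm_fst bm_snd assms bounded_measurableI[of "\<lambda>z. if fst z < snd z then 1 else 0" _ 1]) auto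

text \<open>Fubini with the inner time integrated first. It is used twice: with \<phi> absorbed into
  both functions it yields the Fourier coefficients of the kernel, with squared functions it yields
  the norm.\<close>

lemma integral_volterra_kernel:
  assumes c: "continuous_on {t..T} \<psi>1" "continuous_on {t..T} \<psi>2"
  shows "(\<integral>z. volterra_kernel \<psi>1 \<psi>2 z \<partial>\<mu>2) = (\<integral>y. \<psi>2 y * integral {t..y} \<psi>1 \<partial>\<mu>)"
proof -
  note [bm_intros] = c[THEN bm_continuous]
  have "integrable \<mu>2 (\<lambda>(x, y). volterra_kernel \<psi>1 \<psi>2 (x, y))"
    by (simp, intro mu2.bm_integrable bm_intros)
  from mu_pair.integral_snd[OF this]
  have "(\<integral>z. volterra_kernel \<psi>1 \<psi>2 z \<partial>\<mu>2) = (\<integral>y. (\<integral>x. volterra_kernel \<psi>1 \<psi>2 (x, y) \<partial>\<mu>) \<partial>\<mu>)"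
    by simp
  also have "\<dots> = (\<integral>y. \<psi>2 y * integral {t..y} \<psi>1 \<partial>\<mu>)"
  proof (intro Bochner_Integration.integral_cong refl)
    fix y assume "y \<in> space \<mu>"
    then have y: "y \<in> {t..T}" by (simp add: space_mu)
    have "(\<integral>x. volterra_kernel \<psi>1 \<psi>2 (x, y) \<partial>\<mu>) = (\<integral>x. \<psi>2 y * (indicator {t..<y} x * \<psi>1 x) \<partial>\<mu>)"
      by (intro Bochner_Integration.integral_cong refl)
         (auto simp: volterra_kernel_def space_mu split: split_indicator)
    also have "\<dots> = \<psi>2 y * integral {t..y} \<psi>1"
      using integral_mu_indicator[OF c(1), of t y] y t_less_T by simp
    finally show "(\<integral>x. volterra_kernel \<psi>1 \<psi>2 (x, y) \<partial>\<mu>) = \<psi>2 y * integral {t..y} \<psi>1" .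
  qed
  finally show ?thesis .
qed

abbreviation fourier_kernel :: "(real \<Rightarrow> real) \<Rightarrow> (real \<Rightarrow> real) \<Rightarrow> nat \<Rightarrow> nat \<Rightarrow> real \<times> real \<Rightarrow> real" where
  "fourier_kernel \<psi>1 \<psi>2 p1 p2 z \<equiv>
     (\<Sum>j1\<le>p1. \<Sum>j2\<le>p2. fourier_coeff t T \<psi>1 \<psi>2 j2 j1 * (\<phi> j1 (fst z) * \<phi> j2 (snd z)))"

text \<open>The products of two Legendre functions are orthonormal on the square and
  \<open>fourier_coeff\<close> gives the coefficients of the kernel in them, so Pythagoras is
  exact.\<close>

lemma integral_square_fourier_kernel_error:
  assumes c: "continuous_on {t..T} \<psi>1" "continuous_on {t..T} \<psi>2"
  shows "(\<integral>z. (volterra_kernel \<psi>1 \<psi>2 z - fourier_kernel \<psi>1 \<psi>2 p1 p2 z)\<^sup>2 \<partial>\<mu>2) =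
    (\<integral>y. (\<psi>2 y)\<^sup>2 * integral {t..y} (\<lambda>x. (\<psi>1 x)\<^sup>2) \<partial>\<mu>) -
    (\<Sum>j1\<le>p1. \<Sum>j2\<le>p2. (fourier_coeff t T \<psi>1 \<psi>2 j2 j1)\<^sup>2)"
proof -
  let ?K = "volterra_kernel \<psi>1 \<psi>2" and ?I = "{..p1} \<times> {..p2}"
  define e where "e i z = \<phi> (fst i) (fst z) * \<phi> (snd i) (snd z)" for i z
  define d where "d i = fourier_coeff t T \<psi>1 \<psi>2 (snd i) (fst i)" for i
  note [bm_intros] = c[THEN bm_continuous]
  have Ke: "(\<integral>z. ?K z * e i z \<partial>\<mu>2) = d i" for i
  proof -
    have "(\<lambda>z. ?K z * e i z) = volterra_kernel (\<lambda>x. \<psi>1 x * \<phi> (fst i) x) (\<lambda>y. \<psi>2 y * \<phi> (snd i) y)"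
      by (auto simp: volterra_kernel_def e_def)
    then show ?thesis
      using integral_volterra_kernel[of "\<lambda>x. \<psi>1 x * \<phi> (fst i) x" "\<lambda>y. \<psi>2 y * \<phi> (snd i) y"]
      by (simp add: c continuous_intros d_def fourier_coeff_eq mult_ac)
  qed
  have KK: "(\<integral>z. (?K z)\<^sup>2 \<partial>\<mu>2) = (\<integral>y. (\<psi>2 y)\<^sup>2 * integral {t..y} (\<lambda>x. (\<psi>1 x)\<^sup>2) \<partial>\<mu>)"
  proof -
    have "(\<lambda>z. (?K z)\<^sup>2) = volterra_kernel (\<lambda>x. (\<psi>1 x)\<^sup>2) (\<lambda>y. (\<psi>2 y)\<^sup>2)"
      by (auto simp: volterra_kernel_def power_mult_distrib)
    then show ?thesis by (simp add: integral_volterra_kernel c continuous_intros)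
  qed
  have "(\<integral>z. e i z * e j z \<partial>\<mu>2) = (if i = j then 1 else 0)" for i j
  proof -
    have "(\<lambda>z. e i z * e j z) =
        (\<lambda>z. (\<lambda>x. \<phi> (fst i) x * \<phi> (fst j) x) (fst z) * (\<lambda>y. \<phi> (snd i) y * \<phi> (snd j) y) (snd z))"
      by (auto simp: e_def)
    then have "(\<integral>z. e i z * e j z \<partial>\<mu>2) =
        (\<integral>x. \<phi> (fst i) x * \<phi> (fst j) x \<partial>\<mu>) * (\<integral>y. \<phi> (snd i) y * \<phi> (snd j) y \<partial>\<mu>)"
      by (simp only:, intro bm_pair_integral_mult bm_intros mu.finite_measure_axioms)
    then show ?thesis by (auto simp: phi_orthonormal prod_eq_iff)
  qed
  then have "(\<integral>z. (?K z - (\<Sum>i\<in>?I. d i * e i z))\<^sup>2 \<partial>\<mu>2) =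
      (\<integral>z. (?K z)\<^sup>2 \<partial>\<mu>2) - (\<Sum>i\<in>?I. (\<integral>z. ?K z * e i z \<partial>\<mu>2)\<^sup>2) +
      (\<Sum>i\<in>?I. (d i - (\<integral>z. ?K z * e i z \<partial>\<mu>2))\<^sup>2)"
    by (intro mu2.integral_square_diff_orthonormal) (auto simp: e_def[abs_def] intro!: bm_intros)
  then show ?thesis
    unfolding Ke KK by (simp add: d_def e_def sum.cartesian_product case_prod_beta)
qed

text \<open>Squared defect of the trace plus squared L2 distance of the kernels, the combination
  that controls the mean square in \<open>bilinear_comparison\<close>. The integrals of products of
  \<phi> are left unevaluated to match the trace produced by
  \<open>fourier_sum_bilinear\<close>.\<close>

definition fourier_error :: "(real \<Rightarrow> real) \<Rightarrow> (real \<Rightarrow> real) \<Rightarrow> nat \<Rightarrow> nat \<Rightarrow> real" where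
  "fourier_error \<psi>1 \<psi>2 p1 p2 =
    (1 / 2 * (\<integral>x. \<psi>1 x * \<psi>2 x \<partial>\<mu>) -
      (\<Sum>j1\<le>p1. \<Sum>j2\<le>p2. fourier_coeff t T \<psi>1 \<psi>2 j2 j1 * (\<integral>x. \<phi> j1 x * \<phi> j2 x \<partial>\<mu>)))\<^sup>2 +
    (\<integral>z. (volterra_kernel \<psi>1 \<psi>2 z - fourier_kernel \<psi>1 \<psi>2 p1 p2 z)\<^sup>2 \<partial>\<mu>2)"

text \<open>The limit in \<open>p2\<close> uses Parseval in the outer variable, for each of the
  finitely many \<open>j1\<close>. The limit in \<open>p1\<close> uses \<open>trace_tendsto\<close>
  and Parseval in the inner variable, integrated against the square of \<psi>2.\<close>

lemma fourier_error_tendsto: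
  assumes \<psi>1: "C1_on t T \<psi>1" and \<psi>2: "C1_on t T \<psi>2"
  shows "\<exists>e. e \<longlonglongrightarrow> 0 \<and> (\<forall>p1. fourier_error \<psi>1 \<psi>2 p1 \<longlonglongrightarrow> e p1)"
proof -
  have c: "continuous_on {t..T} \<psi>1" "continuous_on {t..T} \<psi>2"
    using \<psi>1 \<psi>2 by (auto intro: C1_on_imp_continuous_on)
  define G where "G j s = integral {t..s} (\<lambda>x. \<psi>1 x * \<phi> j x)" for j s
  define H where "H s = integral {t..s} (\<lambda>x. (\<psi>1 x)\<^sup>2)" for s
  have cG: "continuous_on {t..T} (G j)" for j
    unfolding G_def by (intro continuous_on_integral_mu continuous_intros c)
  have cH: "continuous_on {t..T} H"
    unfolding H_def by (intro continuous_on_integral_mu continuous_intros c)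
  have lim: "(\<lambda>n. \<Sum>j\<le>n. (G j s)\<^sup>2) \<longlonglongrightarrow> H s" "(\<Sum>j\<le>n. (G j s)\<^sup>2) \<le> H s" if "s \<in> {t..T}" for s n
    unfolding G_def H_def using phi_parseval_truncated[OF c(1) that] by auto
  note [bm_intros] = bm_continuous[OF c(2)] bm_continuous[OF cG] bm_continuous[OF cH]
  let ?h = "1 / 2 * (\<integral>x. \<psi>1 x * \<psi>2 x \<partial>\<mu>)"
  \<comment> \<open>The limit in \<open>p2\<close>: the defect of the diagonal sum, plus the part of
    the kernel orthogonal to the first \<open>p + 1\<close> functions of the inner variable.\<close>
  define e where "e p = (?h - (\<Sum>j\<le>p. fourier_coeff t T \<psi>1 \<psi>2 j j))\<^sup>2 +
    ((\<integral>y. (\<psi>2 y)\<^sup>2 * H y \<partial>\<mu>) - (\<integral>y. (\<psi>2 y)\<^sup>2 * (\<Sum>j\<le>p. (G j y)\<^sup>2) \<partial>\<mu>))" for p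
  have I: "(\<lambda>n. \<integral>x. (\<psi>2 x)\<^sup>2 * (\<Sum>j\<le>n. (G j x)\<^sup>2) \<partial>\<mu>) \<longlonglongrightarrow> (\<integral>x. (\<psi>2 x)\<^sup>2 * H x \<partial>\<mu>)"
  proof (rule integral_dominated_convergence[where w = "\<lambda>x. (\<psi>2 x)\<^sup>2 * H x"])
    show "integrable \<mu> (\<lambda>x. (\<psi>2 x)\<^sup>2 * H x)"
      by (intro mu.bm_integrable bm_intros)
    show "AE x in \<mu>. (\<lambda>n. (\<psi>2 x)\<^sup>2 * (\<Sum>j\<le>n. (G j x)\<^sup>2)) \<longlonglongrightarrow> (\<psi>2 x)\<^sup>2 * H x"
      using lim by (intro AE_I2 tendsto_intros) (auto simp: space_mu)
    show "AE x in \<mu>. norm ((\<psi>2 x)\<^sup>2 * (\<Sum>j\<le>n. (G j x)\<^sup>2)) \<le> (\<psi>2 x)\<^sup>2 * H x" for n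
      using lim by (intro AE_I2) (auto simp: space_mu abs_mult sum_nonneg intro!: mult_left_mono)
  qed (auto intro!: bm_measurable bm_intros)
  have "e \<longlonglongrightarrow> (?h - ?h)\<^sup>2 + ((\<integral>y. (\<psi>2 y)\<^sup>2 * H y \<partial>\<mu>) - (\<integral>y. (\<psi>2 y)\<^sup>2 * H y \<partial>\<mu>))"
    unfolding e_def by (intro tendsto_intros trace_tendsto \<psi>1 \<psi>2 I)
  then have e0: "e \<longlonglongrightarrow> 0" by simp
  moreover have "fourier_error \<psi>1 \<psi>2 p1 \<longlonglongrightarrow> e p1" for p1
  proof -
    \<comment> \<open>Orthonormality keeps only \<open>j2 = j1\<close>, and this index lies in the
      inner range for every \<open>j1\<close> because of \<open>p1 \<le> p2\<close>.\<close>
    have tr: "(\<Sum>j1\<le>p1. \<Sum>j2\<le>p2. fourier_coeff t T \<psi>1 \<psi>2 j2 j1 * (\<integral>x. \<phi> j1 x * \<phi> j2 x \<partial>\<mu>)) =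
        (\<Sum>j\<le>p1. fourier_coeff t T \<psi>1 \<psi>2 j j)" if "p1 \<le> p2" for p2
      using that by (intro sum.cong refl) (simp add: phi_orthonormal if_distrib sum.delta' cong: if_cong)
    have "(\<lambda>p2. \<Sum>j2\<le>p2. (fourier_coeff t T \<psi>1 \<psi>2 j2 j1)\<^sup>2) \<longlonglongrightarrow> (\<integral>y. (\<psi>2 y * G j1 y)\<^sup>2 \<partial>\<mu>)" for j1
      using phi_parseval_continuous[of "\<lambda>y. \<psi>2 y * G j1 y"]
      by (simp add: fourier_coeff_eq[OF c] G_def[symmetric] cG c continuous_intros)
    then have "(\<lambda>p2. \<Sum>j1\<le>p1. \<Sum>j2\<le>p2. (fourier_coeff t T \<psi>1 \<psi>2 j2 j1)\<^sup>2) \<longlonglongrightarrow>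
        (\<Sum>j1\<le>p1. \<integral>y. (\<psi>2 y * G j1 y)\<^sup>2 \<partial>\<mu>)"
      by (intro tendsto_intros)
    also have "(\<Sum>j1\<le>p1. \<integral>y. (\<psi>2 y * G j1 y)\<^sup>2 \<partial>\<mu>) = (\<integral>y. (\<psi>2 y)\<^sup>2 * (\<Sum>j\<le>p1. (G j y)\<^sup>2) \<partial>\<mu>)"
      unfolding sum_distrib_left power_mult_distrib
      by (rule Bochner_Integration.integral_sum[symmetric]) (intro mu.bm_integrable bm_intros)
    finally have "(\<lambda>p2. (?h - (\<Sum>j\<le>p1. fourier_coeff t T \<psi>1 \<psi>2 j j))\<^sup>2 + ((\<integral>y. (\<psi>2 y)\<^sup>2 * H y \<partial>\<mu>) -
        (\<Sum>j1\<le>p1. \<Sum>j2\<le>p2. (fourier_coeff t T \<psi>1 \<psi>2 j2 j1)\<^sup>2))) \<longlonglongrightarrow> e p1"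
      unfolding e_def by (intro tendsto_intros)
    then show ?thesis
      by (rule Lim_transform_eventually)
         (use eventually_ge_at_top[of p1] in \<open>eventually_elim, simp only: fourier_error_def tr integral_square_fourier_kernel_error[OF c] H_def\<close>)
  qed
  ultimately show ?thesis by blast
qed

end

section \<open>Partitions\<close>

lemma partition_of_mono:
  assumes "partition_of a b N \<tau>" "i \<le> j" "j \<le> N"
  shows "\<tau> i \<le> \<tau> j"
  using assms(2,3)
proof (induction j)
  case (Suc j)
  have "\<tau> j < \<tau> (Suc j)" using assms(1) Suc.prems by (simp add: partition_of_def)
  with Suc show ?case by (cases "i = Suc j") auto
qed simp

lemma partition_of_bounds:
  assumes "partition_of a b N \<tau>" "j \<le> N"
  shows "\<tau> j \<in> {a..b}"
  using partition_of_mono[OF assms(1), of 0 j] partition_of_mono[OF assms(1), of j N] assms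
  by (auto simp: partition_of_def)

lemma sum_indicator_partition:
  assumes "partition_of a b N \<tau>"
  shows "(\<Sum>j<N. indicator {\<tau> j..<\<tau> (Suc j)} x) = (indicator {a..<b} x :: real)"
proof -
  have "(\<Sum>j<n. indicator {\<tau> j..<\<tau> (Suc j)} x) = (indicator {a..<\<tau> n} x :: real)" if "n \<le> N" for n
    using that
  proof (induction n)
    case 0
    then show ?case using assms by (simp add: partition_of_def)
  next
    case (Suc n)
    then show ?case
      using partition_of_bounds[OF assms, of n] partition_of_mono[OF assms, of n "Suc n"]
      by (auto split: split_indicator)
  qed
  from this[of N] show ?thesis using assms by (simp add: partition_of_def)
qed

lemma integral_partition:
  fixes g :: "real \<Rightarrow> real"
  assumes "partition_of a b N \<tau>" "continuous_on {a..b} g"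
  shows "integral {a..b} g = (\<Sum>j<N. integral {\<tau> j..\<tau> (Suc j)} g)"
proof -
  have "integral {a..\<tau> n} g = (\<Sum>j<n. integral {\<tau> j..\<tau> (Suc j)} g)" if "n \<le> N" for n
    using that
  proof (induction n)
    case 0
    then show ?case using assms by (simp add: partition_of_def)
  next
    case (Suc n)
    have *: "a \<le> \<tau> n" "\<tau> n \<le> \<tau> (Suc n)" "\<tau> (Suc n) \<le> b"
      using partition_of_bounds[OF assms(1), of n] partition_of_bounds[OF assms(1), of "Suc n"]
        partition_of_mono[OF assms(1), of n "Suc n"] Suc.prems by auto
    then have "g integrable_on {a..\<tau> (Suc n)}"
      by (intro integrable_continuous_real continuous_on_subset[OF assms(2)]) auto
    from Henstock_Kurzweil_Integration.integral_combine[OF *(1,2) this] Suc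
    show ?case by simp
  qed
  from this[of N] show ?thesis using assms by (simp add: partition_of_def)
qed

text \<open>\<open>v j\<close> is any number close to \<open>h\<close> on the \<open>j\<close>-th
  cell, not necessarily a value of \<open>h\<close>. This covers the Stratonovich trace, the
  Stieltjes sums and the trapezoid sums alike.\<close>

lemma riemann_stieltjes_sum_bound:
  fixes g h :: "real \<Rightarrow> real"
  assumes P: "partition_of a b N \<tau>"
    and g: "continuous_on {a..b} g" and h: "continuous_on {a..b} h"
    and close: "\<And>j x. j < N \<Longrightarrow> x \<in> {\<tau> j..\<tau> (Suc j)} \<Longrightarrow> \<bar>v j - h x\<bar> \<le> \<epsilon>"
    and G: "\<And>x. x \<in> {a..b} \<Longrightarrow> \<bar>g x\<bar> \<le> G"
  shows "\<bar>(\<Sum>j<N. v j * integral {\<tau> j..\<tau> (Suc j)} g) - integral {a..b} (\<lambda>x. h x * g x)\<bar> \<le> \<epsilon> * G * (b - a)"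
proof -
  have sub: "{\<tau> j..\<tau> (Suc j)} \<subseteq> {a..b}" if "j < N" for j
    using partition_of_bounds[OF P, of j] partition_of_bounds[OF P, of "Suc j"] that by auto
  have "\<bar>(\<Sum>j<N. v j * integral {\<tau> j..\<tau> (Suc j)} g) - integral {a..b} (\<lambda>x. h x * g x)\<bar> =
      \<bar>\<Sum>j<N. v j * integral {\<tau> j..\<tau> (Suc j)} g - integral {\<tau> j..\<tau> (Suc j)} (\<lambda>x. h x * g x)\<bar>"
    by (subst integral_partition[OF P]) (auto intro!: continuous_intros g h simp: sum_subtractf)
  also have "\<dots> \<le> (\<Sum>j<N. \<bar>v j * integral {\<tau> j..\<tau> (Suc j)} g - integral {\<tau> j..\<tau> (Suc j)} (\<lambda>x. h x * g x)\<bar>)"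
    by (rule sum_abs)
  also have "\<dots> \<le> (\<Sum>j<N. \<epsilon> * G * (\<tau> (Suc j) - \<tau> j))"
  proof (rule sum_mono)
    fix j assume "j \<in> {..<N}"
    then have j: "j < N" by simp
    have le: "\<tau> j \<le> \<tau> (Suc j)" using partition_of_mono[OF P, of j "Suc j"] j by simp
    note c = continuous_on_subset[OF g sub[OF j]] continuous_on_subset[OF h sub[OF j]]
    have "v j * integral {\<tau> j..\<tau> (Suc j)} g - integral {\<tau> j..\<tau> (Suc j)} (\<lambda>x. h x * g x) =
        integral {\<tau> j..\<tau> (Suc j)} (\<lambda>x. v j * g x - h x * g x)"
      by (subst Henstock_Kurzweil_Integration.integral_diff)
         (auto intro!: integrable_continuous_real continuous_intros c)
    also have "norm \<dots> \<le> (\<epsilon> * G) * (\<tau> (Suc j) - \<tau> j)"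
    proof (rule integral_bound[OF le])
      show "continuous_on {\<tau> j..\<tau> (Suc j)} (\<lambda>x. v j * g x - h x * g x)"
        by (intro continuous_intros c)
      fix x assume x: "x \<in> {\<tau> j..\<tau> (Suc j)}"
      have "\<bar>v j - h x\<bar> * \<bar>g x\<bar> \<le> \<epsilon> * G"
        using close[OF j x] G[of x] x sub[OF j] by (intro mult_mono) (auto intro: order_trans[OF abs_ge_zero])
      then show "norm (v j * g x - h x * g x) \<le> \<epsilon> * G"
        by (simp add: abs_mult flip: left_diff_distrib)
    qed
    finally show "\<bar>v j * integral {\<tau> j..\<tau> (Suc j)} g - integral {\<tau> j..\<tau> (Suc j)} (\<lambda>x. h x * g x)\<bar> \<le>
        \<epsilon> * G * (\<tau> (Suc j) - \<tau> j)" by simp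
  qed
  also have "\<dots> = \<epsilon> * G * (b - a)"
    using P by (simp add: partition_of_def sum_lessThan_telescope flip: sum_distrib_left)
  finally show ?thesis .
qed

definition uniform_partition :: "real \<Rightarrow> real \<Rightarrow> nat \<Rightarrow> nat \<Rightarrow> real" where
  "uniform_partition a b n j = a + real j * ((b - a) / real n)"

lemma uniform_partition_step:
  "uniform_partition a b n (Suc j) - uniform_partition a b n j = (b - a) / real n"
  unfolding uniform_partition_def of_nat_Suc distrib_right by simp

lemma partition_of_uniform: "a < b \<Longrightarrow> n > 0 \<Longrightarrow> partition_of a b n (uniform_partition a b n)"
  unfolding partition_of_def
proof (intro conjI allI impI)
  fix j assume "a < b" "n > 0"
  then have "(b - a) / real n > 0" by simp
  then show "uniform_partition a b n j < uniform_partition a b n (Suc j)"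
    using uniform_partition_step[of a b n j] by linarith
qed (auto simp: uniform_partition_def)

lemma eventually_uniform_partition_mesh:
  assumes "\<delta> > 0"
  shows "eventually (\<lambda>n. n > 0 \<and> (b - a) / real n < \<delta>) sequentially"
proof -
  have "(\<lambda>n. (b - a) / real n) \<longlonglongrightarrow> 0"
    by (rule lim_const_over_n)
  then have "eventually (\<lambda>n. (b - a) / real n < \<delta>) sequentially"
    by (rule order_tendstoD) fact
  then show ?thesis using eventually_gt_at_top[of "0::nat"] by eventually_elim auto
qed

text \<open>The sets in the infimum form a filter base, since the smaller of two bounds on the mesh
  serves for both.\<close>

lemma eventually_mesh_to_0:
  "eventually P (mesh_to_0 a b) \<longleftrightarrow>
    (\<exists>\<delta>>0. \<forall>N \<tau>. partition_of a b N \<tau> \<longrightarrow> (\<forall>j<N. \<tau> (Suc j) - \<tau> j < \<delta>) \<longrightarrow> P (N, \<tau>))"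
proof -
  have "eventually P (mesh_to_0 a b) \<longleftrightarrow> (\<exists>\<delta>\<in>{0<..}. eventually P (principal
      {(N, \<tau>). partition_of a b N \<tau> \<and> (\<forall>j<N. \<tau> (Suc j) - \<tau> j < \<delta>)}))"
    unfolding mesh_to_0_def
  proof (rule eventually_INF_base)
    fix d e :: real assume "d \<in> {0<..}" "e \<in> {0<..}"
    then show "\<exists>x\<in>{0<..}. principal {(N, \<tau>). partition_of a b N \<tau> \<and> (\<forall>j<N. \<tau> (Suc j) - \<tau> j < x)} \<le>
        inf (principal {(N, \<tau>). partition_of a b N \<tau> \<and> (\<forall>j<N. \<tau> (Suc j) - \<tau> j < d)})
            (principal {(N, \<tau>). partition_of a b N \<tau> \<and> (\<forall>j<N. \<tau> (Suc j) - \<tau> j < e)})"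
      by (intro bexI[of _ "min d e"]) auto
  qed (auto intro!: exI[of _ 1])
  then show ?thesis by (simp add: eventually_principal Bex_def imp_conjL)
qed

text \<open>A concrete sequence along which limits over partitions are evaluated;
  \<open>Suc n\<close> keeps the number of cells positive.\<close>

lemma filterlim_uniform_partition:
  assumes "a < b"
  shows "filterlim (\<lambda>n. (Suc n, uniform_partition a b (Suc n))) (mesh_to_0 a b) sequentially"
  unfolding filterlim_iff eventually_mesh_to_0
proof safe
  fix P and \<delta> :: real assume "\<delta> > 0"
    and P: "\<forall>N \<tau>. partition_of a b N \<tau> \<longrightarrow> (\<forall>j<N. \<tau> (Suc j) - \<tau> j < \<delta>) \<longrightarrow> P (N, \<tau>)"
  from eventually_compose_filterlim[OF eventually_uniform_partition_mesh[OF \<open>\<delta> > 0\<close>, of b a] filterlim_Suc]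
  show "\<forall>\<^sub>F n in sequentially. P (Suc n, uniform_partition a b (Suc n))"
    by eventually_elim (use P assms in \<open>auto simp: uniform_partition_step partition_of_uniform\<close>)
qed

section \<open>Kernel and trace of the Stratonovich sums\<close>

context interval
begin

text \<open>Each cell gives two products of a function of the inner time and one of the outer time,
  one for each of the two averaged values of \<eta>.\<close>

definition stratonovich_kernel ::
  "(real \<Rightarrow> real) \<Rightarrow> (real \<Rightarrow> real) \<Rightarrow> nat \<Rightarrow> (nat \<Rightarrow> real) \<Rightarrow> real \<times> real \<Rightarrow> real" where
  "stratonovich_kernel \<psi>1 \<psi>2 N \<tau> z = (\<Sum>j<N.
     \<psi>2 (\<tau> j) / 2 * ((indicator {t..<\<tau> j} (fst z) * \<psi>1 (fst z)) * indicator {\<tau> j..<\<tau> (Suc j)} (snd z)) +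
     \<psi>2 (\<tau> j) / 2 * ((indicator {t..<\<tau> (Suc j)} (fst z) * \<psi>1 (fst z)) * indicator {\<tau> j..<\<tau> (Suc j)} (snd z)))"

definition stratonovich_trace ::
  "(real \<Rightarrow> real) \<Rightarrow> (real \<Rightarrow> real) \<Rightarrow> nat \<Rightarrow> (nat \<Rightarrow> real) \<Rightarrow> real" where
  "stratonovich_trace \<psi>1 \<psi>2 N \<tau> = (\<Sum>j<N.
     \<psi>2 (\<tau> j) / 2 * (\<integral>x. (indicator {t..<\<tau> j} x * \<psi>1 x) * indicator {\<tau> j..<\<tau> (Suc j)} x \<partial>\<mu>) +
     \<psi>2 (\<tau> j) / 2 * (\<integral>x. (indicator {t..<\<tau> (Suc j)} x * \<psi>1 x) * indicator {\<tau> j..<\<tau> (Suc j)} x \<partial>\<mu>))"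

text \<open>The value of \<eta> at the left end point involves only times before the cell and
  contributes nothing; the value at the right end point covers the whole cell. Hence the factor one
  half.\<close>

lemma stratonovich_trace_eq:
  assumes P: "partition_of t T N \<tau>" and c: "continuous_on {t..T} \<psi>1"
  shows "stratonovich_trace \<psi>1 \<psi>2 N \<tau> = (\<Sum>j<N. \<psi>2 (\<tau> j) * integral {\<tau> j..\<tau> (Suc j)} (\<lambda>x. \<psi>1 x / 2))"
  unfolding stratonovich_trace_def
proof (intro sum.cong refl)
  fix j assume "j \<in> {..<N}"
  then have *: "\<tau> j \<in> {t..T}" "\<tau> (Suc j) \<in> {t..T}"
    using partition_of_bounds[OF P] by auto
  have "(\<lambda>x. (indicator {t..<\<tau> j} x * \<psi>1 x) * indicator {\<tau> j..<\<tau> (Suc j)} x) = (\<lambda>x. 0)"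
    by (auto split: split_indicator)
  moreover have "(\<lambda>x. (indicator {t..<\<tau> (Suc j)} x * \<psi>1 x) * indicator {\<tau> j..<\<tau> (Suc j)} x) =
      (\<lambda>x. indicator {\<tau> j..<\<tau> (Suc j)} x * \<psi>1 x)"
    using * by (auto split: split_indicator)
  ultimately show "\<psi>2 (\<tau> j) / 2 * (\<integral>x. (indicator {t..<\<tau> j} x * \<psi>1 x) * indicator {\<tau> j..<\<tau> (Suc j)} x \<partial>\<mu>) +
     \<psi>2 (\<tau> j) / 2 * (\<integral>x. (indicator {t..<\<tau> (Suc j)} x * \<psi>1 x) * indicator {\<tau> j..<\<tau> (Suc j)} x \<partial>\<mu>) =
     \<psi>2 (\<tau> j) * integral {\<tau> j..\<tau> (Suc j)} (\<lambda>x. \<psi>1 x / 2)"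
    using integral_mu_indicator[OF c *] by simp
qed

text \<open>Every section of the strip around the diagonal is contained in an interval of length 2 *
  \<delta>.\<close>

lemma integral_near_diagonal:
  assumes "\<delta> > 0"
  shows "bounded_measurable \<mu>2 (\<lambda>z. if \<bar>fst z - snd z\<bar> < \<delta> then 1 else 0)"
    and "(\<integral>z. (if \<bar>fst z - snd z\<bar> < \<delta> then 1 else 0) \<partial>\<mu>2) \<le> 2 * \<delta> * (T - t)"
proof -
  show bm: "bounded_measurable \<mu>2 (\<lambda>z. if \<bar>fst z - snd z\<bar> < \<delta> then 1 else 0)"
    by (rule bounded_measurableI[of _ _ 1]) auto
  have inner: "(\<integral>y. (if \<bar>x - y\<bar> < \<delta> then 1 else 0) \<partial>\<mu>) \<le> 2 * \<delta>" for x
  proof -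
    have "(\<integral>y. (if \<bar>x - y\<bar> < \<delta> then 1 else 0) \<partial>\<mu>) = (\<integral>y. indicator {x - \<delta><..<x + \<delta>} y \<partial>\<mu>)"
      by (intro Bochner_Integration.integral_cong refl) (auto split: split_indicator)
    also have "\<dots> = measure lborel ({x - \<delta><..<x + \<delta>} \<inter> {t..T})"
      by (simp add: space_mu, subst measure_restrict_space) auto
    also have "\<dots> \<le> measure lborel {x - \<delta><..<x + \<delta>}"
      using assms by (intro measure_mono_fmeasurable) (auto simp: fmeasurable_def)
    also have "\<dots> = 2 * \<delta>" using assms by simp
    finally show ?thesis .
  qed
  have "(\<integral>z. (if \<bar>fst z - snd z\<bar> < \<delta> then 1 else 0 :: real) \<partial>\<mu>2) =
      (\<integral>x. (\<integral>y. (if \<bar>x - y\<bar> < \<delta> then 1 else 0) \<partial>\<mu>) \<partial>\<mu>)"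
    using mu_pair.integral_fst'[OF mu2.bm_integrable[OF bm], symmetric] by simp
  also have "\<dots> \<le> (\<integral>x. 2 * \<delta> \<partial>\<mu>)"
    using mu.bm_lebesgue_integral[OF bm]
    by (intro integral_mono mu.bm_integrable inner) (auto intro: bm_intros)
  finally show "(\<integral>z. (if \<bar>fst z - snd z\<bar> < \<delta> then 1 else 0) \<partial>\<mu>2) \<le> 2 * \<delta> * (T - t)"
    by (simp add: space_mu measure_mu mult_ac)
qed

text \<open>Away from the diagonal strip only the replacement of \<psi>2 at \<open>y\<close> by its
  value at the left end of the cell matters, and this is a Lipschitz error. In the strip a crude
  bound suffices. The line \<open>y = T\<close> is separate because no half-open cell contains
  \<open>T\<close>.\<close>

lemma stratonovich_kernel_pointwise_error:
  assumes P: "partition_of t T N \<tau>" and mesh: "\<And>j. j < N \<Longrightarrow> \<tau> (Suc j) - \<tau> j < \<delta>"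
    and c1: "\<And>x. x \<in> {t..T} \<Longrightarrow> \<bar>\<psi>1 x\<bar> \<le> c1" and c2: "\<And>x. x \<in> {t..T} \<Longrightarrow> \<bar>\<psi>2 x\<bar> \<le> c2"
    and L: "\<And>x y. x \<in> {t..T} \<Longrightarrow> y \<in> {t..T} \<Longrightarrow> \<bar>\<psi>2 x - \<psi>2 y\<bar> \<le> L * \<bar>x - y\<bar>"
    and pos: "c1 > 0" "c2 > 0" "L > 0" and x: "x \<in> {t..T}" and y: "y \<in> {t..T}"
  shows "\<bar>volterra_kernel \<psi>1 \<psi>2 (x, y) - stratonovich_kernel \<psi>1 \<psi>2 N \<tau> (x, y)\<bar> \<le>
    c1 * L * \<delta> + 2 * c1 * c2 * ((if \<bar>x - y\<bar> < \<delta> then 1 else 0) + indicator {T} y)"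
proof (cases "y = T")
  case True
  then have "indicator {\<tau> j..<\<tau> (Suc j)} y = (0::real)" if "j < N" for j
    using partition_of_bounds[OF P, of "Suc j"] that by (auto split: split_indicator)
  then have "stratonovich_kernel \<psi>1 \<psi>2 N \<tau> (x, y) = 0"
    by (simp add: stratonovich_kernel_def)
  moreover have "\<bar>\<psi>1 x\<bar> * \<bar>\<psi>2 y\<bar> \<le> c1 * c2"
    using c1[OF x] c2[OF y] pos by (intro mult_mono) auto
  \<comment> \<open>There is at least one cell, and its positive length lies below \<delta>.\<close>
  moreover have "\<delta> > 0"
  proof -
    have "N > 0" using P t_less_T by (cases N) (auto simp: partition_of_def)
    then show "\<delta> > 0" using mesh[of 0] P by (auto simp: partition_of_def)
  qed
  then have "c1 * L * \<delta> > 0" "c1 * c2 > 0" using pos by simp_all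
  ultimately show ?thesis
    using True by (simp add: volterra_kernel_def abs_mult mult.assoc)
next
  case False
  then have "(\<Sum>j<N. indicator {\<tau> j..<\<tau> (Suc j)} y) = (1::real)"
    using sum_indicator_partition[OF P, of y] y by simp
  then obtain k where k: "k < N" "y \<in> {\<tau> k..<\<tau> (Suc k)}"
    by (metis (mono_tags, lifting) indicator_simps(2) lessThan_iff sum.neutral zero_neq_one)
  have uniq: "y \<notin> {\<tau> j..<\<tau> (Suc j)}" if "j < N" "j \<noteq> k" for j
    using partition_of_mono[OF P, of "Suc j" k] partition_of_mono[OF P, of "Suc k" j] that k
    by (cases "j < k") force+
  have "stratonovich_kernel \<psi>1 \<psi>2 N \<tau> (x, y) =
      (\<Sum>j<N. if j = k then \<psi>2 (\<tau> k) / 2 * \<psi>1 x * (indicator {t..<\<tau> k} x + indicator {t..<\<tau> (Suc k)} x) else 0)"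
    unfolding stratonovich_kernel_def using k uniq by (intro sum.cong refl) (auto simp: algebra_simps)
  then have S: "stratonovich_kernel \<psi>1 \<psi>2 N \<tau> (x, y) =
      \<psi>2 (\<tau> k) / 2 * \<psi>1 x * (indicator {t..<\<tau> k} x + indicator {t..<\<tau> (Suc k)} x)"
    using k by simp
  have tk: "\<tau> k \<in> {t..T}" "\<tau> (Suc k) \<in> {t..T}" using partition_of_bounds[OF P] k by auto
  have d: "\<tau> (Suc k) - \<tau> k < \<delta>" using mesh k by simp
  have b: "\<bar>\<psi>1 x\<bar> * \<bar>\<psi>2 y\<bar> \<le> c1 * c2" "\<bar>\<psi>1 x\<bar> * \<bar>\<psi>2 (\<tau> k)\<bar> \<le> c1 * c2"
    using c1[OF x] c2[OF y] c2[OF tk(1)] pos by (intro mult_mono; auto)+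
  have "c1 * L * \<delta> > 0" "c1 * c2 > 0" using pos d k by simp_all
  consider "x < \<tau> k" | "\<tau> k \<le> x" "x < \<tau> (Suc k)" | "\<tau> (Suc k) \<le> x" by linarith
  then show ?thesis
  proof cases
    \<comment> \<open>\<open>x\<close> precedes the cell of \<open>y\<close>: both kernels are
      \<psi>1 at \<open>x\<close> times a value of \<psi>2, at \<open>y\<close> and at the left end
      of the cell respectively.\<close>
    case 1
    have "\<bar>\<psi>1 x\<bar> * \<bar>\<psi>2 y - \<psi>2 (\<tau> k)\<bar> \<le> c1 * (L * \<delta>)"
    proof (intro mult_mono c1 x)
      have "\<bar>\<psi>2 y - \<psi>2 (\<tau> k)\<bar> \<le> L * \<bar>y - \<tau> k\<bar>" by (rule L[OF y tk(1)])
      also have "\<dots> \<le> L * \<delta>" using k d pos by (intro mult_left_mono) auto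
      finally show "\<bar>\<psi>2 y - \<psi>2 (\<tau> k)\<bar> \<le> L * \<delta>" .
    qed (use pos in auto)
    moreover have "volterra_kernel \<psi>1 \<psi>2 (x, y) - stratonovich_kernel \<psi>1 \<psi>2 N \<tau> (x, y) =
        \<psi>1 x * (\<psi>2 y - \<psi>2 (\<tau> k))"
      using 1 x k unfolding S by (simp add: volterra_kernel_def algebra_simps)
    ultimately show ?thesis
      using \<open>c1 * c2 > 0\<close> False by (simp add: abs_mult mult_ac)
  next
    \<comment> \<open>Both points share a cell, so they are closer than \<delta> and the crude bound
      applies.\<close>
    case 2
    have "volterra_kernel \<psi>1 \<psi>2 (x, y) - stratonovich_kernel \<psi>1 \<psi>2 N \<tau> (x, y) =
        \<psi>1 x * \<psi>2 y * (if x < y then 1 else 0) - \<psi>1 x * \<psi>2 (\<tau> k) / 2"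
      using 2 x unfolding S by (simp add: volterra_kernel_def algebra_simps)
    moreover have "\<bar>\<psi>1 x * \<psi>2 y * (if x < y then 1 else 0) - \<psi>1 x * \<psi>2 (\<tau> k) / 2\<bar> \<le>
        \<bar>\<psi>1 x\<bar> * \<bar>\<psi>2 y\<bar> + \<bar>\<psi>1 x\<bar> * \<bar>\<psi>2 (\<tau> k)\<bar> / 2"
      by (rule order_trans[OF abs_triangle_ineq4]) (auto simp: abs_mult)
    moreover have "\<bar>x - y\<bar> < \<delta>" using 2 k d by auto
    ultimately show ?thesis
      using b \<open>c1 * c2 > 0\<close> \<open>c1 * L * \<delta> > 0\<close> False by simp
  next
    \<comment> \<open>Here \<open>y < x\<close> and both kernels vanish.\<close>
    case 3
    then have "volterra_kernel \<psi>1 \<psi>2 (x, y) - stratonovich_kernel \<psi>1 \<psi>2 N \<tau> (x, y) = 0"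
      using k unfolding S by (auto simp: volterra_kernel_def split: split_indicator)
    then show ?thesis
      using \<open>c1 * c2 > 0\<close> \<open>c1 * L * \<delta> > 0\<close> by (auto split: split_indicator)
  qed
qed

lemma bm_stratonovich_kernel [bm_intros]:
  "bounded_measurable \<mu> \<psi>1 \<Longrightarrow> bounded_measurable \<mu>2 (stratonovich_kernel \<psi>1 \<psi>2 N \<tau>)"
  unfolding stratonovich_kernel_def[abs_def] by (intro bm_intros) auto

definition stratonovich_error :: "(real \<Rightarrow> real) \<Rightarrow> (real \<Rightarrow> real) \<Rightarrow> nat \<times> (nat \<Rightarrow> real) \<Rightarrow> real" where
  "stratonovich_error \<psi>1 \<psi>2 = (\<lambda>(N, \<tau>).
    (1 / 2 * (\<integral>x. \<psi>1 x * \<psi>2 x \<partial>\<mu>) - stratonovich_trace \<psi>1 \<psi>2 N \<tau>)\<^sup>2 +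
    (\<integral>z. (volterra_kernel \<psi>1 \<psi>2 z - stratonovich_kernel \<psi>1 \<psi>2 N \<tau> z)\<^sup>2 \<partial>\<mu>2))"

lemma stratonovich_error_le:
  assumes \<psi>1: "C1_on t T \<psi>1" and \<psi>2: "C1_on t T \<psi>2"
  shows "\<exists>B\<ge>0. \<forall>\<delta> N \<tau>. \<delta> \<le> 1 \<longrightarrow> partition_of t T N \<tau> \<longrightarrow> (\<forall>j<N. \<tau> (Suc j) - \<tau> j < \<delta>) \<longrightarrow>
    stratonovich_error \<psi>1 \<psi>2 (N, \<tau>) \<le> B * \<delta>"
proof -
  have c: "continuous_on {t..T} \<psi>1" "continuous_on {t..T} \<psi>2"
    using \<psi>1 \<psi>2 by (auto intro: C1_on_imp_continuous_on)
  obtain c1 where c1: "c1 > 0" "\<And>x. x \<in> {t..T} \<Longrightarrow> \<bar>\<psi>1 x\<bar> \<le> c1" using C1_on_bounded[OF \<psi>1] by metis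
  obtain c2 where c2: "c2 > 0" "\<And>x. x \<in> {t..T} \<Longrightarrow> \<bar>\<psi>2 x\<bar> \<le> c2" using C1_on_bounded[OF \<psi>2] by metis
  obtain L where L: "L > 0" "\<And>x y. x \<in> {t..T} \<Longrightarrow> y \<in> {t..T} \<Longrightarrow> \<bar>\<psi>2 x - \<psi>2 y\<bar> \<le> L * \<bar>x - y\<bar>"
    using C1_on_lipschitz[OF \<psi>2] by metis
  note [bm_intros] = c[THEN bm_continuous]
  \<comment> \<open>One summand each for the Riemann sum error of the trace, the variation of
    \<psi>2 within a cell, and the diagonal strip. The first two errors are of order \<delta>
    squared, which is at most \<delta> because \<delta> is at most 1.\<close>
  define B where "B = (L * (c1 / 2) * (T - t))\<^sup>2 + 2 * (c1 * L)\<^sup>2 * (T - t)\<^sup>2 + 16 * (c1 * c2)\<^sup>2 * (2 * (T - t))"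
  have "B \<ge> 0" unfolding B_def using t_less_T by simp
  show ?thesis
  proof (intro exI[of _ B] conjI allI impI)
    fix \<delta> N \<tau>
    assume "\<delta> \<le> 1" and P: "partition_of t T N \<tau>" and mesh: "\<forall>j<N. \<tau> (Suc j) - \<tau> j < \<delta>"
    have "N > 0" using P t_less_T by (cases N) (auto simp: partition_of_def)
    then have "\<delta> > 0" using mesh P by (auto simp: partition_of_def dest!: spec[of _ 0])
    have \<delta>2: "\<delta>\<^sup>2 \<le> \<delta>" using \<open>\<delta> > 0\<close> \<open>\<delta> \<le> 1\<close> by (simp add: power2_eq_square mult_left_le)
    have "\<bar>(\<Sum>j<N. \<psi>2 (\<tau> j) * integral {\<tau> j..\<tau> (Suc j)} (\<lambda>x. \<psi>1 x / 2)) - integral {t..T} (\<lambda>x. \<psi>2 x * (\<psi>1 x / 2))\<bar>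
        \<le> (L * \<delta>) * (c1 / 2) * (T - t)"
    proof (rule riemann_stieltjes_sum_bound[OF P])
      fix j x assume j: "j < N" and x: "x \<in> {\<tau> j..\<tau> (Suc j)}"
      then have "\<tau> j \<in> {t..T}" "\<tau> (Suc j) \<in> {t..T}" using partition_of_bounds[OF P] by auto
      then have "\<bar>\<psi>2 (\<tau> j) - \<psi>2 x\<bar> \<le> L * \<bar>\<tau> j - x\<bar>" using x by (intro L) auto
      also have "\<dots> \<le> L * \<delta>" using mesh j x L by (intro mult_left_mono) (auto dest!: spec[of _ j])
      finally show "\<bar>\<psi>2 (\<tau> j) - \<psi>2 x\<bar> \<le> L * \<delta>" .
    qed (use c c1 in \<open>auto intro!: continuous_intros\<close>)
    moreover have "integral {t..T} (\<lambda>x. \<psi>2 x * (\<psi>1 x / 2)) = 1 / 2 * (\<integral>x. \<psi>1 x * \<psi>2 x \<partial>\<mu>)"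
      by (simp add: integral_mu_continuous continuous_intros c mult_ac)
    ultimately have "\<bar>1 / 2 * (\<integral>x. \<psi>1 x * \<psi>2 x \<partial>\<mu>) - stratonovich_trace \<psi>1 \<psi>2 N \<tau>\<bar> \<le> (L * (c1 / 2) * (T - t)) * \<delta>"
      unfolding stratonovich_trace_eq[OF P c(1)] by (simp add: abs_minus_commute mult_ac)
    then have "(1 / 2 * (\<integral>x. \<psi>1 x * \<psi>2 x \<partial>\<mu>) - stratonovich_trace \<psi>1 \<psi>2 N \<tau>)\<^sup>2 \<le> ((L * (c1 / 2) * (T - t)) * \<delta>)\<^sup>2"
      using L c1 t_less_T \<open>\<delta> > 0\<close> by (intro abs_le_square_iff[THEN iffD1]) auto
    also have "\<dots> \<le> (L * (c1 / 2) * (T - t))\<^sup>2 * \<delta>"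
      unfolding power_mult_distrib[of _ \<delta>] by (intro mult_left_mono \<delta>2) auto
    finally have tr: "(1 / 2 * (\<integral>x. \<psi>1 x * \<psi>2 x \<partial>\<mu>) - stratonovich_trace \<psi>1 \<psi>2 N \<tau>)\<^sup>2 \<le> (L * (c1 / 2) * (T - t))\<^sup>2 * \<delta>" .
    let ?D = "\<lambda>z. if \<bar>fst z - snd z\<bar> < \<delta> then 1 else (0::real)"
    note D = integral_near_diagonal[OF \<open>\<delta> > 0\<close>]
    have T0: "(\<integral>z. indicator {T} (snd z) \<partial>\<mu>2) = (0::real)"
      using bm_pair_integral_mult[OF mu.finite_measure_axioms mu.finite_measure_axioms bm_const[of _ 1] bm_indicator[of "{T}"]]
      by (simp add: space_mu measure_restrict_space)
    have "(\<integral>z. (volterra_kernel \<psi>1 \<psi>2 z - stratonovich_kernel \<psi>1 \<psi>2 N \<tau> z)\<^sup>2 \<partial>\<mu>2) \<le>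
        (\<integral>z. 2 * (c1 * L * \<delta>)\<^sup>2 + 16 * (c1 * c2)\<^sup>2 * (?D z + indicator {T} (snd z)) \<partial>\<mu>2)"
    proof (intro integral_mono mu2.bm_integrable bm_intros D)
      fix z assume "z \<in> space \<mu>2"
      then obtain x y where z: "z = (x, y)" "x \<in> {t..T}" "y \<in> {t..T}"
        by (auto simp: space_pair_measure space_mu)
      let ?a = "c1 * L * \<delta>" and ?b = "2 * (c1 * c2)" and ?i = "?D z + indicator {T} (snd z)"
      have "\<bar>volterra_kernel \<psi>1 \<psi>2 z - stratonovich_kernel \<psi>1 \<psi>2 N \<tau> z\<bar> \<le> ?a + ?b * ?i"
      proof -
        have "\<bar>volterra_kernel \<psi>1 \<psi>2 (x, y) - stratonovich_kernel \<psi>1 \<psi>2 N \<tau> (x, y)\<bar> \<le>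
            c1 * L * \<delta> + 2 * c1 * c2 * ((if \<bar>x - y\<bar> < \<delta> then 1 else 0) + indicator {T} y)"
          by (rule stratonovich_kernel_pointwise_error[OF P]) (use mesh c1 c2 L z in auto)
        then show ?thesis by (simp add: z(1) mult.assoc)
      qed
      then have "(volterra_kernel \<psi>1 \<psi>2 z - stratonovich_kernel \<psi>1 \<psi>2 N \<tau> z)\<^sup>2 \<le> (?a + ?b * ?i)\<^sup>2"
        using c1 c2 L \<open>\<delta> > 0\<close> by (intro abs_le_square_iff[THEN iffD1]) (auto intro: order_trans[OF _ abs_ge_self])
      also have "\<dots> \<le> 2 * ?a\<^sup>2 + 2 * (?b * ?i)\<^sup>2"
        using sum_squares_bound[of ?a "?b * ?i"] by (simp add: power2_sum)
      also have "\<dots> \<le> 2 * ?a\<^sup>2 + 16 * (c1 * c2)\<^sup>2 * ?i"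
      proof -
        \<comment> \<open>\<open>?i\<close> only takes the values 0, 1 and 2. With \<open>?b\<close>
          equal to \<open>2 * (c1 * c2)\<close> this accounts for the constant 16 = 2 * 4 *
          2.\<close>
        have "?i\<^sup>2 \<le> 2 * ?i" by (auto simp: power2_eq_square split: split_indicator)
        moreover have "2 * (?b * i)\<^sup>2 \<le> 16 * (c1 * c2)\<^sup>2 * i" if "i\<^sup>2 \<le> 2 * i" for i
          using mult_left_mono[OF that, of "8 * (c1 * c2)\<^sup>2"] by (simp add: power_mult_distrib)
        ultimately show ?thesis by (intro add_left_mono)
      qed
      finally show "(volterra_kernel \<psi>1 \<psi>2 z - stratonovich_kernel \<psi>1 \<psi>2 N \<tau> z)\<^sup>2 \<le>
          2 * ?a\<^sup>2 + 16 * (c1 * c2)\<^sup>2 * ?i" .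
    qed auto
    also have "\<dots> = 2 * (c1 * L * \<delta>)\<^sup>2 * (T - t)\<^sup>2 + 16 * (c1 * c2)\<^sup>2 * (\<integral>z. ?D z \<partial>\<mu>2)"
    proof -
      have i: "integrable \<mu>2 ?D" "integrable \<mu>2 (\<lambda>z. indicator {T} (snd z) :: real)"
        by (intro mu2.bm_integrable bm_intros D; simp)+
      have "(\<integral>z. 2 * (c1 * L * \<delta>)\<^sup>2 \<partial>\<mu>2) = 2 * (c1 * L * \<delta>)\<^sup>2 * (T - t)\<^sup>2"
        using bm_pair_integral_mult[OF mu.finite_measure_axioms mu.finite_measure_axioms bm_const[of _ "2 * (c1 * L * \<delta>)\<^sup>2"] bm_const[of _ 1]]
        by (simp only: mult_1_right) (simp add: space_mu measure_mu power2_eq_square)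
      then show ?thesis
        using i T0 by (simp add: Bochner_Integration.integral_add)
    qed
    also have "\<dots> \<le> 2 * (c1 * L)\<^sup>2 * (T - t)\<^sup>2 * \<delta> + 16 * (c1 * c2)\<^sup>2 * (2 * \<delta> * (T - t))"
    proof (intro add_mono mult_left_mono D(2))
      have "2 * (c1 * L * \<delta>)\<^sup>2 * (T - t)\<^sup>2 = 2 * (c1 * L)\<^sup>2 * (T - t)\<^sup>2 * \<delta>\<^sup>2"
        by (simp add: power_mult_distrib)
      also have "\<dots> \<le> 2 * (c1 * L)\<^sup>2 * (T - t)\<^sup>2 * \<delta>"
        by (intro mult_left_mono \<delta>2) auto
      finally show "2 * (c1 * L * \<delta>)\<^sup>2 * (T - t)\<^sup>2 \<le> 2 * (c1 * L)\<^sup>2 * (T - t)\<^sup>2 * \<delta>" .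
    qed auto
    finally have "(\<integral>z. (volterra_kernel \<psi>1 \<psi>2 z - stratonovich_kernel \<psi>1 \<psi>2 N \<tau> z)\<^sup>2 \<partial>\<mu>2) \<le>
        2 * (c1 * L)\<^sup>2 * (T - t)\<^sup>2 * \<delta> + 16 * (c1 * c2)\<^sup>2 * (2 * \<delta> * (T - t))" .
    then show "stratonovich_error \<psi>1 \<psi>2 (N, \<tau>) \<le> B * \<delta>"
      using tr by (simp add: stratonovich_error_def B_def algebra_simps)
  qed fact
qed

lemma stratonovich_error_tendsto:
  assumes \<psi>1: "C1_on t T \<psi>1" and \<psi>2: "C1_on t T \<psi>2"
  shows "(stratonovich_error \<psi>1 \<psi>2 \<longlongrightarrow> 0) (mesh_to_0 t T)"
proof (rule tendstoI)
  fix \<epsilon> :: real assume "\<epsilon> > 0"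
  let ?e = "stratonovich_error \<psi>1 \<psi>2"
  from stratonovich_error_le[OF \<psi>1 \<psi>2] obtain B where "B \<ge> 0" and
    B: "\<And>\<delta> N \<tau>. \<delta> \<le> 1 \<Longrightarrow> partition_of t T N \<tau> \<Longrightarrow> (\<forall>j<N. \<tau> (Suc j) - \<tau> j < \<delta>) \<Longrightarrow> ?e (N, \<tau>) \<le> B * \<delta>"
    by blast
  \<comment> \<open>Dividing by \<open>B + 1\<close> covers \<open>B = 0\<close> and leaves room for
    a strict inequality.\<close>
  define \<delta> where "\<delta> = min 1 (\<epsilon> / (B + 1))"
  have "\<delta> > 0" "\<delta> \<le> 1" using \<open>\<epsilon> > 0\<close> \<open>B \<ge> 0\<close> by (auto simp: \<delta>_def)
  have "\<delta> \<le> \<epsilon> / (B + 1)" by (simp add: \<delta>_def)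
  then have "(B + 1) * \<delta> \<le> \<epsilon>" using \<open>B \<ge> 0\<close> by (simp add: pos_le_divide_eq mult.commute)
  then have "B * \<delta> < \<epsilon>" using \<open>\<delta> > 0\<close> by (simp add: distrib_right)
  then have "?e (N, \<tau>) < \<epsilon>" if "partition_of t T N \<tau>" "\<forall>j<N. \<tau> (Suc j) - \<tau> j < \<delta>" for N \<tau>
    using B[OF \<open>\<delta> \<le> 1\<close> that] by linarith
  moreover have "?e (N, \<tau>) \<ge> 0" for N \<tau> by (simp add: stratonovich_error_def)
  ultimately show "eventually (\<lambda>x. dist (?e x) 0 < \<epsilon>) (mesh_to_0 t T)"
    unfolding eventually_mesh_to_0 using \<open>\<delta> > 0\<close> by (intro exI[of _ \<delta>]) auto
qed

end

section \<open>Moments of Wiener integrals of step functions\<close>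

context prob_space
begin

text \<open>The first four moments of a centred normal variable of variance \<open>v\<close>. They
  suffice for expectations of four factors, and the property is passed on to independent sums by
  expanding powers, without densities. Integrability of the fourth power includes the lower
  ones.\<close>

definition gauss_moments :: "('a \<Rightarrow> real) \<Rightarrow> real \<Rightarrow> bool" where
  "gauss_moments X v \<longleftrightarrow> X \<in> borel_measurable M \<and> integrable M (\<lambda>\<omega>. X \<omega> ^ 4) \<and>
     expectation X = 0 \<and> expectation (\<lambda>\<omega>. X \<omega> ^ 2) = v \<and>
     expectation (\<lambda>\<omega>. X \<omega> ^ 3) = 0 \<and> expectation (\<lambda>\<omega>. X \<omega> ^ 4) = 3 * v\<^sup>2"

lemma integrable_power_le_4:
  assumes [measurable]: "X \<in> borel_measurable M" and X: "integrable M (\<lambda>\<omega>. X \<omega> ^ 4 :: real)" and "k \<le> 4"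
  shows "integrable M (\<lambda>\<omega>. X \<omega> ^ k)"
proof (rule Bochner_Integration.integrable_bound)
  show "integrable M (\<lambda>\<omega>. 1 + X \<omega> ^ 4)" using X by simp
  have "\<bar>x\<bar> ^ k \<le> 1 + x ^ 4" for x :: real
  proof (cases "\<bar>x\<bar> \<le> 1")
    case True
    then show ?thesis using power_le_one[of "\<bar>x\<bar>" k] by (simp add: add_increasing2)
  next
    case False
    then show ?thesis using power_increasing[OF \<open>k \<le> 4\<close>, of "\<bar>x\<bar>"] by simp
  qed
  then show "AE \<omega> in M. norm (X \<omega> ^ k) \<le> norm (1 + X \<omega> ^ 4)"
    by (intro AE_I2) (simp add: power_abs abs_of_nonneg)
qed simp

lemma gauss_moments_zero: "gauss_moments (\<lambda>\<omega>. 0) 0"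
  by (simp add: gauss_moments_def)

lemma gauss_moments_scale:
  assumes "gauss_moments X v"
  shows "gauss_moments (\<lambda>\<omega>. c * X \<omega>) (c\<^sup>2 * v)"
  using assms by (auto simp: gauss_moments_def power_mult_distrib simp flip: power_mult)

text \<open>Independence factors every mixed moment in the binomial expansions; in degree four the
  result is \<open>3 * v\<^sup>2 + 6 * v * w + 3 * w\<^sup>2\<close>.\<close>

lemma gauss_moments_add_indep:
  assumes X: "gauss_moments X v" and Y: "gauss_moments Y w" and indep: "indep_var borel X borel Y"
  shows "gauss_moments (\<lambda>\<omega>. X \<omega> + Y \<omega>) (v + w)"
proof -
  have [measurable]: "X \<in> borel_measurable M" "Y \<in> borel_measurable M"
    using X Y by (auto simp: gauss_moments_def)
  have iX: "integrable M (\<lambda>\<omega>. X \<omega> ^ k)" and iY: "integrable M (\<lambda>\<omega>. Y \<omega> ^ k)" if "k \<le> 4" for k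
    using X Y that by (auto intro: integrable_power_le_4 simp: gauss_moments_def)
  have i: "integrable M (\<lambda>\<omega>. X \<omega> ^ j * Y \<omega> ^ k)"
    and e: "expectation (\<lambda>\<omega>. X \<omega> ^ j * Y \<omega> ^ k) = expectation (\<lambda>\<omega>. X \<omega> ^ j) * expectation (\<lambda>\<omega>. Y \<omega> ^ k)"
    if "j \<le> 4" "k \<le> 4" for j k
  proof -
    have "indep_var borel (\<lambda>\<omega>. X \<omega> ^ j) borel (\<lambda>\<omega>. Y \<omega> ^ k)"
      using indep_var_compose[OF indep, of "\<lambda>x. x ^ j" borel "\<lambda>x. x ^ k" borel] by (simp add: comp_def)
    from indep_var_lebesgue_integral[OF this iX iY] indep_var_integrable[OF this iX iY] that
    show "integrable M (\<lambda>\<omega>. X \<omega> ^ j * Y \<omega> ^ k)"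
      "expectation (\<lambda>\<omega>. X \<omega> ^ j * Y \<omega> ^ k) = expectation (\<lambda>\<omega>. X \<omega> ^ j) * expectation (\<lambda>\<omega>. Y \<omega> ^ k)"
      by auto
  qed
  note i1 = iX[of 1, simplified] iY[of 1, simplified]
  have m: "expectation X = 0" "expectation (\<lambda>\<omega>. X \<omega> ^ 2) = v" "expectation (\<lambda>\<omega>. X \<omega> ^ 3) = 0"
    "expectation (\<lambda>\<omega>. X \<omega> ^ 4) = 3 * v\<^sup>2" "expectation Y = 0" "expectation (\<lambda>\<omega>. Y \<omega> ^ 2) = w"
    "expectation (\<lambda>\<omega>. Y \<omega> ^ 3) = 0" "expectation (\<lambda>\<omega>. Y \<omega> ^ 4) = 3 * w\<^sup>2"
    using X Y by (auto simp: gauss_moments_def)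
  note ii = iX[of 2] iX[of 3] iX[of 4] iY[of 2] iY[of 3] iY[of 4]
    i[of 1 1, simplified] i[of 2 1, simplified] i[of 1 2, simplified] i[of 3 1, simplified] i[of 2 2] i[of 1 3, simplified]
  note ee = e[of 1 1, simplified] e[of 2 1, simplified] e[of 1 2, simplified] e[of 3 1, simplified] e[of 2 2] e[of 1 3, simplified]
  have p2: "(X \<omega> + Y \<omega>)\<^sup>2 = X \<omega> ^ 2 + 2 * (X \<omega> * Y \<omega>) + Y \<omega> ^ 2" for \<omega>
    by (simp add: power2_sum)
  have p3: "(X \<omega> + Y \<omega>) ^ 3 = X \<omega> ^ 3 + 3 * (X \<omega> ^ 2 * Y \<omega>) + 3 * (X \<omega> * Y \<omega> ^ 2) + Y \<omega> ^ 3" for \<omega>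
    by (simp add: power2_eq_square power3_eq_cube algebra_simps)
  have p4: "(X \<omega> + Y \<omega>) ^ 4 = X \<omega> ^ 4 + 4 * (X \<omega> ^ 3 * Y \<omega>) + 6 * (X \<omega> ^ 2 * Y \<omega> ^ 2) + 4 * (X \<omega> * Y \<omega> ^ 3) + Y \<omega> ^ 4" for \<omega>
    by (simp add: power2_eq_square power3_eq_cube power4_eq_xxxx algebra_simps)
  have v: "3 * (v + w)\<^sup>2 = 3 * v\<^sup>2 + 6 * (v * w) + 3 * w\<^sup>2"
    by (simp add: power2_sum)
  show ?thesis
    unfolding gauss_moments_def p2 p3 p4 v using ii i1 ee m by simp
qed

lemma gauss_moments_normal:
  assumes D: "distributed M lborel X (normal_density 0 \<sigma>)" and "\<sigma> > 0"
  shows "gauss_moments X (\<sigma>\<^sup>2)"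
proof -
  have X [measurable]: "X \<in> borel_measurable M" using distributed_measurable[OF D] by simp
  have E: "expectation (\<lambda>\<omega>. X \<omega> ^ k) = (\<integral>x. normal_density 0 \<sigma> x * x ^ k \<partial>lborel)" for k
    using distributed_integral[OF D, of "\<lambda>x. x ^ k"] by simp
  have "integrable M (\<lambda>\<omega>. X \<omega> ^ 4)"
    using distributed_integrable[OF D, of "\<lambda>x. x ^ 4"] integrable_normal_moment[OF \<open>\<sigma> > 0\<close>, of 0 4] by simp
  moreover have "expectation X = 0"
    using E[of 1] integral_normal_moment_odd[OF \<open>\<sigma> > 0\<close>, of 0 0] by simp
  moreover have "expectation (\<lambda>\<omega>. X \<omega> ^ 2) = \<sigma>\<^sup>2"
    using E[of 2] integral_normal_moment_even[OF \<open>\<sigma> > 0\<close>, of 0 1] by simp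
  moreover have "expectation (\<lambda>\<omega>. X \<omega> ^ 3) = 0"
    using E[of 3] integral_normal_moment_odd[OF \<open>\<sigma> > 0\<close>, of 0 1] by simp
  moreover have "expectation (\<lambda>\<omega>. X \<omega> ^ 4) = 3 * (\<sigma>\<^sup>2)\<^sup>2"
    using E[of 4] integral_normal_moment_even[OF \<open>\<sigma> > 0\<close>, of 0 2]
    by (simp add: fact_numeral power_divide)
  ultimately show ?thesis by (simp add: gauss_moments_def)
qed

end

section \<open>Wiener integrals of step functions\<close>

locale wiener_interval = wiener_setting M F T m f + interval t T
  for M :: "'a measure" and F T m f t +
  assumes t_nonneg: "0 \<le> t"
begin

lemma wiener_measurable: "i \<in> {1..m} \<Longrightarrow> s \<in> {0..T} \<Longrightarrow> f i s \<in> borel_measurable M"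
  using filtration_subalgebra wiener_adapted by (blast intro: measurable_from_subalg)

text \<open>Independence is assumed for \<open>F s\<close> and the vector of increments. The events
  of \<open>X\<close> lie in the former, those of one coordinate of the vector in the
  \<sigma>-algebra of the latter.\<close>

lemma wiener_increment_indep_var:
  assumes i: "i \<in> {1..m}" and "0 \<le> s" "s < u" "u \<le> T" and X: "X \<in> borel_measurable (F s)"
  shows "indep_var borel X borel (\<lambda>\<omega>. f i u \<omega> - f i s \<omega>)"
proof -
  let ?V = "\<lambda>\<omega>. \<lambda>i\<in>{1..m}. f i u \<omega> - f i s \<omega>"
  let ?A = "vimage_algebra (space M) ?V (Pi\<^sub>M {1..m} (\<lambda>_. borel))"
  let ?Y = "\<lambda>\<omega>. f i u \<omega> - f i s \<omega>"
  have sub: "subalgebra M (F s)" using assms by (intro filtration_subalgebra) auto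
  have sp: "space (F s) = space M" using sub by (simp add: subalgebra_def)
  have "?V \<in> measurable ?A (Pi\<^sub>M {1..m} (\<lambda>_. borel))"
    by (rule measurable_vimage_algebra1) (auto simp: space_PiM)
  then have "(\<lambda>\<omega>. ?V \<omega> i) \<in> borel_measurable ?A"
    by (rule measurable_compose[OF _ measurable_component_singleton]) (use i in auto)
  then have Y: "?Y \<in> borel_measurable ?A" using i by simp
  have 1: "sigma_sets (space M) {X -` B \<inter> space M |B. B \<in> sets borel} \<subseteq> sets (F s)"
    using sets.sigma_sets_subset[of "{X -` B \<inter> space M |B. B \<in> sets borel}" "F s"] measurable_sets[OF X]
    by (auto simp: sp)
  have 2: "sigma_sets (space M) {?Y -` B \<inter> space M |B. B \<in> sets borel} \<subseteq> sets ?A"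
    using sets.sigma_sets_subset[of "{?Y -` B \<inter> space M |B. B \<in> sets borel}" ?A] measurable_sets[OF Y]
    by auto
  show ?thesis
    unfolding indep_var_eq
  proof (intro conjI)
    show "random_variable borel X" using sub X by (rule measurable_from_subalg)
    show "random_variable borel ?Y"
      using assms by (intro borel_measurable_diff wiener_measurable) auto
    show "indep_set (sigma_sets (space M) {X -` B \<inter> space M |B. B \<in> sets borel})
        (sigma_sets (space M) {?Y -` B \<inter> space M |B. B \<in> sets borel})"
      using wiener_increment_indep[OF assms(2-4)] 1 2 unfolding indep_sets2_eq by blast
  qed
qed

text \<open>Step functions are indexed by a finite set of right end points of intervals that all
  start at \<open>t\<close>. A linear combination then needs only the union of the two sets and no
  common refinement of partitions.\<close>

definition wiener_sum :: "nat \<Rightarrow> real set \<Rightarrow> (real \<Rightarrow> real) \<Rightarrow> 'a \<Rightarrow> real" where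
  "wiener_sum i U c \<omega> = (\<Sum>u\<in>U. c u * (f i u \<omega> - f i t \<omega>))"

definition step_sum :: "real set \<Rightarrow> (real \<Rightarrow> real) \<Rightarrow> real \<Rightarrow> real" where
  "step_sum U c x = (\<Sum>u\<in>U. c u * indicator {t..<u} x)"

lemma bm_step_sum [bm_intros]: "bounded_measurable \<mu> (step_sum U c)"
  unfolding step_sum_def[abs_def] by (intro bm_intros) auto

lemma wiener_sum_adapted:
  assumes "i \<in> {1..m}" "U \<subseteq> {t..s}" "s \<in> {t..T}"
  shows "wiener_sum i U c \<in> borel_measurable (F s)"
proof -
  have "f i u \<in> borel_measurable (F s)" if "u \<in> {t..s}" for u
  proof -
    have "f i u \<in> borel_measurable (F u)" using that assms t_nonneg by (intro wiener_adapted) auto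
    moreover have "sets (F u) \<subseteq> sets (F s)" "space (F u) = space (F s)"
      using filtration_mono[of u s] filtration_subalgebra[of u] filtration_subalgebra[of s] that assms t_nonneg
      by (auto simp: subalgebra_def)
    ultimately show ?thesis by (auto simp: measurable_def)
  qed
  moreover from this[of t] assms have "f i t \<in> borel_measurable (F s)" by simp
  ultimately show ?thesis
    unfolding wiener_sum_def[abs_def] using assms(2) by (intro borel_measurable_sum borel_measurable_times borel_measurable_diff) auto
qed

lemma integral_indicator_mu:
  "a \<in> {t..T} \<Longrightarrow> b \<in> {t..T} \<Longrightarrow> a \<le> b \<Longrightarrow> (\<integral>x. indicator {a..<b} x \<partial>\<mu>) = b - a"
  using integral_mu_indicator[of "\<lambda>_. 1" a b] by simp

text \<open>Induction on the largest node \<open>b\<close>. Splitting \<open>[t, b)\<close> at the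
  preceding node \<open>s\<close> leaves a sum over the earlier nodes, measurable at time
  \<open>s\<close>, plus an independent increment from \<open>s\<close> to \<open>b\<close>.\<close>

lemma wiener_sum_moments:
  assumes i: "i \<in> {1..m}"
  shows "finite U \<Longrightarrow> U \<subseteq> {t..T} \<Longrightarrow> gauss_moments (wiener_sum i U c) (\<integral>x. (step_sum U c x)\<^sup>2 \<partial>\<mu>)"
proof (induction U arbitrary: c rule: finite_linorder_max_induct)
  case empty
  then show ?case by (simp add: wiener_sum_def[abs_def] step_sum_def gauss_moments_zero)
next
  case (insert b A)
  \<comment> \<open>The last node before \<open>b\<close>, or \<open>t\<close> if there is
    none.\<close>
  define s where "s = Max (insert t A)"
  have s: "s \<in> insert t A" unfolding s_def using insert.hyps by (intro Max_in) auto
  have A_le: "a \<le> s" if "a \<in> A" for a unfolding s_def using insert.hyps that by (intro Max_ge) auto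
  have b: "b \<in> {t..T}" "b \<notin> A" using insert by auto
  have sT: "s \<in> {t..T}" "s \<le> b" using s insert b t_less_T by auto
  \<comment> \<open>The weight of \<open>b\<close> on \<open>[t, s)\<close> is moved to the node
    \<open>s\<close>. If \<open>s\<close> is not a node it equals \<open>t\<close>, where the
    corresponding term is zero.\<close>
  define c' where "c' = (if s \<in> A then c(s := c s + c b) else c)"
  have upd: "(\<Sum>u\<in>A. c' u * g u) = (\<Sum>u\<in>A. c u * g u) + c b * g s" if "g t = 0" for g :: "real \<Rightarrow> real"
  proof (cases "s \<in> A")
    case True
    then have "(\<Sum>u\<in>A. c' u * g u) = (\<Sum>u\<in>A. c u * g u + (if u = s then c b * g s else 0))"
      by (intro sum.cong refl) (auto simp: c'_def algebra_simps)
    then show ?thesis using True insert.hyps by (simp add: sum.distrib)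
  next
    case False
    then show ?thesis using s that by (simp add: c'_def)
  qed
  have ws: "wiener_sum i (insert b A) c = (\<lambda>\<omega>. wiener_sum i A c' \<omega> + c b * (f i b \<omega> - f i s \<omega>))"
    using insert.hyps b upd[of "\<lambda>u. f i u _ - f i t _"]
    by (auto simp: wiener_sum_def algebra_simps)
  have ss: "step_sum (insert b A) c = (\<lambda>x. step_sum A c' x + c b * indicator {s..<b} x)"
  proof
    fix x
    have "indicator {t..<b} x = (indicator {t..<s} x + indicator {s..<b} x :: real)"
      using sT by (auto split: split_indicator)
    moreover have "step_sum (insert b A) c x = c b * indicator {t..<b} x + (\<Sum>u\<in>A. c u * indicator {t..<u} x)"
      unfolding step_sum_def using insert.hyps(1) b(2) by (rule sum.insert)
    moreover have "step_sum A c' x = (\<Sum>u\<in>A. c u * indicator {t..<u} x) + c b * indicator {t..<s} x"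
      unfolding step_sum_def by (rule upd) simp
    ultimately show "step_sum (insert b A) c x = step_sum A c' x + c b * indicator {s..<b} x"
      by (simp only: distrib_left)
  qed
  have disj: "step_sum A c' x * indicator {s..<b} x = 0" for x
    using A_le by (force simp: step_sum_def intro!: sum.neutral split: split_indicator)
  have sq: "(step_sum (insert b A) c x)\<^sup>2 = (step_sum A c' x)\<^sup>2 + (c b)\<^sup>2 * indicator {s..<b} x" for x
    using disj[of x] unfolding ss power2_sum by (auto simp: power_mult_distrib split: split_indicator)
  have var: "(\<integral>x. (step_sum (insert b A) c x)\<^sup>2 \<partial>\<mu>) = (\<integral>x. (step_sum A c' x)\<^sup>2 \<partial>\<mu>) + (c b)\<^sup>2 * (b - s)"
  proof -
    have "(\<integral>x. (step_sum (insert b A) c x)\<^sup>2 \<partial>\<mu>) =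
        (\<integral>x. (step_sum A c' x)\<^sup>2 \<partial>\<mu>) + (\<integral>x. (c b)\<^sup>2 * indicator {s..<b} x \<partial>\<mu>)"
      unfolding sq by (intro Bochner_Integration.integral_add mu.bm_integrable bm_intros) auto
    then show ?thesis using integral_indicator_mu[OF sT(1) b(1) sT(2)] by simp
  qed
  have IH: "gauss_moments (wiener_sum i A c') (\<integral>x. (step_sum A c' x)\<^sup>2 \<partial>\<mu>)"
    using insert by auto
  show ?case
  proof (cases "s = b")
    \<comment> \<open>This only happens for \<open>b = t\<close>, where the increment is
      zero.\<close>
    case True
    then show ?thesis using IH unfolding ws var by simp
  next
    case False
    then have "s < b" using sT by simp
    have "gauss_moments (\<lambda>\<omega>. f i b \<omega> - f i s \<omega>) ((sqrt (b - s))\<^sup>2)"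
      using i sT b t_nonneg \<open>s < b\<close> by (intro gauss_moments_normal wiener_increment_normal) auto
    then have "gauss_moments (\<lambda>\<omega>. c b * (f i b \<omega> - f i s \<omega>)) ((c b)\<^sup>2 * (b - s))"
      using \<open>s < b\<close> gauss_moments_scale by fastforce
    moreover have "indep_var borel (wiener_sum i A c') borel (\<lambda>\<omega>. c b * (f i b \<omega> - f i s \<omega>))"
    proof -
      have "wiener_sum i A c' \<in> borel_measurable (F s)"
        using i sT insert A_le by (intro wiener_sum_adapted) auto
      then have "indep_var borel (wiener_sum i A c') borel (\<lambda>\<omega>. f i b \<omega> - f i s \<omega>)"
        using i sT b t_nonneg \<open>s < b\<close> by (intro wiener_increment_indep_var) auto
      from indep_var_compose[OF this, of "\<lambda>x. x" borel "\<lambda>x. c b * x" borel] show ?thesis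
        by (simp add: comp_def)
    qed
    ultimately show ?thesis unfolding ws var by (intro gauss_moments_add_indep IH)
  qed
qed

definition simple_int :: "nat \<Rightarrow> (real \<Rightarrow> real) \<Rightarrow> ('a \<Rightarrow> real) \<Rightarrow> bool" where
  "simple_int i a X \<longleftrightarrow>
     (if i = 0 then bounded_measurable \<mu> a \<and> X = (\<lambda>\<omega>. \<integral>x. a x \<partial>\<mu>)
      else \<exists>U c. finite U \<and> U \<subseteq> {t..T} \<and> a = step_sum U c \<and> X = wiener_sum i U c)"

lemma simple_int_bm: "simple_int i a X \<Longrightarrow> bounded_measurable \<mu> a"
  by (auto simp: simple_int_def bm_intros split: if_splits)

lemma simple_int_lin:
  assumes X: "simple_int i a X" and Y: "simple_int i b Y"
  shows "simple_int i (\<lambda>x. p * a x + q * b x) (\<lambda>\<omega>. p * X \<omega> + q * Y \<omega>)"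
proof (cases "i = 0")
  case True
  then have [bm_intros]: "bounded_measurable \<mu> a" "bounded_measurable \<mu> b"
    using X Y by (auto simp: simple_int_def)
  have "(\<integral>x. p * a x + q * b x \<partial>\<mu>) = p * (\<integral>x. a x \<partial>\<mu>) + q * (\<integral>x. b x \<partial>\<mu>)"
    by (subst Bochner_Integration.integral_add) (auto intro!: mu.bm_integrable bm_intros)
  then show ?thesis using X Y True by (auto simp: simple_int_def intro!: bm_intros)
next
  case False
  then obtain U c V d where
    U: "finite U" "U \<subseteq> {t..T}" "a = step_sum U c" "X = wiener_sum i U c" and
    V: "finite V" "V \<subseteq> {t..T}" "b = step_sum V d" "Y = wiener_sum i V d"
    using X Y by (auto simp: simple_int_def)
  define e where "e u = p * (if u \<in> U then c u else 0) + q * (if u \<in> V then d u else 0)" for u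
  have *: "(\<Sum>u\<in>U \<union> V. e u * g u) = p * (\<Sum>u\<in>U. c u * g u) + q * (\<Sum>u\<in>V. d u * g u)" for g :: "real \<Rightarrow> real"
  proof -
    have "(\<Sum>u\<in>U. c u * g u) = (\<Sum>u\<in>U \<union> V. (if u \<in> U then c u else 0) * g u)"
      using U V by (intro sum.mono_neutral_cong_left) auto
    moreover have "(\<Sum>u\<in>V. d u * g u) = (\<Sum>u\<in>U \<union> V. (if u \<in> V then d u else 0) * g u)"
      using U V by (intro sum.mono_neutral_cong_left) auto
    ultimately show ?thesis
      by (simp only: e_def sum_distrib_left sum.distrib[symmetric] distrib_right mult.assoc)
  qed
  have "(\<lambda>x. p * a x + q * b x) = step_sum (U \<union> V) e"
    by (rule ext) (simp only: U V step_sum_def *)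
  moreover have "(\<lambda>\<omega>. p * X \<omega> + q * Y \<omega>) = wiener_sum i (U \<union> V) e"
    by (rule ext) (simp only: U V wiener_sum_def *)
  ultimately show ?thesis using False U V by (auto simp: simple_int_def)
qed

lemma simple_int_moments:
  assumes "i \<in> {1..m}" "simple_int i a X"
  shows "gauss_moments X (\<integral>x. (a x)\<^sup>2 \<partial>\<mu>)"
  using assms by (auto simp: simple_int_def intro: wiener_sum_moments)

text \<open>Sums of simple integrals are simple integrals, so the variances determine the
  covariances by polarization.\<close>

lemma simple_int_covariance:
  assumes i: "i \<in> {1..m}" and X: "simple_int i a X" and Y: "simple_int i b Y"
  shows "integrable M (\<lambda>\<omega>. X \<omega> * Y \<omega>)" "expectation (\<lambda>\<omega>. X \<omega> * Y \<omega>) = (\<integral>x. a x * b x \<partial>\<mu>)"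
proof -
  note bm [bm_intros] = simple_int_bm[OF X] simple_int_bm[OF Y]
  have S: "simple_int i (\<lambda>x. a x + b x) (\<lambda>\<omega>. X \<omega> + Y \<omega>)"
    using simple_int_lin[OF X Y, of 1 1] by simp
  have i2: "integrable M (\<lambda>\<omega>. Z \<omega> ^ 2)" and e2: "expectation (\<lambda>\<omega>. Z \<omega> ^ 2) = (\<integral>x. (g x)\<^sup>2 \<partial>\<mu>)"
    if "simple_int i g Z" for g Z
    using simple_int_moments[OF i that] by (auto simp: gauss_moments_def intro: integrable_power_le_4)
  have XY: "(\<lambda>\<omega>. X \<omega> * Y \<omega>) = (\<lambda>\<omega>. ((X \<omega> + Y \<omega>)\<^sup>2 - X \<omega> ^ 2 - Y \<omega> ^ 2) / 2)"
    by (simp add: power2_sum)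
  show "integrable M (\<lambda>\<omega>. X \<omega> * Y \<omega>)"
    unfolding XY using i2[OF X] i2[OF Y] i2[OF S] by auto
  have "expectation (\<lambda>\<omega>. X \<omega> * Y \<omega>) = ((\<integral>x. (a x + b x)\<^sup>2 \<partial>\<mu>) - (\<integral>x. (a x)\<^sup>2 \<partial>\<mu>) - (\<integral>x. (b x)\<^sup>2 \<partial>\<mu>)) / 2"
    unfolding XY using i2[OF X] i2[OF Y] i2[OF S] e2[OF X] e2[OF Y] e2[OF S] by simp
  also have "(\<integral>x. (a x + b x)\<^sup>2 \<partial>\<mu>) = (\<integral>x. (a x)\<^sup>2 \<partial>\<mu>) + (\<integral>x. (b x)\<^sup>2 \<partial>\<mu>) + 2 * (\<integral>x. a x * b x \<partial>\<mu>)"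
  proof -
    have "integrable \<mu> (\<lambda>x. (a x)\<^sup>2)" "integrable \<mu> (\<lambda>x. (b x)\<^sup>2)" "integrable \<mu> (\<lambda>x. a x * b x)"
      by (intro mu.bm_integrable bm_intros)+
    then show ?thesis by (simp add: power2_sum mult.assoc)
  qed
  finally show "expectation (\<lambda>\<omega>. X \<omega> * Y \<omega>) = (\<integral>x. a x * b x \<partial>\<mu>)" by simp
qed

end

text \<open>Every fourth power carries the product of the signs of \<open>y\<close>,
  \<open>z\<close> and \<open>w\<close>. Only the monomial odd in all three survives, with
  coefficient 8 * 4! = 192.\<close>

lemma polarization_4:
  fixes x y z w :: real
  shows "192 * (x * y * z * w) =
    (x + y + z + w) ^ 4 - (x + y + z - w) ^ 4 - (x + y - z + w) ^ 4 + (x + y - z - w) ^ 4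
    - (x - y + z + w) ^ 4 + (x - y + z - w) ^ 4 + (x - y - z + w) ^ 4 - (x - y - z - w) ^ 4"
  by algebra

context wiener_interval
begin

text \<open>Joint normality is replaced by linearity: each signed sum \<open>Q\<close> of the four
  integrals is a simple integral, so its fourth moment is three times its squared variance
  \<open>V\<close>. Polarization recovers the mixed moment.\<close>

lemma simple_int_isserlis:
  assumes i: "i \<in> {1..m}"
    and S: "simple_int i a1 X1" "simple_int i a2 X2" "simple_int i a3 X3" "simple_int i a4 X4"
  shows "integrable M (\<lambda>\<omega>. X1 \<omega> * X2 \<omega> * X3 \<omega> * X4 \<omega>)"
    and "expectation (\<lambda>\<omega>. X1 \<omega> * X2 \<omega> * X3 \<omega> * X4 \<omega>) =
      (\<integral>x. a1 x * a2 x \<partial>\<mu>) * (\<integral>x. a3 x * a4 x \<partial>\<mu>) +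
      (\<integral>x. a1 x * a3 x \<partial>\<mu>) * (\<integral>x. a2 x * a4 x \<partial>\<mu>) +
      (\<integral>x. a1 x * a4 x \<partial>\<mu>) * (\<integral>x. a2 x * a3 x \<partial>\<mu>)"
proof -
  note bm [bm_intros] = S[THEN simple_int_bm]
  define Q where "Q p q r \<omega> = X1 \<omega> + p * X2 \<omega> + q * X3 \<omega> + r * X4 \<omega>" for p q r \<omega>
  define n where "n a b = (\<integral>x. a x * b x \<partial>\<mu>)" for a b :: "real \<Rightarrow> real"
  define V where "V p q r = n a1 a1 + p\<^sup>2 * n a2 a2 + q\<^sup>2 * n a3 a3 + r\<^sup>2 * n a4 a4 + 2 * p * n a1 a2 +
    2 * q * n a1 a3 + 2 * r * n a1 a4 + 2 * p * q * n a2 a3 + 2 * p * r * n a2 a4 + 2 * q * r * n a3 a4" for p q r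
  have QV: "gauss_moments (Q p q r) (V p q r)" for p q r
  proof -
    have "simple_int i (\<lambda>x. a1 x + p * a2 x) (\<lambda>\<omega>. X1 \<omega> + p * X2 \<omega>)"
      using simple_int_lin[OF S(1,2), of 1 p] by simp
    from simple_int_lin[OF this S(3), of 1 q]
    have "simple_int i (\<lambda>x. a1 x + p * a2 x + q * a3 x) (\<lambda>\<omega>. X1 \<omega> + p * X2 \<omega> + q * X3 \<omega>)" by simp
    from simple_int_lin[OF this S(4), of 1 r]
    have "simple_int i (\<lambda>x. a1 x + p * a2 x + q * a3 x + r * a4 x) (Q p q r)" by (simp add: Q_def[abs_def])
    from simple_int_moments[OF i this]
    have "gauss_moments (Q p q r) (\<integral>x. (a1 x + p * a2 x + q * a3 x + r * a4 x)\<^sup>2 \<partial>\<mu>)" .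
    also have "(\<integral>x. (a1 x + p * a2 x + q * a3 x + r * a4 x)\<^sup>2 \<partial>\<mu>) =
       (\<integral>x. a1 x * a1 x + p\<^sup>2 * (a2 x * a2 x) + q\<^sup>2 * (a3 x * a3 x) + r\<^sup>2 * (a4 x * a4 x) + 2 * p * (a1 x * a2 x) +
        2 * q * (a1 x * a3 x) + 2 * r * (a1 x * a4 x) + 2 * p * q * (a2 x * a3 x) + 2 * p * r * (a2 x * a4 x) +
        2 * q * r * (a3 x * a4 x) \<partial>\<mu>)"
      by (intro Bochner_Integration.integral_cong refl) (simp add: power2_eq_square algebra_simps)
    also have "\<dots> = V p q r"
    proof -
      have "integrable \<mu> (\<lambda>x. a1 x * a1 x)" "integrable \<mu> (\<lambda>x. a2 x * a2 x)" "integrable \<mu> (\<lambda>x. a3 x * a3 x)"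
        "integrable \<mu> (\<lambda>x. a4 x * a4 x)" "integrable \<mu> (\<lambda>x. a1 x * a2 x)" "integrable \<mu> (\<lambda>x. a1 x * a3 x)"
        "integrable \<mu> (\<lambda>x. a1 x * a4 x)" "integrable \<mu> (\<lambda>x. a2 x * a3 x)" "integrable \<mu> (\<lambda>x. a2 x * a4 x)"
        "integrable \<mu> (\<lambda>x. a3 x * a4 x)"
        by (intro mu.bm_integrable bm_intros)+
      then show ?thesis by (simp add: V_def n_def)
    qed
    finally show ?thesis .
  qed
  have iQ: "integrable M (\<lambda>\<omega>. Q p q r \<omega> ^ 4)" and eQ: "expectation (\<lambda>\<omega>. Q p q r \<omega> ^ 4) = 3 * (V p q r)\<^sup>2" for p q r
    using QV[of p q r] by (auto simp: gauss_moments_def)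
  have prod: "(\<lambda>\<omega>. X1 \<omega> * X2 \<omega> * X3 \<omega> * X4 \<omega>) = (\<lambda>\<omega>. (Q 1 1 1 \<omega> ^ 4 - Q 1 1 (-1) \<omega> ^ 4 - Q 1 (-1) 1 \<omega> ^ 4
      + Q 1 (-1) (-1) \<omega> ^ 4 - Q (-1) 1 1 \<omega> ^ 4 + Q (-1) 1 (-1) \<omega> ^ 4 + Q (-1) (-1) 1 \<omega> ^ 4 - Q (-1) (-1) (-1) \<omega> ^ 4) / 192)"
  proof
    fix \<omega>
    show "X1 \<omega> * X2 \<omega> * X3 \<omega> * X4 \<omega> = (Q 1 1 1 \<omega> ^ 4 - Q 1 1 (-1) \<omega> ^ 4 - Q 1 (-1) 1 \<omega> ^ 4
      + Q 1 (-1) (-1) \<omega> ^ 4 - Q (-1) 1 1 \<omega> ^ 4 + Q (-1) 1 (-1) \<omega> ^ 4 + Q (-1) (-1) 1 \<omega> ^ 4 - Q (-1) (-1) (-1) \<omega> ^ 4) / 192"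
      using polarization_4[of "X1 \<omega>" "X2 \<omega>" "X3 \<omega>" "X4 \<omega>"] by (simp add: Q_def)
  qed
  show "integrable M (\<lambda>\<omega>. X1 \<omega> * X2 \<omega> * X3 \<omega> * X4 \<omega>)"
    unfolding prod using iQ by simp
  have "expectation (\<lambda>\<omega>. X1 \<omega> * X2 \<omega> * X3 \<omega> * X4 \<omega>) = (3 * (V 1 1 1)\<^sup>2 - 3 * (V 1 1 (-1))\<^sup>2 - 3 * (V 1 (-1) 1)\<^sup>2
      + 3 * (V 1 (-1) (-1))\<^sup>2 - 3 * (V (-1) 1 1)\<^sup>2 + 3 * (V (-1) 1 (-1))\<^sup>2 + 3 * (V (-1) (-1) 1)\<^sup>2 - 3 * (V (-1) (-1) (-1))\<^sup>2) / 192"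
    unfolding prod using iQ eQ by simp
  also have "\<dots> = n a1 a2 * n a3 a4 + n a1 a3 * n a2 a4 + n a1 a4 * n a2 a3"
    unfolding V_def by (simp add: power2_eq_square field_simps)
  finally show "expectation (\<lambda>\<omega>. X1 \<omega> * X2 \<omega> * X3 \<omega> * X4 \<omega>) =
      (\<integral>x. a1 x * a2 x \<partial>\<mu>) * (\<integral>x. a3 x * a4 x \<partial>\<mu>) +
      (\<integral>x. a1 x * a3 x \<partial>\<mu>) * (\<integral>x. a2 x * a4 x \<partial>\<mu>) +
      (\<integral>x. a1 x * a4 x \<partial>\<mu>) * (\<integral>x. a2 x * a3 x \<partial>\<mu>)"
    by (simp add: n_def)
qed

text \<open>The integrals are measurable functions of whole component paths, and independence of the
  components is given for whole paths.\<close>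

lemma simple_int_indep:
  assumes i: "i \<in> {1..m}" and k: "k \<in> {1..m}" and "i \<noteq> k"
    and X: "simple_int i a1 X1" "simple_int i a2 X2" and Y: "simple_int k b1 Y1" "simple_int k b2 Y2"
  shows "integrable M (\<lambda>\<omega>. X1 \<omega> * X2 \<omega> * (Y1 \<omega> * Y2 \<omega>))"
    and "expectation (\<lambda>\<omega>. X1 \<omega> * X2 \<omega> * (Y1 \<omega> * Y2 \<omega>)) = (\<integral>x. a1 x * a2 x \<partial>\<mu>) * (\<integral>x. b1 x * b2 x \<partial>\<mu>)"
proof -
  have path: "\<exists>g. g \<in> borel_measurable (Pi\<^sub>M {0..T} (\<lambda>_. borel)) \<and> X = (\<lambda>\<omega>. g (\<lambda>s\<in>{0..T}. f l s \<omega>))"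
    if l: "l \<in> {1..m}" and X: "simple_int l a X" for l a X
  proof -
    from X l obtain U c where U: "finite U" "U \<subseteq> {t..T}" "X = wiener_sum l U c"
      by (auto simp: simple_int_def)
    have UT: "u \<in> {0..T}" if "u \<in> U" for u using that U t_nonneg by auto
    have tT: "t \<in> {0..T}" using t_nonneg t_less_T by auto
    show ?thesis
    proof (intro exI conjI)
      show "(\<lambda>p. \<Sum>u\<in>U. c u * (p u - p t)) \<in> borel_measurable (Pi\<^sub>M {0..T} (\<lambda>_. borel))"
        using UT tT by (intro borel_measurable_sum borel_measurable_times borel_measurable_diff
          measurable_component_singleton) auto
      show "X = (\<lambda>\<omega>. \<Sum>u\<in>U. c u * ((\<lambda>s\<in>{0..T}. f l s \<omega>) u - (\<lambda>s\<in>{0..T}. f l s \<omega>) t))"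
        unfolding U(3) wiener_sum_def[abs_def] using UT tT by (intro ext sum.cong refl) auto
    qed
  qed
  obtain g1 g2 h1 h2 where g: "g1 \<in> borel_measurable (Pi\<^sub>M {0..T} (\<lambda>_. borel))" "X1 = (\<lambda>\<omega>. g1 (\<lambda>s\<in>{0..T}. f i s \<omega>))"
    "g2 \<in> borel_measurable (Pi\<^sub>M {0..T} (\<lambda>_. borel))" "X2 = (\<lambda>\<omega>. g2 (\<lambda>s\<in>{0..T}. f i s \<omega>))"
    and h: "h1 \<in> borel_measurable (Pi\<^sub>M {0..T} (\<lambda>_. borel))" "Y1 = (\<lambda>\<omega>. h1 (\<lambda>s\<in>{0..T}. f k s \<omega>))"
    "h2 \<in> borel_measurable (Pi\<^sub>M {0..T} (\<lambda>_. borel))" "Y2 = (\<lambda>\<omega>. h2 (\<lambda>s\<in>{0..T}. f k s \<omega>))"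
    using path[OF i X(1)] path[OF i X(2)] path[OF k Y(1)] path[OF k Y(2)] by blast
  define G where "G l p = (if l = i then g1 p * g2 p else h1 p * h2 p)" for l p
  define Z where "Z l \<omega> = G l (\<lambda>s\<in>{0..T}. f l s \<omega>)" for l \<omega>
  have "indep_vars (\<lambda>_. Pi\<^sub>M {0..T} (\<lambda>_. borel)) (\<lambda>i \<omega>. \<lambda>s\<in>{0..T}. f i s \<omega>) {i, k}"
    using wiener_components_indep by (rule indep_vars_subset) (use i k in auto)
  then have ind: "indep_vars (\<lambda>_. borel) Z {i, k}"
    unfolding Z_def[abs_def] by (rule indep_vars_compose2) (use g h in \<open>auto simp: G_def[abs_def]\<close>)
  have Z: "Z i = (\<lambda>\<omega>. X1 \<omega> * X2 \<omega>)" "Z k = (\<lambda>\<omega>. Y1 \<omega> * Y2 \<omega>)"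
    using g h \<open>i \<noteq> k\<close> by (auto simp: Z_def G_def)
  have int: "integrable M (Z l)" if "l \<in> {i, k}" for l
    using that simple_int_covariance(1)[OF i X] simple_int_covariance(1)[OF k Y] Z by auto
  show "integrable M (\<lambda>\<omega>. X1 \<omega> * X2 \<omega> * (Y1 \<omega> * Y2 \<omega>))"
    using indep_vars_integrable[OF _ ind int] \<open>i \<noteq> k\<close> by (simp add: Z)
  show "expectation (\<lambda>\<omega>. X1 \<omega> * X2 \<omega> * (Y1 \<omega> * Y2 \<omega>)) = (\<integral>x. a1 x * a2 x \<partial>\<mu>) * (\<integral>x. b1 x * b2 x \<partial>\<mu>)"
    using indep_vars_lebesgue_integral[OF _ ind int] \<open>i \<noteq> k\<close>
      simple_int_covariance(2)[OF i X] simple_int_covariance(2)[OF k Y] by (simp add: Z)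
qed

text \<open>
  Bilinear expressions in two families of integrals, tracked together with their kernel on
  \<open>[t, T]\<^sup>2\<close> and the trace of the kernel. The trace is not determined by the kernel as an element
  of \<open>L\<^sub>2\<close>, but it contributes to the mean square when both families use the same Wiener process.
\<close>

inductive bilinear ::
  "((real \<Rightarrow> real) \<Rightarrow> ('a \<Rightarrow> real) \<Rightarrow> bool) \<Rightarrow> ((real \<Rightarrow> real) \<Rightarrow> ('a \<Rightarrow> real) \<Rightarrow> bool) \<Rightarrow>
    (real \<times> real \<Rightarrow> real) \<Rightarrow> real \<Rightarrow> ('a \<Rightarrow> real) \<Rightarrow> bool"
  for A B where
  zero: "bilinear A B (\<lambda>z. 0) 0 (\<lambda>\<omega>. 0)"
| base: "A a X \<Longrightarrow> B b Y \<Longrightarrow>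
    bilinear A B (\<lambda>z. a (fst z) * b (snd z)) (\<integral>x. a x * b x \<partial>\<mu>) (\<lambda>\<omega>. X \<omega> * Y \<omega>)"
| lin: "bilinear A B k u X \<Longrightarrow> bilinear A B l v Y \<Longrightarrow>
    bilinear A B (\<lambda>z. c * k z + l z) (c * u + v) (\<lambda>\<omega>. c * X \<omega> + Y \<omega>)"

lemma bilinear_add:
  "bilinear A B k u X \<Longrightarrow> bilinear A B l v Y \<Longrightarrow> bilinear A B (\<lambda>z. k z + l z) (u + v) (\<lambda>\<omega>. X \<omega> + Y \<omega>)"
  using bilinear.lin[of A B k u X l v Y 1] by simp

lemma bilinear_scale: "bilinear A B k u X \<Longrightarrow> bilinear A B (\<lambda>z. c * k z) (c * u) (\<lambda>\<omega>. c * X \<omega>)"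
  using bilinear.lin[OF _ bilinear.zero, of A B k u X c] by simp

lemma bilinear_diff:
  "bilinear A B k u X \<Longrightarrow> bilinear A B l v Y \<Longrightarrow> bilinear A B (\<lambda>z. k z - l z) (u - v) (\<lambda>\<omega>. X \<omega> - Y \<omega>)"
  using bilinear.lin[of A B l v Y k u X "-1"] by simp

lemma bilinear_sum:
  "(\<And>i. i \<in> I \<Longrightarrow> bilinear A B (k i) (u i) (X i)) \<Longrightarrow>
    bilinear A B (\<lambda>z. \<Sum>i\<in>I. k i z) (\<Sum>i\<in>I. u i) (\<lambda>\<omega>. \<Sum>i\<in>I. X i \<omega>)"
  by (induction I rule: infinite_finite_induct) (auto intro: bilinear_add bilinear.zero)

text \<open>Exchanging the two families transposes the kernel and keeps the trace. It reduces the
  case \<open>i2 = 0\<close> to \<open>i1 = 0\<close>.\<close>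

lemma bilinear_swap:
  "bilinear A B k u X \<Longrightarrow> bilinear B A (\<lambda>z. k (snd z, fst z)) u X"
proof (induction rule: bilinear.induct)
  case (base a X b Y)
  then show ?case using bilinear.base[of B b Y A a X] by (simp add: mult.commute)
qed (auto intro: bilinear.intros)

lemma bilinear_bm:
  assumes "bilinear A B k u X" "\<And>a X. A a X \<Longrightarrow> bounded_measurable \<mu> a" "\<And>b Y. B b Y \<Longrightarrow> bounded_measurable \<mu> b"
  shows "bounded_measurable \<mu>2 k"
  using assms(1)
proof (induction rule: bilinear.induct)
  case (base a X b Y)
  then show ?case by (intro bm_intros assms(2)[of a X] assms(3)[of b Y])
qed (auto intro!: bm_intros)

lemma bm_swap:
  "bounded_measurable \<mu>2 k \<Longrightarrow> bounded_measurable \<mu>2 (\<lambda>z. k (snd z, fst z))"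
  unfolding bounded_measurable_def by (auto simp: space_pair_measure)

lemma integral_swap:
  assumes "bounded_measurable \<mu>2 k"
  shows "(\<integral>z. k (snd z, fst z) \<partial>\<mu>2) = (\<integral>z. k z \<partial>\<mu>2)"
  using mu_pair.integral_product_swap[OF bm_measurable[OF assms]] by (simp add: case_prod_unfold)

text \<open>The three terms are the three pairings in Isserlis' formula for
  \<open>X1 * Y1 * X2 * Y2\<close>: within each product, like with like, and crosswise.
  \<open>d\<close> is 1 if both families use the same Wiener process and 0 otherwise, when only the
  middle pairing remains.\<close>

definition covariance_form :: "real \<Rightarrow> (real \<times> real \<Rightarrow> real) \<Rightarrow> real \<Rightarrow> (real \<times> real \<Rightarrow> real) \<Rightarrow> real \<Rightarrow> real" where
  "covariance_form d k u l v = d * (u * v) + (\<integral>z. k z * l z \<partial>\<mu>2) +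
     d * (\<integral>z. k z * l (snd z, fst z) \<partial>\<mu>2)"

lemma covariance_form_lin_left:
  assumes [bm_intros]: "bounded_measurable \<mu>2 k" "bounded_measurable \<mu>2 k'" "bounded_measurable \<mu>2 l"
  shows "covariance_form d (\<lambda>z. c * k z + k' z) (c * u + u') l v =
    c * covariance_form d k u l v + covariance_form d k' u' l v"
proof -
  note [bm_intros] = bm_swap[OF assms(3)]
  have "integrable \<mu>2 (\<lambda>z. k z * l z)" "integrable \<mu>2 (\<lambda>z. k' z * l z)"
    "integrable \<mu>2 (\<lambda>z. k z * l (snd z, fst z))" "integrable \<mu>2 (\<lambda>z. k' z * l (snd z, fst z))"
    by (intro mu2.bm_integrable bm_intros)+
  then show ?thesis by (simp add: covariance_form_def distrib_right mult.assoc) (simp add: algebra_simps)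
qed

lemma covariance_form_lin_right:
  assumes [bm_intros]: "bounded_measurable \<mu>2 k" "bounded_measurable \<mu>2 l" "bounded_measurable \<mu>2 l'"
  shows "covariance_form d k u (\<lambda>z. c * l z + l' z) (c * v + v') =
    c * covariance_form d k u l v + covariance_form d k u l' v'"
proof -
  note [bm_intros] = bm_swap[OF assms(2)] bm_swap[OF assms(3)]
  have "integrable \<mu>2 (\<lambda>z. k z * l z)" "integrable \<mu>2 (\<lambda>z. k z * l' z)"
    "integrable \<mu>2 (\<lambda>z. k z * l (snd z, fst z))" "integrable \<mu>2 (\<lambda>z. k z * l' (snd z, fst z))"
    by (intro mu2.bm_integrable bm_intros)+
  then show ?thesis by (simp add: covariance_form_def distrib_left mult.left_commute[of "k _"])
qed

lemma covariance_form_product: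
  assumes [bm_intros]: "bounded_measurable \<mu> a1" "bounded_measurable \<mu> b1" "bounded_measurable \<mu> a2" "bounded_measurable \<mu> b2"
  shows "covariance_form d (\<lambda>z. a1 (fst z) * b1 (snd z)) u (\<lambda>z. a2 (fst z) * b2 (snd z)) v =
    d * (u * v) + (\<integral>x. a1 x * a2 x \<partial>\<mu>) * (\<integral>x. b1 x * b2 x \<partial>\<mu>) +
    d * ((\<integral>x. a1 x * b2 x \<partial>\<mu>) * (\<integral>x. b1 x * a2 x \<partial>\<mu>))"
proof -
  have *: "(\<integral>z. g (fst z) * h (snd z) * (g' (fst z) * h' (snd z)) \<partial>\<mu>2) = (\<integral>x. g x * g' x \<partial>\<mu>) * (\<integral>x. h x * h' x \<partial>\<mu>)"
    if [bm_intros]: "bounded_measurable \<mu> g" "bounded_measurable \<mu> h" "bounded_measurable \<mu> g'" "bounded_measurable \<mu> h'" for g h g' h'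
    using bm_pair_integral_mult[of \<mu> \<mu> "\<lambda>x. g x * g' x" "\<lambda>x. h x * h' x"]
    by (simp add: bm_intros mu.finite_measure_axioms mult_ac)
  show ?thesis
    unfolding covariance_form_def using *[of a1 b1 a2 b2] *[of a1 b1 b2 a2] assms by (simp add: mult_ac)
qed

text \<open>Both sides are bilinear, so induction on each expression reduces the claim to single
  products: Isserlis' formula if the indices agree, independence if not.\<close>

lemma simple_bilinear_covariance:
  assumes i: "i1 \<in> {1..m}" "i2 \<in> {1..m}"
    and Q1: "bilinear (simple_int i1) (simple_int i2) k1 u1 Q1"
    and Q2: "bilinear (simple_int i1) (simple_int i2) k2 u2 Q2"
  shows "integrable M (\<lambda>\<omega>. Q1 \<omega> * Q2 \<omega>) \<and>
    expectation (\<lambda>\<omega>. Q1 \<omega> * Q2 \<omega>) = covariance_form (if i1 = i2 then 1 else 0) k1 u1 k2 u2"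
proof -
  let ?d = "if i1 = i2 then 1 else 0 :: real"
  note bm = bilinear_bm[OF _ simple_int_bm simple_int_bm]
  have base: "integrable M (\<lambda>\<omega>. X1 \<omega> * Y1 \<omega> * (X2 \<omega> * Y2 \<omega>)) \<and>
      expectation (\<lambda>\<omega>. X1 \<omega> * Y1 \<omega> * (X2 \<omega> * Y2 \<omega>)) =
      covariance_form ?d (\<lambda>z. a1 (fst z) * b1 (snd z)) (\<integral>x. a1 x * b1 x \<partial>\<mu>) (\<lambda>z. a2 (fst z) * b2 (snd z)) (\<integral>x. a2 x * b2 x \<partial>\<mu>)"
    if S: "simple_int i1 a1 X1" "simple_int i2 b1 Y1" "simple_int i1 a2 X2" "simple_int i2 b2 Y2" for a1 b1 a2 b2 X1 Y1 X2 Y2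
  proof (cases "i1 = i2")
    case True
    have "(\<lambda>\<omega>. X1 \<omega> * Y1 \<omega> * (X2 \<omega> * Y2 \<omega>)) = (\<lambda>\<omega>. X1 \<omega> * Y1 \<omega> * X2 \<omega> * Y2 \<omega>)" by (simp add: mult_ac)
    then show ?thesis
      using simple_int_isserlis[OF i(2) S[unfolded True]] True S[THEN simple_int_bm]
      by (simp add: covariance_form_product)
  next
    case False
    have "(\<lambda>\<omega>. X1 \<omega> * Y1 \<omega> * (X2 \<omega> * Y2 \<omega>)) = (\<lambda>\<omega>. X1 \<omega> * X2 \<omega> * (Y1 \<omega> * Y2 \<omega>))" by (simp add: mult_ac)
    then show ?thesis
      using simple_int_indep[OF i False S(1,3,2,4)] False S[THEN simple_int_bm]
      by (simp add: covariance_form_product)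
  qed
  have inner: "integrable M (\<lambda>\<omega>. X1 \<omega> * Y1 \<omega> * Q2 \<omega>) \<and>
      expectation (\<lambda>\<omega>. X1 \<omega> * Y1 \<omega> * Q2 \<omega>) = covariance_form ?d (\<lambda>z. a1 (fst z) * b1 (snd z)) (\<integral>x. a1 x * b1 x \<partial>\<mu>) k2 u2"
    if S: "simple_int i1 a1 X1" "simple_int i2 b1 Y1" for a1 b1 X1 Y1
    using Q2
  proof (induction rule: bilinear.induct)
    case zero
    then show ?case by (simp add: covariance_form_def)
  next
    case (base a X b Y)
    then show ?case using S by (intro \<open>\<And>a1 b1 a2 b2 X1 Y1 X2 Y2. \<lbrakk>_; _; _; _\<rbrakk> \<Longrightarrow> _\<close>)
  next
    case (lin k u X l v Y c)
    have "bounded_measurable \<mu>2 (\<lambda>z. a1 (fst z) * b1 (snd z))"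
      using S[THEN simple_int_bm] by (auto intro: bm_intros)
    then show ?case
      using lin.IH bm[OF lin.hyps(1)] bm[OF lin.hyps(2)]
      by (simp add: covariance_form_lin_right distrib_left mult.left_commute[of "_ * _"])
  qed
  show ?thesis
    using Q1
  proof (induction rule: bilinear.induct)
    case zero
    then show ?case by (simp add: covariance_form_def)
  next
    case (base a X b Y)
    then show ?case by (intro inner)
  next
    case (lin k u X l v Y c)
    then show ?case
      using bm[OF lin.hyps(1)] bm[OF lin.hyps(2)] bm[OF Q2]
      by (simp add: covariance_form_lin_left distrib_right mult.assoc)
  qed
qed

end

section \<open>Mean squares\<close>

text \<open>Lower semicontinuity of the mean square. Bounds survive almost sure limits even where
  mean-square convergence is not known.\<close>

lemma mean_square_fatou:
  assumes [measurable]: "\<And>n. X n \<in> borel_measurable M" and lim: "AE \<omega> in M. (\<lambda>n. X n \<omega>) \<longlonglongrightarrow> Y \<omega>"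
    and le: "eventually (\<lambda>n. mean_square M (X n) \<le> ennreal (b n)) sequentially" and b: "b \<longlonglongrightarrow> \<beta>"
  shows "mean_square M Y \<le> ennreal \<beta>"
proof -
  have "AE \<omega> in M. ennreal ((Y \<omega>)\<^sup>2) = liminf (\<lambda>n. ennreal ((X n \<omega>)\<^sup>2))"
    using lim
  proof eventually_elim
    case (elim \<omega>)
    then have "(\<lambda>n. ennreal ((X n \<omega>)\<^sup>2)) \<longlonglongrightarrow> ennreal ((Y \<omega>)\<^sup>2)" by (intro tendsto_intros)
    then show ?case by (intro lim_imp_Liminf[symmetric]) auto
  qed
  then have "mean_square M Y = (\<integral>\<^sup>+\<omega>. liminf (\<lambda>n. ennreal ((X n \<omega>)\<^sup>2)) \<partial>M)"
    unfolding mean_square_def by (rule nn_integral_cong_AE)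
  also have "\<dots> \<le> liminf (\<lambda>n. mean_square M (X n))"
    unfolding mean_square_def by (rule nn_integral_liminf) simp
  also have "\<dots> \<le> liminf (\<lambda>n. ennreal (b n))"
    using le by (rule Liminf_mono)
  also have "\<dots> = ennreal \<beta>"
    using b by (intro lim_imp_Liminf tendsto_intros) auto
  finally show ?thesis .
qed

lemma mean_square_eq_expectation:
  assumes "X \<in> borel_measurable M" "integrable M (\<lambda>\<omega>. (X \<omega>)\<^sup>2)"
  shows "mean_square M X = ennreal (\<integral>\<omega>. (X \<omega>)\<^sup>2 \<partial>M)"
  unfolding mean_square_def using assms by (intro nn_integral_eq_integral) auto

context wiener_interval
begin

lemma simple_int_zero: "simple_int i (\<lambda>x. 0) (\<lambda>\<omega>. 0)"
  unfolding simple_int_def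
  by (auto intro!: bm_intros exI[of _ "{}"] simp: step_sum_def[abs_def] wiener_sum_def[abs_def])

lemma simple_int_measurable: "i \<in> {0..m} \<Longrightarrow> simple_int i a X \<Longrightarrow> X \<in> borel_measurable M"
proof (cases "i = 0")
  case False
  then show "i \<in> {0..m} \<Longrightarrow> simple_int i a X \<Longrightarrow> X \<in> borel_measurable M"
    using simple_int_moments[of i a X] by (simp add: gauss_moments_def)
qed (auto simp: simple_int_def)

lemma bilinear_simple_bm:
  "bilinear (simple_int i1) (simple_int i2) k u X \<Longrightarrow> bounded_measurable \<mu>2 k"
  by (erule bilinear_bm) (auto intro: simple_int_bm)

lemma bilinear_measurable:
  assumes "bilinear A B k u X" "\<And>a X. A a X \<Longrightarrow> X \<in> borel_measurable M" "\<And>b Y. B b Y \<Longrightarrow> Y \<in> borel_measurable M"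
  shows "X \<in> borel_measurable M"
  using assms(1)
proof (induction rule: bilinear.induct)
  case (base a X b Y)
  then show ?case using assms(2)[of a X] assms(3)[of b Y] by (intro borel_measurable_times)
qed auto

lemma bm_section:
  assumes k: "bounded_measurable \<mu>2 k" and y: "y \<in> {t..T}"
  shows "bounded_measurable \<mu> (\<lambda>x. k (x, y))"
proof -
  have "(\<lambda>x. k (x, y)) \<in> borel_measurable \<mu>"
    using bm_measurable[OF k] y by (intro measurable_compose[OF measurable_Pair2' bm_measurable[OF k]]) (simp add: space_mu)
  moreover obtain c where "\<forall>z\<in>space \<mu>2. \<bar>k z\<bar> \<le> c"
    using k by (auto simp: bounded_measurable_def)
  ultimately show ?thesis
    using y by (intro bounded_measurableI[of _ _ c]) (auto simp: space_mu space_pair_measure)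
qed

text \<open>If the first family consists of time integrals, its factors are numbers. The whole
  expression is then a single integral, whose integrand is the kernel with the first variable
  integrated out.\<close>

lemma bilinear_time_left:
  assumes "bilinear (simple_int 0) (simple_int j) k u X"
  shows "\<exists>b. simple_int j b X \<and> (\<forall>y\<in>{t..T}. b y = (\<integral>x. k (x, y) \<partial>\<mu>))"
  using assms
proof (induction rule: bilinear.induct)
  case zero
  then show ?case using simple_int_zero by auto
next
  case (base a X b Y)
  have "simple_int j (\<lambda>y. (\<integral>x. a x \<partial>\<mu>) * b y) (\<lambda>\<omega>. X \<omega> * Y \<omega>)"
    using simple_int_lin[OF base(2) base(2), of "\<integral>x. a x \<partial>\<mu>" 0] base(1) by (simp add: simple_int_def)
  then show ?case by (intro exI[of _ "\<lambda>y. (\<integral>x. a x \<partial>\<mu>) * b y"]) simp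
next
  case (lin k u X l v Y c)
  note bm = bilinear_simple_bm[OF lin.hyps(1)] bilinear_simple_bm[OF lin.hyps(2)]
  from lin.IH obtain b d where b: "simple_int j b X" "\<And>y. y \<in> {t..T} \<Longrightarrow> b y = (\<integral>x. k (x, y) \<partial>\<mu>)"
    and d: "simple_int j d Y" "\<And>y. y \<in> {t..T} \<Longrightarrow> d y = (\<integral>x. l (x, y) \<partial>\<mu>)" by auto
  have "simple_int j (\<lambda>y. c * b y + d y) (\<lambda>\<omega>. c * X \<omega> + Y \<omega>)"
    using simple_int_lin[OF b(1) d(1), of c 1] by simp
  moreover have "c * b y + d y = (\<integral>x. c * k (x, y) + l (x, y) \<partial>\<mu>)" if "y \<in> {t..T}" for y
    using that b d mu.bm_integrable[OF bm_section[OF bm(1) that]] mu.bm_integrable[OF bm_section[OF bm(2) that]] by simp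
  ultimately show ?case by (intro exI[of _ "\<lambda>y. c * b y + d y"]) simp
qed

text \<open>Large enough for each case: 2 for two Wiener processes, \<open>T - t\<close> for one
  time component, and its square for two.\<close>

definition ms_const :: real where
  "ms_const = 2 + (T - t) + (T - t)\<^sup>2"

lemma ms_const_ge_2: "ms_const \<ge> 2"
  unfolding ms_const_def using t_less_T zero_le_power2[of "T - t"] by linarith

lemma ms_const_pos: "ms_const > 0"
  using ms_const_ge_2 by linarith

text \<open>Cauchy-Schwarz against the constant 1, applied to each section of the kernel, costs a
  factor \<open>T - t\<close>; if the outer component is time as well, it is applied a second
  time.\<close>

lemma simple_bilinear_bound_time_left:
  assumes j: "j \<in> {0..m}" and Q: "bilinear (simple_int 0) (simple_int j) k u X"
  shows "mean_square M X \<le> ennreal (ms_const * (u\<^sup>2 + (\<integral>z. (k z)\<^sup>2 \<partial>\<mu>2)))"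
proof -
  from bilinear_time_left[OF Q] obtain b where b: "simple_int j b X" "\<And>y. y \<in> {t..T} \<Longrightarrow> b y = (\<integral>x. k (x, y) \<partial>\<mu>)"
    by blast
  note bk = bilinear_simple_bm[OF Q]
  note bb = simple_int_bm[OF b(1)]
  have one: "(\<integral>x. g x \<partial>\<mu>)\<^sup>2 \<le> (T - t) * (\<integral>x. (g x)\<^sup>2 \<partial>\<mu>)" if "bounded_measurable \<mu> g" for g
    using mu.integral_product_square_le[OF that bm_const[of _ 1]] by (simp add: space_mu measure_mu mult.commute)
  have bk2: "bounded_measurable \<mu>2 (\<lambda>z. (k z)\<^sup>2)" by (intro bm_intros bk)
  have snd: "(\<integral>y. (\<integral>x. (k (x, y))\<^sup>2 \<partial>\<mu>) \<partial>\<mu>) = (\<integral>z. (k z)\<^sup>2 \<partial>\<mu>2)"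
    using mu_pair.integral_snd[of "\<lambda>x y. (k (x, y))\<^sup>2"] mu2.bm_integrable[OF bk2]
    by (simp add: case_prod_unfold)
  have bk2': "bounded_measurable \<mu> (\<lambda>y. \<integral>x. (k (x, y))\<^sup>2 \<partial>\<mu>)"
    using mu.bm_lebesgue_integral[OF bm_swap[OF bk2]] by simp
  have "(\<integral>y. (b y)\<^sup>2 \<partial>\<mu>) \<le> (\<integral>y. (T - t) * (\<integral>x. (k (x, y))\<^sup>2 \<partial>\<mu>) \<partial>\<mu>)"
  proof (intro integral_mono mu.bm_integrable)
    show "bounded_measurable \<mu> (\<lambda>y. (b y)\<^sup>2)" by (intro bm_intros bb)
    show "bounded_measurable \<mu> (\<lambda>y. (T - t) * (\<integral>x. (k (x, y))\<^sup>2 \<partial>\<mu>))" by (intro bm_intros bk2')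
    fix y assume "y \<in> space \<mu>"
    then have "y \<in> {t..T}" by (simp add: space_mu)
    then show "(b y)\<^sup>2 \<le> (T - t) * (\<integral>x. (k (x, y))\<^sup>2 \<partial>\<mu>)"
      using one[OF bm_section[OF bk]] b(2) by simp
  qed
  also have "\<dots> = (T - t) * (\<integral>z. (k z)\<^sup>2 \<partial>\<mu>2)" by (simp add: snd)
  finally have le: "(\<integral>y. (b y)\<^sup>2 \<partial>\<mu>) \<le> (T - t) * (\<integral>z. (k z)\<^sup>2 \<partial>\<mu>2)" .
  let ?K = "\<integral>z. (k z)\<^sup>2 \<partial>\<mu>2"
  have K0: "?K \<ge> 0" by simp
  show ?thesis
  proof (cases "j = 0")
    case True
    then have X: "X = (\<lambda>\<omega>. \<integral>x. b x \<partial>\<mu>)" using b(1) by (simp add: simple_int_def)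
    have "(\<integral>x. b x \<partial>\<mu>)\<^sup>2 \<le> (T - t) * (\<integral>y. (b y)\<^sup>2 \<partial>\<mu>)" by (rule one[OF bb])
    also have "\<dots> \<le> (T - t) * ((T - t) * ?K)"
      using le t_less_T by (intro mult_left_mono) auto
    also have "\<dots> = (T - t)\<^sup>2 * ?K" by (simp add: power2_eq_square)
    also have "\<dots> \<le> ms_const * (u\<^sup>2 + ?K)"
      using t_less_T K0 by (intro mult_mono) (auto simp: ms_const_def)
    finally show ?thesis
      unfolding X mean_square_def by (simp add: emeasure_space_1 ennreal_leI)
  next
    case False
    then have "gauss_moments X (\<integral>y. (b y)\<^sup>2 \<partial>\<mu>)" using j b(1) by (intro simple_int_moments[of j]) auto
    then have "mean_square M X = ennreal (\<integral>y. (b y)\<^sup>2 \<partial>\<mu>)"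
      by (subst mean_square_eq_expectation) (auto simp: gauss_moments_def intro: integrable_power_le_4)
    also have "(\<integral>y. (b y)\<^sup>2 \<partial>\<mu>) \<le> ms_const * (u\<^sup>2 + ?K)"
      using t_less_T K0 by (intro order_trans[OF le] mult_mono) (auto simp: ms_const_def)
    finally show ?thesis by (simp add: ennreal_leI)
  qed
qed

text \<open>For two Wiener processes the crosswise pairing is at most the squared norm of the
  kernel, because transposition preserves that norm.\<close>

lemma simple_bilinear_bound:
  assumes i: "i1 \<in> {0..m}" "i2 \<in> {0..m}" and Q: "bilinear (simple_int i1) (simple_int i2) k u X"
  shows "mean_square M X \<le> ennreal (ms_const * (u\<^sup>2 + (\<integral>z. (k z)\<^sup>2 \<partial>\<mu>2)))"
proof -
  note bk = bilinear_simple_bm[OF Q]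
  have sw: "(\<integral>z. (k (snd z, fst z))\<^sup>2 \<partial>\<mu>2) = (\<integral>z. (k z)\<^sup>2 \<partial>\<mu>2)"
    using integral_swap[of "\<lambda>z. (k z)\<^sup>2"] bk by (auto intro: bm_intros)
  consider "i1 = 0" | "i2 = 0" | "i1 \<in> {1..m}" "i2 \<in> {1..m}" using i by force
  then show ?thesis
  proof cases
    case 1
    then show ?thesis using simple_bilinear_bound_time_left i Q by blast
  next
    case 2
    then show ?thesis
      using simple_bilinear_bound_time_left[OF i(1) bilinear_swap[OF Q, unfolded 2]] by (simp add: sw)
  next
    case 3
    let ?d = "if i1 = i2 then 1 else 0 :: real" and ?K = "\<integral>z. (k z)\<^sup>2 \<partial>\<mu>2"
    note cov = simple_bilinear_covariance[OF 3 Q Q]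
    note bs = bm_swap[OF bk]
    have X: "X \<in> borel_measurable M"
      using bilinear_measurable[OF Q] simple_int_measurable i by blast
    have "mean_square M X = ennreal (covariance_form ?d k u k u)"
      using mean_square_eq_expectation[OF X] cov by (simp add: power2_eq_square)
    also have "covariance_form ?d k u k u \<le> u\<^sup>2 + 2 * ?K"
    proof -
      have "(\<integral>z. k z * k (snd z, fst z) \<partial>\<mu>2) \<le> (\<integral>z. ((k z)\<^sup>2 + (k (snd z, fst z))\<^sup>2) / 2 \<partial>\<mu>2)"
      proof (intro integral_mono)
        show "integrable \<mu>2 (\<lambda>z. k z * k (snd z, fst z))"
          by (intro mu2.bm_integrable bm_intros bk bs)
        show "integrable \<mu>2 (\<lambda>z. ((k z)\<^sup>2 + (k (snd z, fst z))\<^sup>2) / 2)"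
          by (intro integrable_divide_zero mu2.bm_integrable bm_intros bk bs)
        fix z show "k z * k (snd z, fst z) \<le> ((k z)\<^sup>2 + (k (snd z, fst z))\<^sup>2) / 2"
          using sum_squares_bound[of "k z" "k (snd z, fst z)"] by simp
      qed
      also have "\<dots> = ?K"
      proof -
        have "integrable \<mu>2 (\<lambda>z. (k z)\<^sup>2)" "integrable \<mu>2 (\<lambda>z. (k (snd z, fst z))\<^sup>2)"
          by (intro mu2.bm_integrable bm_intros bk bs)+
        then show ?thesis by (simp add: sw)
      qed
      finally have "(\<integral>z. k z * k (snd z, fst z) \<partial>\<mu>2) \<le> ?K" .
      moreover have "?K \<ge> 0" by simp
      ultimately show ?thesis by (simp add: covariance_form_def power2_eq_square)
    qed
    also have "\<dots> \<le> ms_const * (u\<^sup>2 + ?K)"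
    proof -
      have "2 * (u\<^sup>2 + ?K) \<le> ms_const * (u\<^sup>2 + ?K)"
        using ms_const_ge_2 by (intro mult_right_mono) auto
      then show ?thesis by (rule order_trans[rotated]) simp
    qed
    finally show ?thesis by (simp add: ennreal_leI)
  qed
qed

text \<open>The integrands converge in L2 but the integrals almost surely: almost sure limits may be
  multiplied, which is what bilinear expressions need.\<close>

definition lim_int :: "nat \<Rightarrow> (real \<Rightarrow> real) \<Rightarrow> ('a \<Rightarrow> real) \<Rightarrow> bool" where
  "lim_int i a X \<longleftrightarrow> bounded_measurable \<mu> a \<and> X \<in> borel_measurable M \<and>
     (\<exists>s S. (\<forall>n. simple_int i (s n) (S n)) \<and> (\<lambda>n. \<integral>x. (a x - s n x)\<^sup>2 \<partial>\<mu>) \<longlonglongrightarrow> 0 \<and>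
       (AE \<omega> in M. (\<lambda>n. S n \<omega>) \<longlonglongrightarrow> X \<omega>))"

lemma lim_int_bm: "lim_int i a X \<Longrightarrow> bounded_measurable \<mu> a"
  by (simp add: lim_int_def)

lemma bilinear_lim_bm:
  "bilinear (lim_int i1) (lim_int i2) k u X \<Longrightarrow> bounded_measurable \<mu>2 k"
  by (erule bilinear_bm) (auto intro: lim_int_bm)

lemma lim_int_measurable: "lim_int i a X \<Longrightarrow> X \<in> borel_measurable M"
  by (simp add: lim_int_def)

lemma simple_int_imp_lim_int:
  assumes "i \<in> {0..m}" "simple_int i a X"
  shows "lim_int i a X"
  unfolding lim_int_def
  using simple_int_bm[OF assms(2)] simple_int_measurable[OF assms] assms(2)
  by (auto intro!: exI[of _ "\<lambda>_. a"] exI[of _ "\<lambda>_. X"])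

lemma lim_int_product_approx:
  assumes a: "bounded_measurable \<mu> a" and b: "bounded_measurable \<mu> b"
    and s: "\<And>n. bounded_measurable \<mu> (s n)" and r: "\<And>n. bounded_measurable \<mu> (r n)"
    and as: "(\<lambda>n. \<integral>x. (a x - s n x)\<^sup>2 \<partial>\<mu>) \<longlonglongrightarrow> 0" and br: "(\<lambda>n. \<integral>x. (b x - r n x)\<^sup>2 \<partial>\<mu>) \<longlonglongrightarrow> 0"
  shows "(\<lambda>n. \<integral>z. (a (fst z) * b (snd z) - s n (fst z) * r n (snd z))\<^sup>2 \<partial>\<mu>2) \<longlonglongrightarrow> 0"
    and "(\<lambda>n. \<integral>x. s n x * r n x \<partial>\<mu>) \<longlonglongrightarrow> (\<integral>x. a x * b x \<partial>\<mu>)"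
proof -
  note [bm_intros] = a b s r
  define d where "d n = (\<integral>x. (a x - s n x)\<^sup>2 \<partial>\<mu>)" for n
  define e where "e n = (\<integral>x. (b x - r n x)\<^sup>2 \<partial>\<mu>)" for n
  \<comment> \<open>From \<open>a b - s r = (a - s) b + s (b - r)\<close>, with the norm of
    \<open>s n\<close> bounded through that of \<open>a\<close>. The same bound serves for the
    kernel and, after Cauchy-Schwarz, for the trace.\<close>
  define \<beta> where "\<beta> n = 2 * (d n * (\<integral>x. (b x)\<^sup>2 \<partial>\<mu>)) + 2 * ((2 * (\<integral>x. (a x)\<^sup>2 \<partial>\<mu>) + 2 * d n) * e n)" for n
  have "\<beta> \<longlonglongrightarrow> 2 * (0 * (\<integral>x. (b x)\<^sup>2 \<partial>\<mu>)) + 2 * ((2 * (\<integral>x. (a x)\<^sup>2 \<partial>\<mu>) + 2 * 0) * 0)"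
    unfolding \<beta>_def d_def e_def by (intro tendsto_intros as br)
  then have \<beta>0: "\<beta> \<longlonglongrightarrow> 0" by simp
  have e0: "e n \<ge> 0" for n by (simp add: e_def)
  have sn: "(\<integral>x. (s n x)\<^sup>2 \<partial>\<mu>) \<le> 2 * (\<integral>x. (a x)\<^sup>2 \<partial>\<mu>) + 2 * d n" for n
  proof -
    have "(\<integral>x. (a x + (s n x - a x))\<^sup>2 \<partial>\<mu>) \<le> 2 * (\<integral>x. (a x)\<^sup>2 \<partial>\<mu>) + 2 * (\<integral>x. (s n x - a x)\<^sup>2 \<partial>\<mu>)"
      by (intro mu.integral_square_add_le bm_intros)
    then show ?thesis by (simp add: d_def power2_commute)
  qed
  have pm: "(\<integral>z. (g (fst z) * h (snd z))\<^sup>2 \<partial>\<mu>2) = (\<integral>x. (g x)\<^sup>2 \<partial>\<mu>) * (\<integral>x. (h x)\<^sup>2 \<partial>\<mu>)"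
    if "bounded_measurable \<mu> g" "bounded_measurable \<mu> h" for g h
    unfolding power_mult_distrib
    by (rule bm_pair_integral_mult) (auto intro!: bm_intros that mu.finite_measure_axioms)
  have "(\<integral>z. (a (fst z) * b (snd z) - s n (fst z) * r n (snd z))\<^sup>2 \<partial>\<mu>2) \<le> \<beta> n" for n
  proof -
    have "(\<integral>z. (a (fst z) * b (snd z) - s n (fst z) * r n (snd z))\<^sup>2 \<partial>\<mu>2) =
        (\<integral>z. ((a (fst z) - s n (fst z)) * b (snd z) + s n (fst z) * (b (snd z) - r n (snd z)))\<^sup>2 \<partial>\<mu>2)"
      by (simp add: algebra_simps)
    also have "\<dots> \<le> 2 * (\<integral>z. ((a (fst z) - s n (fst z)) * b (snd z))\<^sup>2 \<partial>\<mu>2) +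
        2 * (\<integral>z. (s n (fst z) * (b (snd z) - r n (snd z)))\<^sup>2 \<partial>\<mu>2)"
      by (intro mu2.integral_square_add_le bm_intros)
    also have "(\<integral>z. ((a (fst z) - s n (fst z)) * b (snd z))\<^sup>2 \<partial>\<mu>2) = d n * (\<integral>x. (b x)\<^sup>2 \<partial>\<mu>)"
      unfolding d_def by (rule pm) (intro bm_intros)+
    also have "(\<integral>z. (s n (fst z) * (b (snd z) - r n (snd z)))\<^sup>2 \<partial>\<mu>2) = (\<integral>x. (s n x)\<^sup>2 \<partial>\<mu>) * e n"
      unfolding e_def by (rule pm) (intro bm_intros)+
    finally show ?thesis
      unfolding \<beta>_def using mult_right_mono[OF sn[of n] e0[of n]] by linarith
  qed
  then show "(\<lambda>n. \<integral>z. (a (fst z) * b (snd z) - s n (fst z) * r n (snd z))\<^sup>2 \<partial>\<mu>2) \<longlonglongrightarrow> 0"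
    by (intro tendsto_sandwich[OF _ _ tendsto_const \<beta>0]) auto
  have "((\<integral>x. a x * b x \<partial>\<mu>) - (\<integral>x. s n x * r n x \<partial>\<mu>))\<^sup>2 \<le> \<beta> n" for n
  proof -
    have i: "integrable \<mu> (\<lambda>x. a x * b x)" "integrable \<mu> (\<lambda>x. s n x * r n x)" "integrable \<mu> (\<lambda>x. s n x * b x)"
      by (intro mu.bm_integrable bm_intros)+
    let ?p = "\<integral>x. (a x - s n x) * b x \<partial>\<mu>" and ?q = "\<integral>x. s n x * (b x - r n x) \<partial>\<mu>"
    have "(\<integral>x. a x * b x \<partial>\<mu>) - (\<integral>x. s n x * r n x \<partial>\<mu>) = ?p + ?q"
      using i by (simp add: left_diff_distrib right_diff_distrib)
    then have "((\<integral>x. a x * b x \<partial>\<mu>) - (\<integral>x. s n x * r n x \<partial>\<mu>))\<^sup>2 \<le> 2 * ?p\<^sup>2 + 2 * ?q\<^sup>2"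
      using sum_squares_bound[of ?p ?q] by (simp add: power2_sum)
    moreover have "?p\<^sup>2 \<le> d n * (\<integral>x. (b x)\<^sup>2 \<partial>\<mu>)"
      unfolding d_def by (intro mu.integral_product_square_le bm_intros)
    moreover have "?q\<^sup>2 \<le> (\<integral>x. (s n x)\<^sup>2 \<partial>\<mu>) * e n"
      unfolding e_def by (intro mu.integral_product_square_le bm_intros)
    ultimately show ?thesis
      unfolding \<beta>_def using mult_right_mono[OF sn[of n] e0[of n]] by linarith
  qed
  then have "(\<lambda>n. ((\<integral>x. a x * b x \<partial>\<mu>) - (\<integral>x. s n x * r n x \<partial>\<mu>))\<^sup>2) \<longlonglongrightarrow> 0"
    by (intro tendsto_sandwich[OF _ _ tendsto_const \<beta>0]) auto
  then have "(\<lambda>n. (\<integral>x. a x * b x \<partial>\<mu>) - (\<integral>x. s n x * r n x \<partial>\<mu>)) \<longlonglongrightarrow> 0" by simp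
  from tendsto_diff[OF tendsto_const[of "\<integral>x. a x * b x \<partial>\<mu>"] this]
  show "(\<lambda>n. \<integral>x. s n x * r n x \<partial>\<mu>) \<longlonglongrightarrow> (\<integral>x. a x * b x \<partial>\<mu>)" by simp
qed

text \<open>The approximation is built along the structure of the expression, so kernel, trace and
  random variable converge together.\<close>

lemma lim_bilinear_approx:
  assumes "bilinear (lim_int i1) (lim_int i2) k u X"
  shows "\<exists>l v Z. (\<forall>n. bilinear (simple_int i1) (simple_int i2) (l n) (v n) (Z n)) \<and>
    (\<lambda>n. \<integral>z. (k z - l n z)\<^sup>2 \<partial>\<mu>2) \<longlonglongrightarrow> 0 \<and> v \<longlonglongrightarrow> u \<and> (AE \<omega> in M. (\<lambda>n. Z n \<omega>) \<longlonglongrightarrow> X \<omega>)"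
  using assms
proof (induction rule: bilinear.induct)
  case zero
  show ?case
    by (intro exI[of _ "\<lambda>n z. 0"] exI[of _ "\<lambda>n. 0"] exI[of _ "\<lambda>n \<omega>. 0"]) (simp add: bilinear.zero)
next
  case (base a X b Y)
  from base(1) obtain s S where a: "bounded_measurable \<mu> a" and S: "\<And>n. simple_int i1 (s n) (S n)"
    "(\<lambda>n. \<integral>x. (a x - s n x)\<^sup>2 \<partial>\<mu>) \<longlonglongrightarrow> 0" "AE \<omega> in M. (\<lambda>n. S n \<omega>) \<longlonglongrightarrow> X \<omega>"
    unfolding lim_int_def by blast
  from base(2) obtain r R where b: "bounded_measurable \<mu> b" and R: "\<And>n. simple_int i2 (r n) (R n)"
    "(\<lambda>n. \<integral>x. (b x - r n x)\<^sup>2 \<partial>\<mu>) \<longlonglongrightarrow> 0" "AE \<omega> in M. (\<lambda>n. R n \<omega>) \<longlonglongrightarrow> Y \<omega>"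
    unfolding lim_int_def by blast
  note ap = lim_int_product_approx[OF a b simple_int_bm[OF S(1)] simple_int_bm[OF R(1)] S(2) R(2)]
  show ?case
    by (intro exI[of _ "\<lambda>n z. s n (fst z) * r n (snd z)"] exI[of _ "\<lambda>n. \<integral>x. s n x * r n x \<partial>\<mu>"]
        exI[of _ "\<lambda>n \<omega>. S n \<omega> * R n \<omega>"] conjI allI bilinear.base S R ap)
       (use S(3) R(3) in \<open>eventually_elim, intro tendsto_intros\<close>)
next
  case (lin k u X k' u' X' c)
  from lin.IH obtain l v Z l' v' Z' where
    1: "\<And>n. bilinear (simple_int i1) (simple_int i2) (l n) (v n) (Z n)"
    "(\<lambda>n. \<integral>z. (k z - l n z)\<^sup>2 \<partial>\<mu>2) \<longlonglongrightarrow> 0" "v \<longlonglongrightarrow> u" "AE \<omega> in M. (\<lambda>n. Z n \<omega>) \<longlonglongrightarrow> X \<omega>" and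
    2: "\<And>n. bilinear (simple_int i1) (simple_int i2) (l' n) (v' n) (Z' n)"
    "(\<lambda>n. \<integral>z. (k' z - l' n z)\<^sup>2 \<partial>\<mu>2) \<longlonglongrightarrow> 0" "v' \<longlonglongrightarrow> u'" "AE \<omega> in M. (\<lambda>n. Z' n \<omega>) \<longlonglongrightarrow> X' \<omega>"
    by blast
  note [bm_intros] = bilinear_simple_bm[OF 1(1)] bilinear_simple_bm[OF 2(1)]
    bilinear_lim_bm[OF lin.hyps(1)] bilinear_lim_bm[OF lin.hyps(2)]
  show ?case
  proof (intro exI[of _ "\<lambda>n z. c * l n z + l' n z"] exI[of _ "\<lambda>n. c * v n + v' n"]
      exI[of _ "\<lambda>n \<omega>. c * Z n \<omega> + Z' n \<omega>"] conjI allI bilinear.lin 1 2 tendsto_intros)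
    show "AE \<omega> in M. (\<lambda>n. c * Z n \<omega> + Z' n \<omega>) \<longlonglongrightarrow> c * X \<omega> + X' \<omega>"
      using 1(4) 2(4) by eventually_elim (intro tendsto_intros)
    let ?b = "\<lambda>n. 2 * (c\<^sup>2 * (\<integral>z. (k z - l n z)\<^sup>2 \<partial>\<mu>2)) + 2 * (\<integral>z. (k' z - l' n z)\<^sup>2 \<partial>\<mu>2)"
    have "?b \<longlonglongrightarrow> 2 * (c\<^sup>2 * 0) + 2 * 0" by (intro tendsto_intros 1 2)
    then have b0: "?b \<longlonglongrightarrow> 0" by simp
    have "(\<integral>z. (c * k z + k' z - (c * l n z + l' n z))\<^sup>2 \<partial>\<mu>2) \<le> ?b n" for n
    proof -
      have "(\<integral>z. (c * k z + k' z - (c * l n z + l' n z))\<^sup>2 \<partial>\<mu>2) =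
          (\<integral>z. (c * (k z - l n z) + (k' z - l' n z))\<^sup>2 \<partial>\<mu>2)"
        by (simp add: algebra_simps)
      also have "\<dots> \<le> 2 * (\<integral>z. (c * (k z - l n z))\<^sup>2 \<partial>\<mu>2) + 2 * (\<integral>z. (k' z - l' n z)\<^sup>2 \<partial>\<mu>2)"
        by (intro mu2.integral_square_add_le bm_intros)
      finally show ?thesis by (simp add: power_mult_distrib)
    qed
    then show "(\<lambda>n. \<integral>z. (c * k z + k' z - (c * l n z + l' n z))\<^sup>2 \<partial>\<mu>2) \<longlonglongrightarrow> 0"
      by (intro tendsto_sandwich[OF _ _ tendsto_const b0]) auto
  qed
qed

text \<open>The factor 2 before the kernel norm comes from comparing the approximating kernels with
  \<open>k\<close> by the squared triangle inequality.\<close>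

lemma lim_bilinear_bound:
  assumes i: "i1 \<in> {0..m}" "i2 \<in> {0..m}" and Q: "bilinear (lim_int i1) (lim_int i2) k u X"
  shows "mean_square M X \<le> ennreal (ms_const * (u\<^sup>2 + 2 * (\<integral>z. (k z)\<^sup>2 \<partial>\<mu>2)))"
proof -
  from lim_bilinear_approx[OF Q] obtain l v Z where
    Z: "\<And>n. bilinear (simple_int i1) (simple_int i2) (l n) (v n) (Z n)"
    "(\<lambda>n. \<integral>z. (k z - l n z)\<^sup>2 \<partial>\<mu>2) \<longlonglongrightarrow> 0" "v \<longlonglongrightarrow> u" "AE \<omega> in M. (\<lambda>n. Z n \<omega>) \<longlonglongrightarrow> X \<omega>"
    by blast
  note [bm_intros] = bilinear_simple_bm[OF Z(1)] bilinear_lim_bm[OF Q]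
  let ?K = "\<integral>z. (k z)\<^sup>2 \<partial>\<mu>2" and ?D = "\<lambda>n. \<integral>z. (k z - l n z)\<^sup>2 \<partial>\<mu>2"
  have lim: "(\<lambda>n. ms_const * ((v n)\<^sup>2 + (2 * ?K + 2 * ?D n))) \<longlonglongrightarrow> ms_const * (u\<^sup>2 + (2 * ?K + 2 * 0))"
    by (intro tendsto_intros Z)
  have "mean_square M (Z n) \<le> ennreal (ms_const * ((v n)\<^sup>2 + (2 * ?K + 2 * ?D n)))" for n
  proof -
    have "(\<integral>z. (k z + (l n z - k z))\<^sup>2 \<partial>\<mu>2) \<le> 2 * ?K + 2 * (\<integral>z. (l n z - k z)\<^sup>2 \<partial>\<mu>2)"
      by (intro mu2.integral_square_add_le bm_intros)
    then have "(\<integral>z. (l n z)\<^sup>2 \<partial>\<mu>2) \<le> 2 * ?K + 2 * ?D n" by (simp add: power2_commute)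
    then have "ms_const * ((v n)\<^sup>2 + (\<integral>z. (l n z)\<^sup>2 \<partial>\<mu>2)) \<le> ms_const * ((v n)\<^sup>2 + (2 * ?K + 2 * ?D n))"
      using ms_const_pos by (intro mult_left_mono) auto
    then show ?thesis
      using simple_bilinear_bound[OF i Z(1)[of n]] by (meson ennreal_leI order_trans)
  qed
  then have "mean_square M X \<le> ennreal (ms_const * (u\<^sup>2 + (2 * ?K + 2 * 0)))"
    using bilinear_measurable[OF Z(1)] simple_int_measurable i
    by (intro mean_square_fatou[OF _ Z(4) _ lim]) auto
  then show ?thesis by simp
qed

end

section \<open>Stochastic integrals of smooth functions\<close>

lemma ms_tendsto_AE_subseq:
  assumes [measurable]: "\<And>n. X n \<in> borel_measurable M" and lim: "ms_tendsto M X Y sequentially"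
  shows "\<exists>r :: nat \<Rightarrow> nat. strict_mono r \<and> (AE \<omega> in M. (\<lambda>n. X (r n) \<omega>) \<longlonglongrightarrow> Y \<omega>)"
proof -
  have [measurable]: "Y \<in> borel_measurable M" and ms: "(\<lambda>n. mean_square M (\<lambda>\<omega>. X n \<omega> - Y \<omega>)) \<longlonglongrightarrow> 0"
    using lim by (auto simp: ms_tendsto_def)
  define e where "e n = mean_square M (\<lambda>\<omega>. X n \<omega> - Y \<omega>)" for n
  \<comment> \<open>Finitely many terms may have infinite mean square. They are masked so that every
    \<open>u n\<close> is integrable, and the mask disappears eventually.\<close>
  define u where "u n \<omega> = (if e n < \<infinity> then (X n \<omega> - Y \<omega>)\<^sup>2 else 0)" for n \<omega>
  have [measurable]: "u n \<in> borel_measurable M" for n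
    unfolding u_def[abs_def] by (cases "e n < \<infinity>") auto
  have int: "integrable M (u n)" for n
  proof (cases "e n < \<infinity>")
    case True
    then show ?thesis
      by (intro integrableI_nonneg) (auto simp: u_def e_def mean_square_def)
  qed (simp add: u_def[abs_def])
  have eq: "(\<integral>\<omega>. norm (u n \<omega>) \<partial>M) = enn2real (e n)" for n
  proof (cases "e n < \<infinity>")
    case True
    then have "(\<integral>\<omega>. norm (u n \<omega>) \<partial>M) = (\<integral>\<omega>. (X n \<omega> - Y \<omega>)\<^sup>2 \<partial>M)" by (simp add: u_def)
    also have "\<dots> = enn2real (e n)"
      unfolding e_def mean_square_def by (subst integral_eq_nn_integral) auto
    finally show ?thesis .
  next
    case False
    then have "e n = \<infinity>" by (auto simp: less_top[symmetric])
    then show ?thesis by (simp add: u_def)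
  qed
  have e0: "e \<longlonglongrightarrow> 0" using ms by (simp add: e_def[abs_def])
  have "(\<lambda>n. enn2real (e n)) \<longlonglongrightarrow> enn2real 0"
    using e0 by (intro tendsto_enn2real) auto
  then obtain r where r: "strict_mono r" "AE \<omega> in M. (\<lambda>n. u (r n) \<omega>) \<longlonglongrightarrow> 0"
    using tendsto_L1_AE_subseq[of M u, OF int] unfolding eq by auto
  have "eventually (\<lambda>n. e n < \<infinity>) sequentially"
    using e0 by (rule order_tendstoD) simp
  then have ev: "eventually (\<lambda>n. e (r n) < \<infinity>) sequentially"
    using r(1) by (rule eventually_subseq[rotated])
  have "AE \<omega> in M. (\<lambda>n. X (r n) \<omega>) \<longlonglongrightarrow> Y \<omega>"
    using r(2)
  proof eventually_elim
    case (elim \<omega>)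
    then have "(\<lambda>n. (X (r n) \<omega> - Y \<omega>)\<^sup>2) \<longlonglongrightarrow> 0"
      by (rule Lim_transform_eventually) (use ev in \<open>eventually_elim, simp add: u_def\<close>)
    then have "(\<lambda>n. X (r n) \<omega> - Y \<omega>) \<longlonglongrightarrow> 0" by simp
    then show ?case by (rule LIM_zero_cancel)
  qed
  with r(1) show ?thesis by blast
qed

lemma step_fun_error:
  assumes P: "partition_of a b N \<tau>" and "0 \<le> \<epsilon>"
    and close: "\<And>j. j < N \<Longrightarrow> x \<in> {\<tau> j..<\<tau> (Suc j)} \<Longrightarrow> \<bar>g x - c j\<bar> \<le> \<epsilon>"
  shows "\<bar>indicator {a..<b} x * g x - step_fun N \<tau> c x\<bar> \<le> \<epsilon>"
proof -
  have "indicator {a..<b} x * g x - step_fun N \<tau> c x = (\<Sum>j<N. indicator {\<tau> j..<\<tau> (Suc j)} x * (g x - c j))"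
    unfolding step_fun_def sum_indicator_partition[OF P, symmetric]
    by (simp only: sum_distrib_right right_diff_distrib sum_subtractf mult.commute[of "c _"])
  also have "\<bar>\<dots>\<bar> \<le> (\<Sum>j<N. \<bar>indicator {\<tau> j..<\<tau> (Suc j)} x * (g x - c j)\<bar>)" by (rule sum_abs)
  also have "\<dots> \<le> (\<Sum>j<N. indicator {\<tau> j..<\<tau> (Suc j)} x * \<epsilon>)"
    using close by (intro sum_mono) (auto split: split_indicator)
  also have "\<dots> = indicator {a..<b} x * \<epsilon>"
    by (simp only: sum_distrib_right[symmetric] sum_indicator_partition[OF P])
  also have "\<dots> \<le> \<epsilon>" using \<open>0 \<le> \<epsilon>\<close> by (auto split: split_indicator)
  finally show ?thesis .
qed

lemma step_fun_outside:
  assumes P: "partition_of a b N \<tau>" and "x \<notin> {a..<b}"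
  shows "step_fun N \<tau> c x = 0"
proof -
  have "indicator {\<tau> j..<\<tau> (Suc j)} x = (0::real)" if "j < N" for j
    using partition_of_bounds[OF P, of j] partition_of_bounds[OF P, of "Suc j"] that assms(2)
    by (auto split: split_indicator)
  then show ?thesis unfolding step_fun_def by (intro sum.neutral) auto
qed

lemma summation_by_parts:
  fixes g w :: "nat \<Rightarrow> real"
  shows "(\<Sum>j<N. g j * (w (Suc j) - w j)) = g N * w N - g 0 * w 0 - (\<Sum>j<N. w (Suc j) * (g (Suc j) - g j))"
  by (induction N) (auto simp: algebra_simps)

text \<open>\<open>w\<close> stands for a path and need not have bounded variation. Summation by
  parts moves the differences onto \<open>g\<close>, leaving Riemann sums of \<open>w\<close>
  against \<open>g'\<close>. For \<open>s = t\<close> a partition has no cells, hence the empty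
  sum.\<close>

lemma stieltjes_sum_tendsto:
  assumes "t \<le> s" and w: "continuous_on {t..s} w" and g': "continuous_on {t..s} g'"
    and g: "\<And>x. x \<in> {t..s} \<Longrightarrow> (g has_real_derivative g' x) (at x within {t..s})"
  shows "(\<lambda>n. \<Sum>j<(if s = t then 0 else Suc n). g (uniform_partition t s (Suc n) j) *
      (w (uniform_partition t s (Suc n) (Suc j)) - w (uniform_partition t s (Suc n) j)))
    \<longlonglongrightarrow> g s * w s - g t * w t - integral {t..s} (\<lambda>x. w x * g' x)"
proof (cases "s = t")
  case False
  then have "t < s" using \<open>t \<le> s\<close> by simp
  let ?\<tau> = "\<lambda>n. uniform_partition t s (Suc n)"
  have P: "partition_of t s (Suc n) (?\<tau> n)" for n
    by (intro partition_of_uniform \<open>t < s\<close>) simp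
  have "bounded (g' ` {t..s})"
    using g' by (intro compact_imp_bounded compact_continuous_image) auto
  then obtain G0 where "\<forall>x\<in>{t..s}. \<bar>g' x\<bar> \<le> G0" by (auto simp: bounded_iff)
  then have "\<bar>g' x\<bar> \<le> \<bar>G0\<bar> + 1" if "x \<in> {t..s}" for x using that by force
  then obtain G where G: "\<And>x. x \<in> {t..s} \<Longrightarrow> \<bar>g' x\<bar> \<le> G" "G > 0"
    by (intro that[of "\<bar>G0\<bar> + 1"]) auto
  have uc: "uniformly_continuous_on {t..s} w"
    using w by (intro compact_uniformly_continuous) auto
  have "(\<lambda>n. \<Sum>j<Suc n. w (?\<tau> n (Suc j)) * integral {?\<tau> n j..?\<tau> n (Suc j)} g') \<longlonglongrightarrow> integral {t..s} (\<lambda>x. w x * g' x)"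
  proof (rule LIMSEQ_I)
    fix e :: real assume "e > 0"
    define \<epsilon> where "\<epsilon> = e / 2 / (G * (s - t))"
    have "\<epsilon> > 0" using \<open>e > 0\<close> G \<open>t < s\<close> by (simp add: \<epsilon>_def)
    then obtain d where d: "d > 0" "\<And>x y. x \<in> {t..s} \<Longrightarrow> y \<in> {t..s} \<Longrightarrow> dist y x < d \<Longrightarrow> dist (w y) (w x) < \<epsilon>"
      using uc unfolding uniformly_continuous_on_def by metis
    from eventually_uniform_partition_mesh[OF d(1), of s t] obtain n0 where
      n0: "\<And>n. n \<ge> n0 \<Longrightarrow> (s - t) / real n < d" by (auto simp: eventually_sequentially)
    show "\<exists>no. \<forall>n\<ge>no. norm ((\<Sum>j<Suc n. w (?\<tau> n (Suc j)) * integral {?\<tau> n j..?\<tau> n (Suc j)} g') -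
        integral {t..s} (\<lambda>x. w x * g' x)) < e"
    proof (intro exI allI impI)
      fix n assume "n0 \<le> n"
      then have mesh: "(s - t) / real (Suc n) < d" by (intro n0) simp
      have "\<bar>(\<Sum>j<Suc n. w (?\<tau> n (Suc j)) * integral {?\<tau> n j..?\<tau> n (Suc j)} g') -
        integral {t..s} (\<lambda>x. w x * g' x)\<bar> \<le> \<epsilon> * G * (s - t)"
      proof (rule riemann_stieltjes_sum_bound[OF P g' w])
        fix j x assume j: "j < Suc n" and x: "x \<in> {?\<tau> n j..?\<tau> n (Suc j)}"
        have b: "?\<tau> n j \<in> {t..s}" "?\<tau> n (Suc j) \<in> {t..s}" using partition_of_bounds[OF P] j by auto
        then have "dist (?\<tau> n (Suc j)) x < d"
          using x mesh uniform_partition_step[of t s "Suc n" j] by (auto simp: dist_real_def)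
        then have "dist (w (?\<tau> n (Suc j))) (w x) < \<epsilon>" using b x by (intro d) auto
        then show "\<bar>w (?\<tau> n (Suc j)) - w x\<bar> \<le> \<epsilon>" by (simp add: dist_real_def)
      qed (use G in auto)
      also have "\<dots> = e / 2" unfolding mult.assoc \<epsilon>_def using G \<open>t < s\<close> by simp
      also have "\<dots> < e" using \<open>e > 0\<close> by simp
      finally show "norm ((\<Sum>j<Suc n. w (?\<tau> n (Suc j)) * integral {?\<tau> n j..?\<tau> n (Suc j)} g') -
        integral {t..s} (\<lambda>x. w x * g' x)) < e" by simp
    qed
  qed
  moreover have "(\<Sum>j<Suc n. g (?\<tau> n j) * (w (?\<tau> n (Suc j)) - w (?\<tau> n j))) =
      g s * w s - g t * w t - (\<Sum>j<Suc n. w (?\<tau> n (Suc j)) * integral {?\<tau> n j..?\<tau> n (Suc j)} g')" for n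
  proof -
    have "integral {?\<tau> n j..?\<tau> n (Suc j)} g' = g (?\<tau> n (Suc j)) - g (?\<tau> n j)" if "j < Suc n" for j
    proof (intro integral_unique fundamental_theorem_of_calculus)
      show le: "?\<tau> n j \<le> ?\<tau> n (Suc j)" using partition_of_mono[OF P] that by simp
      fix x assume x: "x \<in> {?\<tau> n j..?\<tau> n (Suc j)}"
      have sub: "{?\<tau> n j..?\<tau> n (Suc j)} \<subseteq> {t..s}"
        using partition_of_bounds[OF P, of j n] partition_of_bounds[OF P, of "Suc j" n] that by auto
      then show "(g has_vector_derivative g' x) (at x within {?\<tau> n j..?\<tau> n (Suc j)})"
        using g[of x] x unfolding has_real_derivative_iff_has_vector_derivative
        by (blast intro: has_vector_derivative_within_subset)
    qed
    moreover have "?\<tau> n (Suc n) = s" "?\<tau> n 0 = t" using P[of n] by (auto simp: partition_of_def)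
    ultimately show ?thesis
      using summation_by_parts[of "\<lambda>j. g (?\<tau> n j)" "\<lambda>j. w (?\<tau> n j)" "Suc n"] by simp
  qed
  ultimately show ?thesis using False by (simp add: tendsto_diff)
qed simp

section \<open>Existence and representation of the Ito integrals\<close>

context wiener_interval
begin

lemma wproc_Suc: "i \<noteq> 0 \<Longrightarrow> wproc f i = f i"
  by (auto simp: wproc_def fun_eq_iff)

lemma simple_int_sum:
  "(\<And>j. j \<in> I \<Longrightarrow> simple_int i (a j) (X j)) \<Longrightarrow>
    simple_int i (\<lambda>x. \<Sum>j\<in>I. c j * a j x) (\<lambda>\<omega>. \<Sum>j\<in>I. c j * X j \<omega>)"
proof (induction I rule: infinite_finite_induct)
  case (insert j I)
  then have "simple_int i (a j) (X j)" "simple_int i (\<lambda>x. \<Sum>j\<in>I. c j * a j x) (\<lambda>\<omega>. \<Sum>j\<in>I. c j * X j \<omega>)" by auto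
  from simple_int_lin[OF this, of "c j" 1] insert.hyps show ?case by simp
qed (auto intro: simple_int_zero)

lemma simple_int_increment:
  assumes "a \<in> {t..T}" "b \<in> {t..T}" "a \<le> b"
  shows "simple_int i (indicator {a..<b}) (\<lambda>\<omega>. wproc f i b \<omega> - wproc f i a \<omega>)"
proof (cases "i = 0")
  case True
  then show ?thesis
    using integral_indicator_mu[OF assms] bm_indicator[of "{a..<b}"] by (simp add: simple_int_def wproc_def)
next
  case False
  have *: "simple_int i (indicator {t..<u}) (\<lambda>\<omega>. f i u \<omega> - f i t \<omega>)" if "u \<in> {t..T}" for u
    unfolding simple_int_def using False that
    by (auto intro!: exI[of _ "{u}"] exI[of _ "\<lambda>_. 1"] simp: step_sum_def[abs_def] wiener_sum_def[abs_def])
  have "(\<lambda>x. 1 * indicator {t..<b} x + - 1 * indicator {t..<a} x) = (indicator {a..<b} :: real \<Rightarrow> real)"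
    using assms by (auto simp: fun_eq_iff split: split_indicator)
  with simple_int_lin[OF *[OF assms(2)] *[OF assms(1)], of 1 "-1"] False show ?thesis
    by (simp add: wproc_Suc)
qed

lemma simple_int_step:
  assumes P: "partition_of t s N \<tau>" and "s \<le> T"
  shows "simple_int i (step_fun N \<tau> c) (step_integral (wproc f i) N \<tau> c)"
  unfolding step_fun_def[abs_def] step_integral_def[abs_def]
proof (rule simple_int_sum)
  fix j assume "j \<in> {..<N}"
  then show "simple_int i (indicator {\<tau> j..<\<tau> (Suc j)}) (\<lambda>\<omega>. wproc f i (\<tau> (Suc j)) \<omega> - wproc f i (\<tau> j) \<omega>)"
    using partition_of_bounds[OF P, of j] partition_of_bounds[OF P, of "Suc j"] partition_of_mono[OF P, of j "Suc j"] \<open>s \<le> T\<close>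
    by (intro simple_int_increment) auto
qed

text \<open>Translates the L2 distance used by \<open>is_ito_integral\<close> into a Bochner
  integral over \<open>[t, T]\<close>. Step functions vanish outside \<open>[t, s)\<close>, and the
  point \<open>s\<close> is null.\<close>

lemma nn_integral_step_error:
  assumes P: "partition_of t s N \<tau>" and "s \<le> T" and g: "continuous_on {t..T} g"
  shows "(\<integral>\<^sup>+x\<in>{t..s}. ennreal ((g x - step_fun N \<tau> c x)\<^sup>2) \<partial>lborel) =
    ennreal (\<integral>x. (indicator {t..<s} x * g x - step_fun N \<tau> c x)\<^sup>2 \<partial>\<mu>)"
proof -
  note [bm_intros] = bm_continuous[OF g] simple_int_bm[OF simple_int_step[OF P \<open>s \<le> T\<close>]]
  have "ennreal (\<integral>x. (indicator {t..<s} x * g x - step_fun N \<tau> c x)\<^sup>2 \<partial>\<mu>) =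
      (\<integral>\<^sup>+x. ennreal ((indicator {t..<s} x * g x - step_fun N \<tau> c x)\<^sup>2) \<partial>\<mu>)"
    by (intro nn_integral_eq_integral[symmetric] mu.bm_integrable bm_intros) auto
  also have "\<dots> = (\<integral>\<^sup>+x\<in>{t..T}. ennreal ((indicator {t..<s} x * g x - step_fun N \<tau> c x)\<^sup>2) \<partial>lborel)"
    by (rule nn_integral_restrict_space) simp
  also have "\<dots> = (\<integral>\<^sup>+x\<in>{t..s}. ennreal ((g x - step_fun N \<tau> c x)\<^sup>2) \<partial>lborel)"
  proof (rule nn_integral_cong_AE)
    show "AE x in lborel. ennreal ((indicator {t..<s} x * g x - step_fun N \<tau> c x)\<^sup>2) * indicator {t..T} x =
        ennreal ((g x - step_fun N \<tau> c x)\<^sup>2) * indicator {t..s} x"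
      using AE_lborel_singleton[of s]
    proof eventually_elim
      case (elim x)
      then show ?case
        using \<open>s \<le> T\<close> step_fun_outside[OF P, of x c] by (cases "x \<in> {t..<s}") (auto split: split_indicator)
    qed
  qed
  finally show ?thesis ..
qed

text \<open>The mean-square limit is replaced by an almost sure one along a subsequence; the L2
  convergence of the integrands is inherited.\<close>

lemma ito_integral_lim_int:
  assumes i: "i \<in> {1..m}" and s: "s \<in> {t..T}" and g: "continuous_on {t..T} g"
    and ito: "is_ito_integral M (wproc f i) t s g X"
  shows "lim_int i (\<lambda>x. indicator {t..<s} x * g x) X"
proof -
  from ito obtain N \<tau> c where P: "\<And>n. partition_of t s (N n) (\<tau> n)"
    and conv: "(\<lambda>n. \<integral>\<^sup>+x\<in>{t..s}. ennreal ((g x - step_fun (N n) (\<tau> n) (c n) x)\<^sup>2) \<partial>lborel) \<longlonglongrightarrow> 0"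
    and ms: "ms_tendsto M (\<lambda>n. step_integral (wproc f i) (N n) (\<tau> n) (c n)) X sequentially"
    unfolding is_ito_integral_def by blast
  have sT: "s \<le> T" using s by simp
  note S = simple_int_step[OF P sT]
  have "step_integral (wproc f i) (N n) (\<tau> n) (c n) \<in> borel_measurable M" for n
    using simple_int_measurable[OF _ S] i by auto
  from ms_tendsto_AE_subseq[OF this ms] obtain r :: "nat \<Rightarrow> nat" where r: "strict_mono r"
    "AE \<omega> in M. (\<lambda>n. step_integral (wproc f i) (N (r n)) (\<tau> (r n)) (c (r n)) \<omega>) \<longlonglongrightarrow> X \<omega>"
    by blast
  have "(\<lambda>n. ennreal (\<integral>x. (indicator {t..<s} x * g x - step_fun (N n) (\<tau> n) (c n) x)\<^sup>2 \<partial>\<mu>)) \<longlonglongrightarrow> ennreal 0"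
    using conv unfolding nn_integral_step_error[OF P sT g] by simp
  then have "(\<lambda>n. \<integral>x. (indicator {t..<s} x * g x - step_fun (N n) (\<tau> n) (c n) x)\<^sup>2 \<partial>\<mu>) \<longlonglongrightarrow> 0"
    by (subst (asm) tendsto_ennreal_iff) auto
  from LIMSEQ_subseq_LIMSEQ[OF this r(1)]
  have "(\<lambda>n. \<integral>x. (indicator {t..<s} x * g x - step_fun (N (r n)) (\<tau> (r n)) (c (r n)) x)\<^sup>2 \<partial>\<mu>) \<longlonglongrightarrow> 0"
    by (simp add: comp_def)
  moreover have "X \<in> borel_measurable M" using ms by (simp add: ms_tendsto_def)
  moreover have "bounded_measurable \<mu> (\<lambda>x. indicator {t..<s} x * g x)"
    using bm_continuous[OF g] by (intro bm_intros) auto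
  ultimately show ?thesis
    unfolding lim_int_def using r(2) S
    by (intro conjI exI[of _ "\<lambda>n. step_fun (N (r n)) (\<tau> (r n)) (c (r n))"]
      exI[of _ "\<lambda>n. step_integral (wproc f i) (N (r n)) (\<tau> (r n)) (c (r n))"]) auto
qed

text \<open>For smooth \<open>g\<close> the integral has a pathwise formula \<open>A\<close> by
  integration by parts, which is continuous in \<open>s\<close>. The step integrals converge to it
  on every continuous path, and also in mean square.\<close>

lemma ito_integral_exists:
  assumes i: "i \<in> {1..m}" and g: "C1_on t T g"
  shows "\<exists>\<eta>. (\<forall>s\<in>{t..T}. is_ito_integral M (wproc f i) t s g (\<eta> s)) \<and>
    (AE \<omega> in M. continuous_on {t..T} (\<lambda>s. \<eta> s \<omega>))"
proof -
  from g obtain g' where dg: "\<And>x. x \<in> {t..T} \<Longrightarrow> (g has_real_derivative g' x) (at x within {t..T})"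
    and cg': "continuous_on {t..T} g'" unfolding C1_on_def by metis
  have cg: "continuous_on {t..T} g" by (rule C1_on_imp_continuous_on[OF g])
  obtain L where L: "L > 0" "\<And>x y. x \<in> {t..T} \<Longrightarrow> y \<in> {t..T} \<Longrightarrow> \<bar>g x - g y\<bar> \<le> L * \<bar>x - y\<bar>"
    using C1_on_lipschitz[OF g] by metis
  have "i \<noteq> 0" using i by simp
  define N where "N s n = (if s = t then 0 else Suc n)" for s and n :: nat
  define \<tau> where "\<tau> s n = uniform_partition t s (Suc n)" for s n
  define c where "c s n j = g (\<tau> s n j)" for s n j
  define S where "S s n = step_integral (wproc f i) (N s n) (\<tau> s n) (c s n)" for s n
  \<comment> \<open>As a limit of measurable sums this is measurable for each \<open>s\<close>, and
    it agrees with \<open>A\<close> wherever the path is continuous.\<close>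
  define \<eta> where "\<eta> s \<omega> = lim (\<lambda>n. S s n \<omega>)" for s \<omega>
  define A where "A s \<omega> = g s * f i s \<omega> - g t * f i t \<omega> - integral {t..s} (\<lambda>x. f i x \<omega> * g' x)" for s \<omega>
  have P: "partition_of t s (N s n) (\<tau> s n)" if "s \<in> {t..T}" for s n
  proof (cases "s = t")
    case False
    then show ?thesis using that by (auto simp: N_def \<tau>_def intro!: partition_of_uniform)
  qed (simp add: N_def \<tau>_def partition_of_def uniform_partition_def)
  have cw: "AE \<omega> in M. continuous_on {t..T} (\<lambda>s. f i s \<omega>)"
    using wiener_continuous[OF i] by eventually_elim (use t_nonneg in \<open>auto intro: continuous_on_subset\<close>)
  have conv: "(\<lambda>n. S s n \<omega>) \<longlonglongrightarrow> A s \<omega>" if "s \<in> {t..T}" "continuous_on {t..T} (\<lambda>s. f i s \<omega>)" for s \<omega>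
  proof -
    have sub: "{t..s} \<subseteq> {t..T}" using that by auto
    have "(\<lambda>n. \<Sum>j<(if s = t then 0 else Suc n). g (uniform_partition t s (Suc n) j) *
        (f i (uniform_partition t s (Suc n) (Suc j)) \<omega> - f i (uniform_partition t s (Suc n) j) \<omega>)) \<longlonglongrightarrow> A s \<omega>"
      unfolding A_def using that sub
      by (intro stieltjes_sum_tendsto continuous_on_subset[OF cg' sub] continuous_on_subset[OF that(2) sub])
         (auto intro: DERIV_subset[OF dg])
    then show ?thesis
      by (simp add: S_def step_integral_def N_def \<tau>_def c_def wproc_Suc[OF \<open>i \<noteq> 0\<close>])
  qed
  have \<eta>A: "\<eta> s \<omega> = A s \<omega>" if "s \<in> {t..T}" "continuous_on {t..T} (\<lambda>s. f i s \<omega>)" for s \<omega>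
    unfolding \<eta>_def by (rule limI) (rule conv[OF that])
  have "AE \<omega> in M. continuous_on {t..T} (\<lambda>s. \<eta> s \<omega>)"
    using cw
  proof eventually_elim
    case (elim \<omega>)
    have "continuous_on {t..T} (\<lambda>s. A s \<omega>)"
      unfolding A_def by (intro continuous_intros continuous_on_integral_mu cg elim cg')
    then show ?case by (rule continuous_on_eq) (simp add: \<eta>A[OF _ elim])
  qed
  moreover have "is_ito_integral M (wproc f i) t s g (\<eta> s)" if s: "s \<in> {t..T}" for s
  proof -
    have sT: "s \<le> T" using s by simp
    have Si: "simple_int i (step_fun (N s n) (\<tau> s n) (c s n)) (S s n)" for n
      unfolding S_def by (rule simple_int_step[OF P[OF s] sT])
    note [bm_intros] = bm_continuous[OF cg] simple_int_bm[OF Si]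
    have Sm [measurable]: "S s n \<in> borel_measurable M" for n
      using simple_int_measurable[OF _ Si] i by auto
    have \<eta>m [measurable]: "\<eta> s \<in> borel_measurable M"
      unfolding \<eta>_def[abs_def] by measurable
    define d where "d n = (\<integral>x. (indicator {t..<s} x * g x - step_fun (N s n) (\<tau> s n) (c s n) x)\<^sup>2 \<partial>\<mu>)" for n
    have d_le: "d n \<le> (L * ((s - t) / real (Suc n)))\<^sup>2 * (T - t)" for n
    proof -
      have "d n \<le> (\<integral>x. (L * ((s - t) / real (Suc n)))\<^sup>2 \<partial>\<mu>)"
        unfolding d_def
      proof (intro integral_mono mu.bm_integrable bm_intros)
        fix x assume "x \<in> space \<mu>"
        then have x: "x \<in> {t..T}" by (simp add: space_mu)
        have "\<bar>indicator {t..<s} x * g x - step_fun (N s n) (\<tau> s n) (c s n) x\<bar> \<le> L * ((s - t) / real (Suc n))"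
        proof (rule step_fun_error[OF P[OF s]])
          show "0 \<le> L * ((s - t) / real (Suc n))" using L s by simp
          fix j assume j: "j < N s n" and xj: "x \<in> {\<tau> s n j..<\<tau> s n (Suc j)}"
          have "\<tau> s n j \<in> {t..T}" using partition_of_bounds[OF P[OF s], of j n] j s by auto
          then have "\<bar>g x - g (\<tau> s n j)\<bar> \<le> L * \<bar>x - \<tau> s n j\<bar>" using x by (intro L) auto
          also have "\<dots> \<le> L * ((s - t) / real (Suc n))"
            using xj L uniform_partition_step[of t s "Suc n" j] unfolding \<tau>_def
            by (intro mult_left_mono) auto
          finally show "\<bar>g x - c s n j\<bar> \<le> L * ((s - t) / real (Suc n))" by (simp add: c_def)
        qed
        then show "(indicator {t..<s} x * g x - step_fun (N s n) (\<tau> s n) (c s n) x)\<^sup>2 \<le> (L * ((s - t) / real (Suc n)))\<^sup>2"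
          by (rule power2_le_iff_abs_le[THEN iffD2, rotated]) (use L s in simp)
      qed auto
      then show ?thesis by (simp add: space_mu measure_mu mult.commute)
    qed
    have "(\<lambda>n. (s - t) / real (Suc n)) \<longlonglongrightarrow> 0"
      using LIMSEQ_Suc[OF lim_const_over_n[of "s - t"]] .
    then have "(\<lambda>n. (L * ((s - t) / real (Suc n)))\<^sup>2 * (T - t)) \<longlonglongrightarrow> (L * 0)\<^sup>2 * (T - t)"
      by (intro tendsto_intros)
    then have "(\<lambda>n. (L * ((s - t) / real (Suc n)))\<^sup>2 * (T - t)) \<longlonglongrightarrow> 0" by simp
    moreover have "0 \<le> d n" for n by (simp add: d_def)
    ultimately have d0: "d \<longlonglongrightarrow> 0"
      by (intro tendsto_sandwich[OF always_eventually always_eventually[OF allI[OF d_le]] tendsto_const]) auto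
    have diff: "mean_square M (\<lambda>\<omega>. S s n \<omega> - S s k \<omega>) \<le> ennreal (2 * d n + 2 * d k)" for n k
    proof -
      let ?a = "\<lambda>n. step_fun (N s n) (\<tau> s n) (c s n)" and ?h = "\<lambda>x. indicator {t..<s} x * g x"
      have "simple_int i (\<lambda>x. ?a n x - ?a k x) (\<lambda>\<omega>. S s n \<omega> - S s k \<omega>)"
        using simple_int_lin[OF Si[of n] Si[of k], of 1 "-1"] by simp
      from simple_int_moments[OF i this]
      have "mean_square M (\<lambda>\<omega>. S s n \<omega> - S s k \<omega>) = ennreal (\<integral>x. (?a n x - ?a k x)\<^sup>2 \<partial>\<mu>)"
        by (subst mean_square_eq_expectation) (auto simp: gauss_moments_def intro: integrable_power_le_4)
      moreover have "(\<integral>x. (?a n x - ?a k x)\<^sup>2 \<partial>\<mu>) \<le> 2 * d n + 2 * d k"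
      proof -
        have "(\<integral>x. ((?a n x - ?h x) + (?h x - ?a k x))\<^sup>2 \<partial>\<mu>) \<le>
            2 * (\<integral>x. (?a n x - ?h x)\<^sup>2 \<partial>\<mu>) + 2 * (\<integral>x. (?h x - ?a k x)\<^sup>2 \<partial>\<mu>)"
          by (intro mu.integral_square_add_le bm_intros) auto
        moreover have "(\<integral>x. (?a n x - ?h x)\<^sup>2 \<partial>\<mu>) = d n"
          unfolding d_def by (intro Bochner_Integration.integral_cong refl power2_commute)
        ultimately show ?thesis by (simp add: d_def)
      qed
      ultimately show ?thesis by (simp add: ennreal_leI)
    qed
    have AE: "AE \<omega> in M. (\<lambda>k. S s k \<omega>) \<longlonglongrightarrow> \<eta> s \<omega>"
      using cw by eventually_elim (use conv \<eta>A s in auto)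
    \<comment> \<open>Fatou in \<open>k\<close> turns the Cauchy estimate into a rate of convergence
      to the almost sure limit.\<close>
    have ub: "mean_square M (\<lambda>\<omega>. S s n \<omega> - \<eta> s \<omega>) \<le> ennreal (2 * d n + 2 * 0)" for n
    proof (rule mean_square_fatou[where X = "\<lambda>k \<omega>. S s n \<omega> - S s k \<omega>" and b = "\<lambda>k. 2 * d n + 2 * d k"])
      show "AE \<omega> in M. (\<lambda>k. S s n \<omega> - S s k \<omega>) \<longlonglongrightarrow> S s n \<omega> - \<eta> s \<omega>"
        using AE by eventually_elim (intro tendsto_intros)
      show "(\<lambda>k. 2 * d n + 2 * d k) \<longlonglongrightarrow> 2 * d n + 2 * 0" by (intro tendsto_intros d0)
    qed (auto simp: diff)
    have "(\<lambda>n. ennreal (2 * d n + 2 * 0)) \<longlonglongrightarrow> ennreal (2 * 0 + 2 * 0)"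
      by (intro tendsto_intros d0)
    then have "(\<lambda>n. ennreal (2 * d n + 2 * 0)) \<longlonglongrightarrow> 0" by simp
    then have "(\<lambda>n. mean_square M (\<lambda>\<omega>. S s n \<omega> - \<eta> s \<omega>)) \<longlonglongrightarrow> 0"
      by (rule tendsto_sandwich[OF always_eventually[OF allI[OF zero_le]] always_eventually[OF allI[OF ub]] tendsto_const])
    then have "ms_tendsto M (S s) (\<eta> s) sequentially" by (simp add: ms_tendsto_def)
    moreover have "(\<lambda>n. \<integral>\<^sup>+x\<in>{t..s}. ennreal ((g x - step_fun (N s n) (\<tau> s n) (c s n) x)\<^sup>2) \<partial>lborel) \<longlonglongrightarrow> 0"
      unfolding nn_integral_step_error[OF P[OF s] sT cg] d_def[symmetric]
      using tendsto_ennrealI[OF d0] by simp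
    ultimately show ?thesis
      unfolding is_ito_integral_def S_def[abs_def]
      by (intro exI[of _ "N s"] exI[of _ "\<tau> s"] exI[of _ "c s"] conjI allI P[OF s])
  qed
  ultimately show ?thesis by blast
qed

text \<open>Existence makes the chosen process satisfy its defining property, which is all that is
  used of it.\<close>

lemma stoch_int_lim_int:
  assumes i: "i \<in> {0..m}" and g: "C1_on t T g" and s: "s \<in> {t..T}"
  shows "lim_int i (\<lambda>x. indicator {t..<s} x * g x) (stoch_int M f i t T g s)"
proof (cases "i = 0")
  case True
  have cg: "continuous_on {t..T} g" by (rule C1_on_imp_continuous_on[OF g])
  have "simple_int 0 (\<lambda>x. indicator {t..<s} x * g x) (stoch_int M f 0 t T g s)"
    unfolding simple_int_def stoch_int_def using s t_less_T bm_continuous[OF cg]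
    by (auto simp: integral_mu_indicator[OF cg] set_integral_continuous[OF cg] intro!: bm_intros)
  then show ?thesis using True i by (intro simple_int_imp_lim_int) auto
next
  case False
  then have i': "i \<in> {1..m}" using i by auto
  from someI_ex[OF ito_integral_exists[OF i' g]] False s
  have "is_ito_integral M (wproc f i) t s g (stoch_int M f i t T g s)"
    by (simp add: stoch_int_def)
  then show ?thesis by (intro ito_integral_lim_int i' s C1_on_imp_continuous_on[OF g])
qed

lemma stoch_int_continuous:
  assumes i: "i \<in> {0..m}" and g: "C1_on t T g"
  shows "AE \<omega> in M. continuous_on {t..T} (\<lambda>s. stoch_int M f i t T g s \<omega>)"
proof (cases "i = 0")
  case True
  have cg: "continuous_on {t..T} g" by (rule C1_on_imp_continuous_on[OF g])
  have "continuous_on {t..T} (\<lambda>s. LBINT r:{t..s}. g r)"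
    using continuous_on_integral_mu[OF cg]
    by (rule continuous_on_eq) (rule set_integral_continuous[OF cg, symmetric])
  then show ?thesis using True by (simp add: stoch_int_def)
next
  case False
  then have i': "i \<in> {1..m}" using i by auto
  from someI_ex[OF ito_integral_exists[OF i' g]] False show ?thesis
    by (simp add: stoch_int_def)
qed

lemma C1_on_phi: "C1_on t T (\<phi> j)"
  unfolding C1_on_def
proof (intro exI[of _ "\<lambda>x. sqrt ((2 * real j + 1) / (T - t)) *
    (poly (pderiv (legendre_poly j)) ((x - (T + t) / 2) * (2 / (T - t))) * (2 / (T - t)))"] conjI ballI)
  fix x
  have "((\<lambda>x. (x - (T + t) / 2) * (2 / (T - t))) has_real_derivative 1 * (2 / (T - t))) (at x within {t..T})"
    by (intro DERIV_cmult_right) (auto intro!: derivative_eq_intros)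
  then have "((\<lambda>x. (x - (T + t) / 2) * (2 / (T - t))) has_real_derivative 2 / (T - t)) (at x within {t..T})"
    by simp
  from DERIV_cmult[OF DERIV_chain2[OF poly_DERIV this]]
  show "(\<phi> j has_real_derivative sqrt ((2 * real j + 1) / (T - t)) *
    (poly (pderiv (legendre_poly j)) ((x - (T + t) / 2) * (2 / (T - t))) * (2 / (T - t)))) (at x within {t..T})"
    unfolding legendre_phi_def .
qed (intro continuous_intros)

text \<open>Only the removal of the cut-off at the null point \<open>T\<close> is new.\<close>

lemma zeta_lim_int:
  assumes i: "i \<in> {0..m}"
  shows "lim_int i (\<phi> j) (zeta M f t T i j)"
proof -
  have "lim_int i (\<lambda>x. indicator {t..<T} x * \<phi> j x) (zeta M f t T i j)"
    unfolding zeta_def using t_less_T by (intro stoch_int_lim_int i C1_on_phi) auto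
  then obtain s S where "zeta M f t T i j \<in> borel_measurable M" and S: "\<And>n. simple_int i (s n) (S n)"
    and lim: "(\<lambda>n. \<integral>x. (indicator {t..<T} x * \<phi> j x - s n x)\<^sup>2 \<partial>\<mu>) \<longlonglongrightarrow> 0"
    "AE \<omega> in M. (\<lambda>n. S n \<omega>) \<longlonglongrightarrow> zeta M f t T i j \<omega>"
    unfolding lim_int_def by blast
  moreover have eq: "(\<integral>x. (indicator {t..<T} x * \<phi> j x - s x)\<^sup>2 \<partial>\<mu>) = (\<integral>x. (\<phi> j x - s x)\<^sup>2 \<partial>\<mu>)"
    if "simple_int i s S" for s S
  proof (rule integral_cong_AE)
    note [bm_intros] = simple_int_bm[OF that]
    show "(\<lambda>x. (indicator {t..<T} x * \<phi> j x - s x)\<^sup>2) \<in> borel_measurable \<mu>"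
      "(\<lambda>x. (\<phi> j x - s x)\<^sup>2) \<in> borel_measurable \<mu>"
      by (auto intro!: bm_measurable bm_intros)
    have "AE x in \<mu>. x \<noteq> T"
      by (subst AE_restrict_space_iff) (auto intro: AE_mp[OF AE_lborel_singleton[of T]])
    then show "AE x in \<mu>. (indicator {t..<T} x * \<phi> j x - s x)\<^sup>2 = (\<phi> j x - s x)\<^sup>2"
      using AE_space by eventually_elim (auto simp: space_mu split: split_indicator)
  qed
  ultimately show ?thesis
    unfolding lim_int_def using bm_phi S lim(1)[unfolded eq[OF S]] lim(2) by blast
qed

end

section \<open>The iterated Stratonovich integral\<close>

text \<open>Applied path by path for \<open>i2 = 0\<close>: the time integral is then also a limit
  of Stratonovich sums, so both cases of \<open>stratonovich2\<close> can be treated alike.\<close>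

lemma trapezoid_sum_tendsto:
  fixes \<psi> \<eta> :: "real \<Rightarrow> real"
  assumes "t < T" and \<psi>: "continuous_on {t..T} \<psi>" and \<eta>: "continuous_on {t..T} \<eta>"
  defines "\<tau> \<equiv> \<lambda>n. uniform_partition t T (Suc n)"
  shows "(\<lambda>n. \<Sum>j<Suc n. \<psi> (\<tau> n j) * ((\<eta> (\<tau> n j) + \<eta> (\<tau> n (Suc j))) / 2) * (\<tau> n (Suc j) - \<tau> n j))
    \<longlonglongrightarrow> integral {t..T} (\<lambda>x. \<psi> x * \<eta> x)"
proof (rule LIMSEQ_I)
  fix e :: real assume "e > 0"
  have P: "partition_of t T (Suc n) (\<tau> n)" for n
    unfolding \<tau>_def by (intro partition_of_uniform \<open>t < T\<close>) simp
  \<comment> \<open>Decoupling the arguments makes the mixed product, with \<psi> and \<eta> taken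
    at different end points, accessible to uniform continuity.\<close>
  have "continuous_on ({t..T} \<times> {t..T}) (\<lambda>z. \<psi> (fst z) * \<eta> (snd z))"
    by (intro continuous_intros continuous_on_compose2[OF \<psi>] continuous_on_compose2[OF \<eta>]) auto
  then have "uniformly_continuous_on ({t..T} \<times> {t..T}) (\<lambda>z. \<psi> (fst z) * \<eta> (snd z))"
    by (intro compact_uniformly_continuous compact_Times) auto
  moreover define \<epsilon> where "\<epsilon> = e / 2 / (T - t)"
  have "\<epsilon> > 0" using \<open>e > 0\<close> \<open>t < T\<close> by (simp add: \<epsilon>_def)
  ultimately obtain d where d: "d > 0" "\<And>z z'. z \<in> {t..T} \<times> {t..T} \<Longrightarrow> z' \<in> {t..T} \<times> {t..T} \<Longrightarrow> dist z' z < d \<Longrightarrow>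
      dist (\<psi> (fst z') * \<eta> (snd z')) (\<psi> (fst z) * \<eta> (snd z)) < \<epsilon>"
    unfolding uniformly_continuous_on_def by metis
  have close: "\<bar>\<psi> a * \<eta> b - \<psi> x * \<eta> x\<bar> < \<epsilon>"
    if "a \<in> {t..T}" "b \<in> {t..T}" "x \<in> {t..T}" "\<bar>a - x\<bar> < d / 2" "\<bar>b - x\<bar> < d / 2" for a b x
  proof -
    have "dist (a, b) (x, x) \<le> \<bar>a - x\<bar> + \<bar>b - x\<bar>"
      using sqrt_sum_squares_le_sum_abs[of "a - x" "b - x"] by (simp add: dist_Pair_Pair dist_real_def)
    then have "dist (a, b) (x, x) < d" using that by simp
    then show ?thesis using d(2)[of "(x, x)" "(a, b)"] that by (simp add: dist_real_def)
  qed
  from eventually_uniform_partition_mesh[of "d / 2" T t] d(1) obtain n0 where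
    n0: "\<And>n. n \<ge> n0 \<Longrightarrow> (T - t) / real n < d / 2" by (auto simp: eventually_sequentially)
  show "\<exists>no. \<forall>n\<ge>no. norm ((\<Sum>j<Suc n. \<psi> (\<tau> n j) * ((\<eta> (\<tau> n j) + \<eta> (\<tau> n (Suc j))) / 2) * (\<tau> n (Suc j) - \<tau> n j)) -
      integral {t..T} (\<lambda>x. \<psi> x * \<eta> x)) < e"
  proof (intro exI allI impI)
    fix n assume "n0 \<le> n"
    then have mesh: "(T - t) / real (Suc n) < d / 2" by (intro n0) simp
    let ?v = "\<lambda>j. \<psi> (\<tau> n j) * ((\<eta> (\<tau> n j) + \<eta> (\<tau> n (Suc j))) / 2)"
    have "\<bar>(\<Sum>j<Suc n. ?v j * integral {\<tau> n j..\<tau> n (Suc j)} (\<lambda>x. 1)) - integral {t..T} (\<lambda>x. (\<psi> x * \<eta> x) * 1)\<bar>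
        \<le> \<epsilon> * 1 * (T - t)"
    proof (rule riemann_stieltjes_sum_bound[OF P])
      fix j x assume j: "j < Suc n" and x: "x \<in> {\<tau> n j..\<tau> n (Suc j)}"
      have b: "\<tau> n j \<in> {t..T}" "\<tau> n (Suc j) \<in> {t..T}" using partition_of_bounds[OF P] j by auto
      have "\<tau> n (Suc j) - \<tau> n j < d / 2" using mesh unfolding \<tau>_def uniform_partition_step .
      then have "\<bar>\<psi> (\<tau> n j) * \<eta> (\<tau> n j) - \<psi> x * \<eta> x\<bar> < \<epsilon>" "\<bar>\<psi> (\<tau> n j) * \<eta> (\<tau> n (Suc j)) - \<psi> x * \<eta> x\<bar> < \<epsilon>"
        using b x by (intro close; auto)+
      then have "\<bar>((\<psi> (\<tau> n j) * \<eta> (\<tau> n j) - \<psi> x * \<eta> x) + (\<psi> (\<tau> n j) * \<eta> (\<tau> n (Suc j)) - \<psi> x * \<eta> x)) / 2\<bar> \<le> \<epsilon>"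
        unfolding abs_divide by (intro order_trans[OF divide_right_mono[OF abs_triangle_ineq]]) auto
      moreover have "?v j - \<psi> x * \<eta> x = ((\<psi> (\<tau> n j) * \<eta> (\<tau> n j) - \<psi> x * \<eta> x) + (\<psi> (\<tau> n j) * \<eta> (\<tau> n (Suc j)) - \<psi> x * \<eta> x)) / 2"
        by (simp add: field_simps)
      ultimately show "\<bar>?v j - \<psi> x * \<eta> x\<bar> \<le> \<epsilon>" by (simp only:)
    qed (auto intro!: continuous_intros \<psi> \<eta>)
    also have "\<epsilon> * 1 * (T - t) = e / 2" 
      unfolding \<epsilon>_def mult_1_right times_divide_eq_left[of "e / 2"] using \<open>t < T\<close>
      by (intro nonzero_mult_div_cancel_right) simp
    also have "(\<Sum>j<Suc n. ?v j * integral {\<tau> n j..\<tau> n (Suc j)} (\<lambda>x. 1)) = (\<Sum>j<Suc n. ?v j * (\<tau> n (Suc j) - \<tau> n j))"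
    proof (intro sum.cong refl arg_cong2[where f = "(*)"])
      fix j assume "j \<in> {..<Suc n}"
      then have "\<tau> n j \<le> \<tau> n (Suc j)" by (intro partition_of_mono[OF P]) auto
      then show "integral {\<tau> n j..\<tau> n (Suc j)} (\<lambda>x. 1) = \<tau> n (Suc j) - \<tau> n j" by simp
    qed
    finally show "norm ((\<Sum>j<Suc n. ?v j * (\<tau> n (Suc j) - \<tau> n j)) - integral {t..T} (\<lambda>x. \<psi> x * \<eta> x)) < e"
      using \<open>e > 0\<close> by simp
  qed
qed

text \<open>The Riesz-Fischer argument: along fast indices the increments are summable in L1, hence
  almost surely. The index map \<open>r\<close> is only required to send \<open>a\<close> to
  zero.\<close>

lemma (in prob_space) mean_square_complete:
  assumes [measurable]: "\<And>n. X n \<in> borel_measurable M"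
    and cauchy: "\<And>n k. mean_square M (\<lambda>\<omega>. X n \<omega> - X k \<omega>) \<le> ennreal (a n + a k)"
    and a: "a \<longlonglongrightarrow> 0"
  shows "\<exists>Y r. Y \<in> borel_measurable M \<and> (\<lambda>n. a (r n)) \<longlonglongrightarrow> 0 \<and> (AE \<omega> in M. (\<lambda>n. X (r n) \<omega>) \<longlonglongrightarrow> Y \<omega>)"
proof -
  have "\<exists>k. \<bar>a k\<bar> < (1 / 4) ^ n / 2" for n
  proof -
    have "eventually (\<lambda>k. dist (a k) 0 < (1 / 4) ^ n / 2) sequentially"
      using a by (rule tendstoD) simp
    then show ?thesis by (auto simp: eventually_sequentially)
  qed
  then obtain r where r: "\<And>n. \<bar>a (r n)\<bar> < (1 / 4) ^ n / 2" by metis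
  have "(\<lambda>n. (1 / 4 :: real) ^ n / 2) \<longlonglongrightarrow> 0 / 2"
    by (intro tendsto_intros LIMSEQ_realpow_zero) auto
  then have "(\<lambda>n. (1 / 4 :: real) ^ n / 2) \<longlonglongrightarrow> 0" by simp
  then have ar: "(\<lambda>n. a (r n)) \<longlonglongrightarrow> 0"
    by (rule Lim_null_comparison[rotated]) (use r in \<open>auto intro!: always_eventually less_imp_le\<close>)
  define D where "D n \<omega> = X (r (Suc n)) \<omega> - X (r n) \<omega>" for n \<omega>
  have [measurable]: "D n \<in> borel_measurable M" for n unfolding D_def by measurable
  have msD: "mean_square M (D n) \<le> ennreal ((1 / 4) ^ n)" for n
  proof -
    have "a (r (Suc n)) + a (r n) \<le> (1 / 4) ^ n"
    proof -
      have "(1 / 4 :: real) ^ Suc n \<le> (1 / 4) ^ n" by (rule power_decreasing) auto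
      then show ?thesis using r[of n] r[of "Suc n"] by linarith
    qed
    then show ?thesis
      unfolding D_def using cauchy[of "r (Suc n)" "r n"] by (meson ennreal_leI order_trans)
  qed
  have D1: "(\<integral>\<^sup>+\<omega>. ennreal \<bar>D n \<omega>\<bar> \<partial>M) \<le> ennreal (2 * (1 / 2) ^ n)" for n
  proof -
    have "(\<integral>\<^sup>+\<omega>. ennreal \<bar>D n \<omega>\<bar> \<partial>M) \<le> (\<integral>\<^sup>+\<omega>. ennreal ((1 / 2) ^ n) + ennreal (2 ^ n) * ennreal ((D n \<omega>)\<^sup>2) \<partial>M)"
    proof (rule nn_integral_mono)
      fix \<omega>
      \<comment> \<open>A weighted arithmetic-geometric inequality bounds the absolute value of
        \<open>D n\<close> by \<open>1 / q + q * (D n \<omega>)\<^sup>2\<close>. With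
        \<open>q = 2 ^ n\<close> and a mean square of at most \<open>(1 / 4) ^ n\<close> both parts
        have mean at most \<open>(1 / 2) ^ n\<close>.\<close>
      define q where "q = (2::real) ^ n"
      have "q > 0" by (simp add: q_def)
      have "0 \<le> (q * \<bar>D n \<omega>\<bar> - 1)\<^sup>2" by simp
      then have "2 * q * \<bar>D n \<omega>\<bar> \<le> q\<^sup>2 * (D n \<omega>)\<^sup>2 + 1" by (simp add: power2_diff power_mult_distrib)
      moreover have "0 \<le> q * \<bar>D n \<omega>\<bar>" using \<open>q > 0\<close> by simp
      moreover have "q * (1 / q + q * (D n \<omega>)\<^sup>2) = 1 + q\<^sup>2 * (D n \<omega>)\<^sup>2"
        using \<open>q > 0\<close> by (simp add: distrib_left power2_eq_square)
      ultimately have "q * \<bar>D n \<omega>\<bar> \<le> q * (1 / q + q * (D n \<omega>)\<^sup>2)"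
        by linarith
      then have "\<bar>D n \<omega>\<bar> \<le> 1 / q + q * (D n \<omega>)\<^sup>2" using \<open>q > 0\<close> by (simp only: mult_le_cancel_left_pos)
      then have "ennreal \<bar>D n \<omega>\<bar> \<le> ennreal ((1 / 2) ^ n + 2 ^ n * (D n \<omega>)\<^sup>2)"
        by (intro ennreal_leI) (simp add: q_def power_one_over)
      also have "\<dots> = ennreal ((1 / 2) ^ n) + ennreal (2 ^ n) * ennreal ((D n \<omega>)\<^sup>2)"
        by (simp add: ennreal_mult)
      finally show "ennreal \<bar>D n \<omega>\<bar> \<le> ennreal ((1 / 2) ^ n) + ennreal (2 ^ n) * ennreal ((D n \<omega>)\<^sup>2)" .
    qed
    also have "\<dots> = ennreal ((1 / 2) ^ n) + ennreal (2 ^ n) * mean_square M (D n)"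
      unfolding mean_square_def by (subst nn_integral_add) (auto simp: nn_integral_cmult emeasure_space_1)
    also have "\<dots> \<le> ennreal ((1 / 2) ^ n) + ennreal (2 ^ n) * ennreal ((1 / 4) ^ n)"
      by (intro add_left_mono mult_left_mono msD) auto
    also have "\<dots> = ennreal ((1 / 2) ^ n + 2 ^ n * (1 / 4) ^ n)"
      by (simp add: ennreal_mult)
    also have "(2::real) ^ n * (1 / 4) ^ n = (1 / 2) ^ n"
      by (simp flip: power_mult_distrib)
    finally show ?thesis by simp
  qed
  have "(\<integral>\<^sup>+\<omega>. (\<Sum>n. ennreal \<bar>D n \<omega>\<bar>) \<partial>M) = (\<Sum>n. \<integral>\<^sup>+\<omega>. ennreal \<bar>D n \<omega>\<bar> \<partial>M)"
    by (rule nn_integral_suminf) simp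
  also have "\<dots> \<le> (\<Sum>n. ennreal (2 * (1 / 2) ^ n))"
    by (intro suminf_le D1) auto
  also have "\<dots> = ennreal (\<Sum>n. 2 * (1 / 2) ^ n)"
    by (intro suminf_ennreal2 summable_mult summable_geometric) auto
  finally have "(\<integral>\<^sup>+\<omega>. (\<Sum>n. ennreal \<bar>D n \<omega>\<bar>) \<partial>M) \<noteq> \<infinity>"
    by (auto simp: top_unique)
  then have "AE \<omega> in M. (\<Sum>n. ennreal \<bar>D n \<omega>\<bar>) \<noteq> \<infinity>"
    by (intro nn_integral_PInf_AE) auto
  then have "AE \<omega> in M. (\<lambda>n. X (r n) \<omega>) \<longlonglongrightarrow> lim (\<lambda>n. X (r n) \<omega>)"
  proof eventually_elim
    case (elim \<omega>)
    then have "summable (\<lambda>n. \<bar>D n \<omega>\<bar>)"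
      by (intro summable_suminf_not_top) auto
    then have "summable (\<lambda>n. D n \<omega>)" by (rule summable_rabs_cancel)
    then have "convergent (\<lambda>n. \<Sum>k<n. D k \<omega>)" by (simp add: summable_iff_convergent)
    then have "convergent (\<lambda>n. (\<Sum>k<n. D k \<omega>) + X (r 0) \<omega>)" by (intro convergent_add convergent_const)
    moreover have "(\<Sum>k<n. D k \<omega>) + X (r 0) \<omega> = X (r n) \<omega>" for n
      unfolding D_def using sum_lessThan_telescope[of "\<lambda>n. X (r n) \<omega>" n] by simp
    ultimately show ?case by (simp add: convergent_LIMSEQ_iff)
  qed
  then show ?thesis using ar
    by (intro exI[of _ "\<lambda>\<omega>. lim (\<lambda>n. X (r n) \<omega>)"] exI[of _ r] conjI) measurable
qed

section \<open>Comparison of the Stratonovich sums with the Fourier sums\<close>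

context wiener_interval
begin

text \<open>Two expressions are close if both are close to a common target, here a number
  \<open>h\<close> and a function \<open>K\<close> that need not come from any expression. The
  factor 4 combines the 2 of \<open>lim_bilinear_bound\<close> with the 2 of the squared triangle
  inequality.\<close>

lemma bilinear_comparison:
  assumes i: "i1 \<in> {0..m}" "i2 \<in> {0..m}"
    and X: "bilinear (lim_int i1) (lim_int i2) k u X" and Y: "bilinear (lim_int i1) (lim_int i2) l v Y"
    and K: "bounded_measurable \<mu>2 K"
  shows "mean_square M (\<lambda>\<omega>. X \<omega> - Y \<omega>) \<le> ennreal (4 * ms_const *
    (((h - u)\<^sup>2 + (\<integral>z. (K z - k z)\<^sup>2 \<partial>\<mu>2)) + ((h - v)\<^sup>2 + (\<integral>z. (K z - l z)\<^sup>2 \<partial>\<mu>2))))"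
proof -
  note [bm_intros] = bilinear_lim_bm[OF X] bilinear_lim_bm[OF Y] K
  let ?k = "\<integral>z. (K z - k z)\<^sup>2 \<partial>\<mu>2" and ?l = "\<integral>z. (K z - l z)\<^sup>2 \<partial>\<mu>2"
  have "(\<integral>z. ((k z - K z) + (K z - l z))\<^sup>2 \<partial>\<mu>2) \<le> 2 * (\<integral>z. (k z - K z)\<^sup>2 \<partial>\<mu>2) + 2 * ?l"
    by (intro mu2.integral_square_add_le bm_intros)
  moreover have "(\<integral>z. (k z - K z)\<^sup>2 \<partial>\<mu>2) = ?k"
    by (intro Bochner_Integration.integral_cong refl power2_commute)
  ultimately have kl: "(\<integral>z. (k z - l z)\<^sup>2 \<partial>\<mu>2) \<le> 2 * ?k + 2 * ?l" by simp
  have "(b - a)\<^sup>2 \<le> 2 * a\<^sup>2 + 2 * b\<^sup>2" for a b :: real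
    using zero_le_power2[of "a + b"] by (simp add: power2_sum power2_diff mult_ac)
  from this[of "h - v" "h - u"] have uv: "(u - v)\<^sup>2 \<le> 2 * (h - u)\<^sup>2 + 2 * (h - v)\<^sup>2" by simp
  have "(u - v)\<^sup>2 + 2 * (\<integral>z. (k z - l z)\<^sup>2 \<partial>\<mu>2) \<le> 4 * (((h - u)\<^sup>2 + ?k) + ((h - v)\<^sup>2 + ?l))"
    using kl uv zero_le_power2[of "h - u"] zero_le_power2[of "h - v"] by (simp only: distrib_left)
  then have "ms_const * ((u - v)\<^sup>2 + 2 * (\<integral>z. (k z - l z)\<^sup>2 \<partial>\<mu>2)) \<le> 4 * ms_const * (((h - u)\<^sup>2 + ?k) + ((h - v)\<^sup>2 + ?l))"
    using mult_left_mono[of _ _ ms_const] ms_const_pos by (simp add: mult_ac)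
  then show ?thesis
    using lim_bilinear_bound[OF i bilinear_diff[OF X Y]] by (meson ennreal_leI order_trans)
qed

lemma stratonovich_sum_bilinear:
  assumes i: "i1 \<in> {0..m}" "i2 \<in> {0..m}" and \<psi>1: "C1_on t T \<psi>1" and P: "partition_of t T N \<tau>"
  shows "bilinear (lim_int i1) (lim_int i2) (stratonovich_kernel \<psi>1 \<psi>2 N \<tau>) (stratonovich_trace \<psi>1 \<psi>2 N \<tau>)
    (stratonovich_sum \<psi>2 (stoch_int M f i1 t T \<psi>1) (wproc f i2) (N, \<tau>))"
proof -
  let ?\<eta> = "stoch_int M f i1 t T \<psi>1" and ?d = "\<lambda>j \<omega>. wproc f i2 (\<tau> (Suc j)) \<omega> - wproc f i2 (\<tau> j) \<omega>"
  have "bilinear (lim_int i1) (lim_int i2) (stratonovich_kernel \<psi>1 \<psi>2 N \<tau>) (stratonovich_trace \<psi>1 \<psi>2 N \<tau>)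
      (\<lambda>\<omega>. \<Sum>j<N. \<psi>2 (\<tau> j) / 2 * (?\<eta> (\<tau> j) \<omega> * ?d j \<omega>) + \<psi>2 (\<tau> j) / 2 * (?\<eta> (\<tau> (Suc j)) \<omega> * ?d j \<omega>))"
    unfolding stratonovich_kernel_def[abs_def] stratonovich_trace_def
  proof (rule bilinear_sum)
    fix j assume "j \<in> {..<N}"
    then have b: "\<tau> j \<in> {t..T}" "\<tau> (Suc j) \<in> {t..T}" "\<tau> j \<le> \<tau> (Suc j)"
      using partition_of_bounds[OF P] partition_of_mono[OF P, of j "Suc j"] by auto
    have d: "lim_int i2 (indicator {\<tau> j..<\<tau> (Suc j)}) (?d j)"
      by (intro simple_int_imp_lim_int simple_int_increment i b)
    note B = bilinear.base[where A = "lim_int i1" and B = "lim_int i2", OF stoch_int_lim_int[OF i(1) \<psi>1 b(1)] d] bilinear.base[where A = "lim_int i1" and B = "lim_int i2", OF stoch_int_lim_int[OF i(1) \<psi>1 b(2)] d]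
    show "bilinear (lim_int i1) (lim_int i2)
        (\<lambda>z. \<psi>2 (\<tau> j) / 2 * ((indicator {t..<\<tau> j} (fst z) * \<psi>1 (fst z)) * indicator {\<tau> j..<\<tau> (Suc j)} (snd z)) +
          \<psi>2 (\<tau> j) / 2 * ((indicator {t..<\<tau> (Suc j)} (fst z) * \<psi>1 (fst z)) * indicator {\<tau> j..<\<tau> (Suc j)} (snd z)))
        (\<psi>2 (\<tau> j) / 2 * (\<integral>x. (indicator {t..<\<tau> j} x * \<psi>1 x) * indicator {\<tau> j..<\<tau> (Suc j)} x \<partial>\<mu>) +
          \<psi>2 (\<tau> j) / 2 * (\<integral>x. (indicator {t..<\<tau> (Suc j)} x * \<psi>1 x) * indicator {\<tau> j..<\<tau> (Suc j)} x \<partial>\<mu>))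
        (\<lambda>\<omega>. \<psi>2 (\<tau> j) / 2 * (?\<eta> (\<tau> j) \<omega> * ?d j \<omega>) + \<psi>2 (\<tau> j) / 2 * (?\<eta> (\<tau> (Suc j)) \<omega> * ?d j \<omega>))"
      by (rule bilinear.lin[OF B(1) bilinear_scale[OF B(2)]])
  qed
  also have "(\<lambda>\<omega>. \<Sum>j<N. \<psi>2 (\<tau> j) / 2 * (?\<eta> (\<tau> j) \<omega> * ?d j \<omega>) + \<psi>2 (\<tau> j) / 2 * (?\<eta> (\<tau> (Suc j)) \<omega> * ?d j \<omega>)) =
      stratonovich_sum \<psi>2 ?\<eta> (wproc f i2) (N, \<tau>)"
    unfolding stratonovich_sum_def by (auto intro!: ext sum.cong simp: field_simps)
  finally show ?thesis .
qed

lemma fourier_sum_bilinear: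
  assumes i: "i1 \<in> {0..m}" "i2 \<in> {0..m}"
  shows "bilinear (lim_int i1) (lim_int i2) (fourier_kernel \<psi>1 \<psi>2 p1 p2)
    (\<Sum>j1\<le>p1. \<Sum>j2\<le>p2. fourier_coeff t T \<psi>1 \<psi>2 j2 j1 * (\<integral>x. \<phi> j1 x * \<phi> j2 x \<partial>\<mu>))
    (\<lambda>\<omega>. \<Sum>j1\<le>p1. \<Sum>j2\<le>p2. fourier_coeff t T \<psi>1 \<psi>2 j2 j1 * (zeta M f t T i1 j1 \<omega> * zeta M f t T i2 j2 \<omega>))"
  by (intro bilinear_sum bilinear_scale bilinear.base zeta_lim_int i)

text \<open>Puts both branches of \<open>stratonovich2\<close> into the form in which Fatou's lemma
  can use them.\<close>

lemma stratonovich2_AE_limit: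
  assumes i: "i1 \<in> {0..m}" "i2 \<in> {0..m}" and \<psi>1: "C1_on t T \<psi>1" and \<psi>2: "C1_on t T \<psi>2"
  shows "\<exists>r. strict_mono r \<and> (AE \<omega> in M. (\<lambda>n. stratonovich_sum \<psi>2 (stoch_int M f i1 t T \<psi>1) (wproc f i2)
    (Suc (r n), uniform_partition t T (Suc (r n))) \<omega>) \<longlonglongrightarrow> stratonovich2 M f t T \<psi>1 \<psi>2 i1 i2 \<omega>)"
proof -
  let ?\<eta> = "stoch_int M f i1 t T \<psi>1"
  define Z where "Z = stratonovich_sum \<psi>2 ?\<eta> (wproc f i2)"
  define \<tau> where "\<tau> n = uniform_partition t T (Suc n)" for n
  have P: "partition_of t T (Suc n) (\<tau> n)" for n
    unfolding \<tau>_def by (intro partition_of_uniform t_less_T) simp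
  have "\<exists>r. strict_mono r \<and> (AE \<omega> in M. (\<lambda>n. Z (Suc (r n), \<tau> (r n)) \<omega>) \<longlonglongrightarrow> stratonovich2 M f t T \<psi>1 \<psi>2 i1 i2 \<omega>)"
  proof (cases "i2 = 0")
    case True
    have "AE \<omega> in M. (\<lambda>n. Z (Suc n, \<tau> n) \<omega>) \<longlonglongrightarrow> stratonovich2 M f t T \<psi>1 \<psi>2 i1 i2 \<omega>"
      using stoch_int_continuous[OF i(1) \<psi>1]
    proof eventually_elim
      case (elim \<omega>)
      have c: "continuous_on {t..T} (\<lambda>s. \<psi>2 s * ?\<eta> s \<omega>)"
        by (intro continuous_intros elim C1_on_imp_continuous_on[OF \<psi>2])
      have "stratonovich2 M f t T \<psi>1 \<psi>2 i1 i2 \<omega> = integral {t..T} (\<lambda>s. \<psi>2 s * ?\<eta> s \<omega>)"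
        using True set_integral_continuous[OF c, of T] t_less_T by (simp add: stratonovich2_def)
      moreover have "Z (Suc n, \<tau> n) \<omega> = (\<Sum>j<Suc n. \<psi>2 (\<tau> n j) * ((?\<eta> (\<tau> n j) \<omega> + ?\<eta> (\<tau> n (Suc j)) \<omega>) / 2) * (\<tau> n (Suc j) - \<tau> n j))" for n
        using True by (simp add: Z_def stratonovich_sum_def wproc_def)
      ultimately show ?case
        using trapezoid_sum_tendsto[OF t_less_T C1_on_imp_continuous_on[OF \<psi>2] elim] by (simp only: \<tau>_def)
    qed
    then show ?thesis by (intro exI[of _ "\<lambda>n. n"]) (simp add: strict_mono_def)
  next
    case False
    define e where "e = stratonovich_error \<psi>1 \<psi>2"
    have K: "bounded_measurable \<mu>2 (volterra_kernel \<psi>1 \<psi>2)"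
      using \<psi>1 \<psi>2 by (intro bm_intros bm_continuous C1_on_imp_continuous_on)
    have Zb: "bilinear (lim_int i1) (lim_int i2) (stratonovich_kernel \<psi>1 \<psi>2 N \<tau>) (stratonovich_trace \<psi>1 \<psi>2 N \<tau>) (Z (N, \<tau>))"
      if "partition_of t T N \<tau>" for N \<tau>
      unfolding Z_def by (intro stratonovich_sum_bilinear i \<psi>1 that)
    have Zm: "Z (N, \<tau>) \<in> borel_measurable M" if "partition_of t T N \<tau>" for N \<tau>
      using bilinear_measurable[OF Zb[OF that]] lim_int_measurable by blast
    have ZZ: "mean_square M (\<lambda>\<omega>. Z (N, \<tau>) \<omega> - Z (N', \<tau>') \<omega>) \<le> ennreal (4 * ms_const * (e (N, \<tau>) + e (N', \<tau>')))"
      if "partition_of t T N \<tau>" "partition_of t T N' \<tau>'" for N \<tau> N' \<tau>'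
      unfolding e_def stratonovich_error_def prod.case
      by (rule bilinear_comparison[OF i Zb[OF that(1)] Zb[OF that(2)] K])
    have e_lim: "(e \<longlongrightarrow> 0) (mesh_to_0 t T)"
      unfolding e_def by (rule stratonovich_error_tendsto[OF \<psi>1 \<psi>2])
    have unif: "filterlim (\<lambda>n. (Suc n, \<tau> n)) (mesh_to_0 t T) sequentially"
      unfolding \<tau>_def by (rule filterlim_uniform_partition[OF t_less_T])
    have "(\<lambda>n. e (Suc n, \<tau> n)) \<longlonglongrightarrow> 0"
      by (rule filterlim_compose[OF e_lim unif])
    then have "(\<lambda>n. 4 * ms_const * e (Suc n, \<tau> n)) \<longlonglongrightarrow> 4 * ms_const * 0" by (intro tendsto_intros)
    \<comment> \<open>Uniform partitions form a Cauchy sequence because all sums share the target of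
      \<open>stratonovich_error\<close>. This yields a candidate limit \<open>Y\<close>.\<close>
    then have "\<exists>Y r. Y \<in> borel_measurable M \<and> (\<lambda>n. 4 * ms_const * e (Suc (r n), \<tau> (r n))) \<longlonglongrightarrow> 0 \<and>
        (AE \<omega> in M. (\<lambda>n. Z (Suc (r n), \<tau> (r n)) \<omega>) \<longlonglongrightarrow> Y \<omega>)"
      using ZZ[OF P P]
      by (intro mean_square_complete[of "\<lambda>n. Z (Suc n, \<tau> n)" "\<lambda>n. 4 * ms_const * e (Suc n, \<tau> n)"] Zm P)
         (auto simp: distrib_left)
    then obtain Y r where Y: "Y \<in> borel_measurable M" and er: "(\<lambda>n. 4 * ms_const * e (Suc (r n), \<tau> (r n))) \<longlonglongrightarrow> 0"
      and Yr: "AE \<omega> in M. (\<lambda>n. Z (Suc (r n), \<tau> (r n)) \<omega>) \<longlonglongrightarrow> Y \<omega>"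
      by blast
    \<comment> \<open>Fatou along the uniform partitions compares \<open>Y\<close> with the sum over
      an arbitrary partition, which gives convergence along the whole filter.\<close>
    have ZY: "mean_square M (\<lambda>\<omega>. Z (N, \<sigma>) \<omega> - Y \<omega>) \<le> ennreal (4 * ms_const * e (N, \<sigma>) + 0)"
      if "partition_of t T N \<sigma>" for N \<sigma>
    proof (rule mean_square_fatou[where X = "\<lambda>n \<omega>. Z (N, \<sigma>) \<omega> - Z (Suc (r n), \<tau> (r n)) \<omega>"
        and b = "\<lambda>n. 4 * ms_const * e (N, \<sigma>) + 4 * ms_const * e (Suc (r n), \<tau> (r n))"])
      show "(\<lambda>\<omega>. Z (N, \<sigma>) \<omega> - Z (Suc (r n), \<tau> (r n)) \<omega>) \<in> borel_measurable M" for n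
        by (intro borel_measurable_diff Zm that P)
      show "AE \<omega> in M. (\<lambda>n. Z (N, \<sigma>) \<omega> - Z (Suc (r n), \<tau> (r n)) \<omega>) \<longlonglongrightarrow> Z (N, \<sigma>) \<omega> - Y \<omega>"
        using Yr by eventually_elim (intro tendsto_intros)
      show "\<forall>\<^sub>F n in sequentially. mean_square M (\<lambda>\<omega>. Z (N, \<sigma>) \<omega> - Z (Suc (r n), \<tau> (r n)) \<omega>) \<le>
          ennreal (4 * ms_const * e (N, \<sigma>) + 4 * ms_const * e (Suc (r n), \<tau> (r n)))"
        using ZZ[OF that P] by (intro always_eventually allI) (simp add: distrib_left)
      show "(\<lambda>n. 4 * ms_const * e (N, \<sigma>) + 4 * ms_const * e (Suc (r n), \<tau> (r n))) \<longlonglongrightarrow> 4 * ms_const * e (N, \<sigma>) + 0"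
        by (intro tendsto_intros er)
    qed
    have "((\<lambda>x. mean_square M (\<lambda>\<omega>. Z x \<omega> - Y \<omega>)) \<longlongrightarrow> 0) (mesh_to_0 t T)"
    proof (rule tendsto_sandwich[OF _ _ tendsto_const])
      show "eventually (\<lambda>x. mean_square M (\<lambda>\<omega>. Z x \<omega> - Y \<omega>) \<le> ennreal (4 * ms_const * e x)) (mesh_to_0 t T)"
        unfolding eventually_mesh_to_0 using ZY by (intro exI[of _ 1]) auto
      have "((\<lambda>x. ennreal (4 * ms_const * e x)) \<longlongrightarrow> ennreal (4 * ms_const * 0)) (mesh_to_0 t T)"
        by (intro tendsto_intros e_lim)
      then show "((\<lambda>x. ennreal (4 * ms_const * e x)) \<longlongrightarrow> 0) (mesh_to_0 t T)" by simp
    qed simp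
    then have "ms_tendsto M Z Y (mesh_to_0 t T)" using Y by (simp add: ms_tendsto_def)
    \<comment> \<open>With a limit available, the chosen value is one as well; it need not be
      \<open>Y\<close> itself.\<close>
    then have "ms_tendsto M Z (SOME J. ms_tendsto M Z J (mesh_to_0 t T)) (mesh_to_0 t T)"
      by (rule someI[where P = "\<lambda>J. ms_tendsto M Z J (mesh_to_0 t T)"])
    then have "ms_tendsto M Z (stratonovich2 M f t T \<psi>1 \<psi>2 i1 i2) (mesh_to_0 t T)"
      using False by (simp add: stratonovich2_def Z_def)
    then have "ms_tendsto M (\<lambda>n. Z (Suc n, \<tau> n)) (stratonovich2 M f t T \<psi>1 \<psi>2 i1 i2) sequentially"
      unfolding ms_tendsto_def using filterlim_compose[OF _ unif] by blast
    from ms_tendsto_AE_subseq[OF Zm[OF P] this] show ?thesis by simp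
  qed
  then show ?thesis by (simp add: Z_def \<tau>_def)
qed

text \<open>The Stratonovich sums are compared with the Fourier sum and their own error is sent to
  zero; Fatou's lemma transfers the remaining bound to the integral.\<close>

lemma stratonovich2_fourier_error:
  assumes i: "i1 \<in> {0..m}" "i2 \<in> {0..m}" and \<psi>1: "C1_on t T \<psi>1" and \<psi>2: "C1_on t T \<psi>2"
  shows "mean_square M (\<lambda>\<omega>. stratonovich2 M f t T \<psi>1 \<psi>2 i1 i2 \<omega> -
      (\<Sum>j1\<le>p1. \<Sum>j2\<le>p2. fourier_coeff t T \<psi>1 \<psi>2 j2 j1 * (zeta M f t T i1 j1 \<omega> * zeta M f t T i2 j2 \<omega>))) \<le>
    ennreal (4 * ms_const * fourier_error \<psi>1 \<psi>2 p1 p2)"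
    (is "mean_square M (\<lambda>\<omega>. _ - ?S \<omega>) \<le> _")
proof -
  let ?\<eta> = "stoch_int M f i1 t T \<psi>1"
  obtain r where r: "strict_mono r" and lim: "AE \<omega> in M. (\<lambda>n. stratonovich_sum \<psi>2 ?\<eta> (wproc f i2)
      (Suc (r n), uniform_partition t T (Suc (r n))) \<omega>) \<longlonglongrightarrow> stratonovich2 M f t T \<psi>1 \<psi>2 i1 i2 \<omega>"
    using stratonovich2_AE_limit[OF assms] by blast
  define \<tau> where "\<tau> n = uniform_partition t T (Suc n)" for n
  define Z where "Z n = stratonovich_sum \<psi>2 ?\<eta> (wproc f i2) (Suc n, \<tau> n)" for n
  have P: "partition_of t T (Suc n) (\<tau> n)" for n
    unfolding \<tau>_def by (intro partition_of_uniform t_less_T) simp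
  define d where "d n = stratonovich_error \<psi>1 \<psi>2 (Suc n, \<tau> n)" for n
  note Zb = stratonovich_sum_bilinear[OF i \<psi>1 P, of \<psi>2, folded Z_def]
  note Sb = fourier_sum_bilinear[OF i, where ?\<psi>1.0 = \<psi>1 and ?\<psi>2.0 = \<psi>2 and ?p1.0 = p1 and ?p2.0 = p2]
  have K: "bounded_measurable \<mu>2 (volterra_kernel \<psi>1 \<psi>2)"
    using \<psi>1 \<psi>2 by (intro bm_intros bm_continuous C1_on_imp_continuous_on)
  have [measurable]: "Z n \<in> borel_measurable M" for n
    by (rule bilinear_measurable[OF Zb]; erule lim_int_measurable)
  have [measurable]: "?S \<in> borel_measurable M"
    by (rule bilinear_measurable[OF Sb]; erule lim_int_measurable)
  have ZS: "mean_square M (\<lambda>\<omega>. Z n \<omega> - ?S \<omega>) \<le> ennreal (4 * ms_const * (d n + fourier_error \<psi>1 \<psi>2 p1 p2))" for n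
    unfolding d_def stratonovich_error_def fourier_error_def prod.case by (rule bilinear_comparison[OF i Zb Sb K])
  have d0: "d \<longlonglongrightarrow> 0"
    unfolding d_def \<tau>_def
    by (rule filterlim_compose[OF stratonovich_error_tendsto[OF \<psi>1 \<psi>2] filterlim_uniform_partition[OF t_less_T]])
  have "mean_square M (\<lambda>\<omega>. stratonovich2 M f t T \<psi>1 \<psi>2 i1 i2 \<omega> - ?S \<omega>) \<le> ennreal (4 * ms_const * (0 + fourier_error \<psi>1 \<psi>2 p1 p2))"
  proof (rule mean_square_fatou[where X = "\<lambda>n \<omega>. Z (r n) \<omega> - ?S \<omega>" and b = "\<lambda>n. 4 * ms_const * (d (r n) + fourier_error \<psi>1 \<psi>2 p1 p2)"])
    show "AE \<omega> in M. (\<lambda>n. Z (r n) \<omega> - ?S \<omega>) \<longlonglongrightarrow> stratonovich2 M f t T \<psi>1 \<psi>2 i1 i2 \<omega> - ?S \<omega>"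
      using lim unfolding Z_def \<tau>_def by eventually_elim (intro tendsto_intros)
    show "(\<lambda>n. 4 * ms_const * (d (r n) + fourier_error \<psi>1 \<psi>2 p1 p2)) \<longlonglongrightarrow> 4 * ms_const * (0 + fourier_error \<psi>1 \<psi>2 p1 p2)"
      using LIMSEQ_subseq_LIMSEQ[OF d0 r] by (intro tendsto_intros) (simp add: comp_def)
    show "\<forall>\<^sub>F n in sequentially. mean_square M (\<lambda>\<omega>. Z (r n) \<omega> - ?S \<omega>) \<le> ennreal (4 * ms_const * (d (r n) + fourier_error \<psi>1 \<psi>2 p1 p2))"
      by (intro always_eventually allI ZS)
  qed simp
  then show ?thesis by simp
qed

end

theorem mainTheorem2:
  fixes M :: "'a measure" and F :: "real \<Rightarrow> 'a measure"
    and t T :: real and m i1 i2 :: nat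
    and f :: "nat \<Rightarrow> real \<Rightarrow> 'a \<Rightarrow> real"
    and \<psi>1 \<psi>2 :: "real \<Rightarrow> real"
  assumes "wiener_setting M F T m f"
    and "0 \<le> t" and "t < T"
    and "i1 \<in> {0..m}" and "i2 \<in> {0..m}"
    and "C2_on t T \<psi>1" and "C2_on t T \<psi>2"
  shows "(\<lambda>p1. limsup (\<lambda>p2. mean_square M (\<lambda>\<omega>.
            stratonovich2 M f t T \<psi>1 \<psi>2 i1 i2 \<omega> -
            (\<Sum>j1\<in>{0..p1}. \<Sum>j2\<in>{0..p2}.
               fourier_coeff t T \<psi>1 \<psi>2 j2 j1 * zeta M f t T i1 j1 \<omega> * zeta M f t T i2 j2 \<omega>))))
         \<longlonglongrightarrow> 0"
proof -
  interpret wiener_setting M F T m f by fact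
  interpret wiener_interval M F T m f t
    by unfold_locales fact+
  have C1: "C1_on t T \<psi>1" "C1_on t T \<psi>2" using assms by (auto intro: C2_on_imp_C1_on)
  obtain e where e: "e \<longlonglongrightarrow> 0" and lim: "\<And>p1. fourier_error \<psi>1 \<psi>2 p1 \<longlonglongrightarrow> e p1"
    using fourier_error_tendsto[OF C1] by blast
  let ?ms = "\<lambda>p1 p2. mean_square M (\<lambda>\<omega>. stratonovich2 M f t T \<psi>1 \<psi>2 i1 i2 \<omega> -
    (\<Sum>j1\<in>{0..p1}. \<Sum>j2\<in>{0..p2}. fourier_coeff t T \<psi>1 \<psi>2 j2 j1 * zeta M f t T i1 j1 \<omega> * zeta M f t T i2 j2 \<omega>))"
  \<comment> \<open>For fixed \<open>p1\<close> the bound converges as \<open>p2\<close> grows, so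
    the upper limit is at most a multiple of \<open>e p1\<close>.\<close>
  have ub: "limsup (?ms p1) \<le> ennreal (4 * ms_const * e p1)" for p1
  proof -
    have "limsup (?ms p1) \<le> limsup (\<lambda>p2. ennreal (4 * ms_const * fourier_error \<psi>1 \<psi>2 p1 p2))"
      unfolding atLeast0AtMost mult.assoc[of "fourier_coeff _ _ _ _ _ _"]
      by (intro Limsup_mono always_eventually allI stratonovich2_fourier_error assms C1)
    also have "\<dots> = ennreal (4 * ms_const * e p1)"
      by (intro lim_imp_Limsup tendsto_intros lim) simp
    finally show ?thesis .
  qed
  have "(\<lambda>p1. ennreal (4 * ms_const * e p1)) \<longlonglongrightarrow> ennreal (4 * ms_const * 0)"
    by (intro tendsto_intros e)
  then have "(\<lambda>p1. ennreal (4 * ms_const * e p1)) \<longlonglongrightarrow> 0" by simp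
  then show ?thesis
    by (rule tendsto_sandwich[OF always_eventually[OF allI[OF zero_le]] always_eventually[OF allI[OF ub]] tendsto_const])
qed

end
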